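(* Let $n,k\ge1$ and $M_k=H_*^T(Z)\cap\Delta(\mathbf{x})^{-k}\,S[y_1,\dots,y_n]\rtimes S_n$ (which equals $H_*^T(Z_k)$), where $\Delta(\mathbf x)=\prod_{i<j}(x_i-x_j)$. There is an action of $GL_2(\mathbb{C})$ on $M_k$ such that the diagonal torus action corresponds to the bigrading (with the degree in the $x$-variables shifted by $k\binom n2$, i.e. the bigrading of $\Delta(\mathbf{x})^kM_k$ by degrees in the $x$- and $y$-variables) and the involution $\begin{pmatrix}0&1\\1&0\end{pmatrix}$ satisfies, for $1\le i\le n$, $$\begin{pmatrix}0&1\\1&0\end{pmatrix}x_i\begin{pmatrix}0&1\\1&0\end{pmatrix}=y_i$$ as operators on $M_k$, where $x_i,y_i$ act by left multiplication.
   Context: $S=\mathbb{C}[x_1,\dots,x_n]$, $F=\mathbb{C}(x_1,\dots,x_n)$. $F[y_1,\dots,y_n]\rtimes S_n$ is the semidirect (smash) product algebra in which the $x_i$ and $y_j$ commute and $\sigma x_i=x_{\sigma(i)}\sigma$, $\sigma y_i=y_{\sigma(i)}\sigma$ for $\sigma\in S_n$. It is bigraded by the degree in the $x$-variables and the degree in the $y$-variables ($S_n$ in degree $0$). Geometrically, let $\mathcal{K}=\mathbb{C}((z))$, $\mathcal{O}=\mathbb{C}[[z]]$, and let $Y$ be the affine flag variety of $GL_n$, i.e. flags of $\mathcal{O}$-lattices $(V_i)_{i\in\mathbb{Z}}$ in $\mathcal{K}^n$ with $V_i\subset V_{i+1}$, $\dim V_{i+1}/V_i=1$, $V_i=zV_{i+n}$.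 $Z\subset Y$ is the locus with $\mathcal{O}e_i\subset V_n$ for all $1\le i\le n$; $Z_k\subset Z$ is the locus preserved by $\gamma_k=\mathrm{diag}(a_1z^k,\dots,a_nz^k)$ ($\gamma_kV_i\subset V_i$ for all $i$), with $a_i\in\mathbb{C}^*$ distinct. $H_*^T$ is equivariant Borel-Moore homology with complex coefficients for the diagonal torus $T=(\mathbb{C}^* )^n$. The $T$-fixed points of $Z$ are the affine permutations $w$ (bijections of $\mathbb{Z}$ with $w(i+n)=w(i)+n$) with $w(\mathbb{Z}_{\ge1})\subset\mathbb{Z}_{\ge1}$; these are exactly the elements $\mathbf{y}^{\mathbf m}\sigma$, $\mathbf{m}\in\mathbb{Z}_{\ge0}^n$, $\sigma\in S_n$, where $y_i$ denotes the affine permutation $i\mapsto i+n$ fixing all $j\not\equiv i$ mod $n$. Localization to fixed points embeds $H_*^T(Z_k)\subset H_*^T(Z)$ into $F[y_1,\dots,y_n]\rtimes S_n$. Under this embedding $H_*^T(Z)$ is the subalgebra generated by $A_i=\frac{1}{x_i-x_{i+1}}(1-s_i)$ ($1\le i\le n-1$, $s_i$ the simple transpositions) and $x_i,y_i$ ($1\le i\le n$). *)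

theory Defs
  imports
    "HOL-Library.Poly_Mapping"
    "HOL-Computational_Algebra.Fraction_Field"
    "HOL-Combinatorics.Perm"
    "HOL-Analysis.Analysis"
begin

unbundle permutation_syntax

text \<open>
  The index set \<open>{1,\<dots>,n}\<close> is rendered as a type \<open>'n\<close> of class \<open>{finite, linorder}\<close>, so that
  \<open>n = CARD('n) \<ge> 1\<close>; the order is needed for the simple transpositions and for \<open>\<Delta>\<close>.
  The symmetric group is the type \<open>'n perm\<close>.  A polynomial is a finitely supported function on
  exponent vectors, i.e. an element of the monoid algebra of \<open>'n \<Rightarrow>\<^sub>0 nat\<close>.
\<close>

type_synonym ('n, 'c) pol = "('n \<Rightarrow>\<^sub>0 nat) \<Rightarrow>\<^sub>0 'c"
type_synonym 'n polx = "('n, complex) pol"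
type_synonym 'n ratx = "'n polx fract"
type_synonym 'n ratx_poly = "('n, 'n ratx) pol"

definition to_ratx :: "'n::linorder polx \<Rightarrow> 'n ratx" where
  "to_ratx p = Fraction_Field.Fract p 1"

definition var :: "'n \<Rightarrow> ('n, 'c::zero_neq_one) pol" where
  "var i = Poly_Mapping.single (Poly_Mapping.single i 1) 1"

definition const :: "'c \<Rightarrow> ('n, 'c::zero) pol" where
  "const c = Poly_Mapping.single 0 c"

definition mdeg :: "('n::finite \<Rightarrow>\<^sub>0 nat) \<Rightarrow> nat" where
  "mdeg m = (\<Sum>i\<in>UNIV. Poly_Mapping.lookup m i)"


section \<open>Permutation of variables\<close>

definition perm_exp :: "'n perm \<Rightarrow> ('n \<Rightarrow>\<^sub>0 nat) \<Rightarrow> ('n \<Rightarrow>\<^sub>0 nat)" where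
  "perm_exp \<sigma> m = Poly_Mapping.map_key (apply (inverse \<sigma>)) m"

definition perm_pol :: "'n perm \<Rightarrow> ('n, 'c::zero) pol \<Rightarrow> ('n, 'c) pol" where
  "perm_pol \<sigma> p = Poly_Mapping.map_key (perm_exp (inverse \<sigma>)) p"

lemma inj_apply [simp]: "inj (apply \<sigma>)"
  by (simp add: bij_is_inj)

lemma lookup_perm_exp [simp]:
  "Poly_Mapping.lookup (perm_exp \<sigma> m) i = Poly_Mapping.lookup m (inverse \<sigma> \<langle>$\<rangle> i)"
  by (simp add: perm_exp_def map_key.rep_eq)

lemma perm_exp_1 [simp]: "perm_exp 1 m = m"
  by (rule poly_mapping_eqI) simp

lemma perm_exp_times: "perm_exp (\<sigma> * \<tau>) m = perm_exp \<sigma> (perm_exp \<tau> m)"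
  by (rule poly_mapping_eqI) (simp add: apply_sequence)

lemma perm_exp_inverse [simp]:
  "perm_exp (inverse \<sigma>) (perm_exp \<sigma> m) = m" "perm_exp \<sigma> (perm_exp (inverse \<sigma>) m) = m"
  by (simp_all flip: perm_exp_times)

lemma perm_exp_0 [simp]: "perm_exp \<sigma> 0 = 0"
  by (rule poly_mapping_eqI) simp

lemma perm_exp_add: "perm_exp \<sigma> (m + m') = perm_exp \<sigma> m + perm_exp \<sigma> m'"
  by (rule poly_mapping_eqI) (simp add: lookup_add)

lemma perm_exp_single: "perm_exp \<sigma> (Poly_Mapping.single i k) = Poly_Mapping.single (\<sigma> \<langle>$\<rangle> i) k"
proof (rule poly_mapping_eqI)
  fix j
  have "i = inverse \<sigma> \<langle>$\<rangle> j \<longleftrightarrow> \<sigma> \<langle>$\<rangle> i = j"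
    by (metis apply_sequence apply_one id_apply perm.right_inverse perm.left_inverse)
  then show "Poly_Mapping.lookup (perm_exp \<sigma> (Poly_Mapping.single i k)) j =
      Poly_Mapping.lookup (Poly_Mapping.single (\<sigma> \<langle>$\<rangle> i) k) j"
    by (simp add: lookup_single when_def)
qed

lemma inj_perm_exp [simp]: "inj (perm_exp \<sigma>)"
  by (metis injI perm_exp_inverse(1))

lemma lookup_perm_pol [simp]:
  "Poly_Mapping.lookup (perm_pol \<sigma> p) m = Poly_Mapping.lookup p (perm_exp (inverse \<sigma>) m)"
  by (simp add: perm_pol_def map_key.rep_eq)

lemma perm_pol_1 [simp]: "perm_pol 1 p = p"
  by (rule poly_mapping_eqI) simp

lemma perm_pol_times: "perm_pol (\<sigma> * \<tau>) p = perm_pol \<sigma> (perm_pol \<tau> p)"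
  by (rule poly_mapping_eqI) (simp add: perm_exp_times)

lemma perm_pol_0 [simp]: "perm_pol \<sigma> 0 = 0"
  by (rule poly_mapping_eqI) simp

lemma perm_pol_add: "perm_pol \<sigma> (p + q) = perm_pol \<sigma> p + perm_pol \<sigma> (q :: (_, _::monoid_add) pol)"
  by (rule poly_mapping_eqI) (simp add: lookup_add)

lemma perm_pol_single:
  "perm_pol \<sigma> (Poly_Mapping.single m c) = Poly_Mapping.single (perm_exp \<sigma> m) c"
proof (rule poly_mapping_eqI)
  fix m'
  have "m = perm_exp (inverse \<sigma>) m' \<longleftrightarrow> perm_exp \<sigma> m = m'"
    by (metis perm_exp_inverse)
  then show "Poly_Mapping.lookup (perm_pol \<sigma> (Poly_Mapping.single m c)) m' =
      Poly_Mapping.lookup (Poly_Mapping.single (perm_exp \<sigma> m) c) m'"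
    by (simp add: lookup_single when_def)
qed

lemma perm_pol_var: "perm_pol \<sigma> (var i) = var (\<sigma> \<langle>$\<rangle> i)"
  by (simp add: var_def perm_pol_single perm_exp_single)

lemma pol_induct [case_names zero add]:
  fixes p :: "'a \<Rightarrow>\<^sub>0 'b::monoid_add"
  assumes "P 0" and "\<And>m c p. P p \<Longrightarrow> P (Poly_Mapping.single m c + p)"
  shows "P p"
proof (induction p rule: update_induct)
  case const
  show ?case by (fact assms(1))
next
  case (update f a b)
  have "Poly_Mapping.update a b f = Poly_Mapping.single a b + f"
    using update(1)
    by (intro poly_mapping_eqI)
      (auto simp: lookup_update lookup_add lookup_single when_def in_keys_iff)
  with assms(2) update(3) show ?case by simp
qed

lemma perm_pol_mult: "perm_pol \<sigma> (p * q) = perm_pol \<sigma> p * perm_pol \<sigma> (q :: (_, _::semiring_0) pol)"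
proof (induction p rule: pol_induct)
  case zero
  show ?case by simp
next
  case (add m c p)
  have "perm_pol \<sigma> (Poly_Mapping.single m c * q) = perm_pol \<sigma> (Poly_Mapping.single m c) * perm_pol \<sigma> q"
    by (induction q rule: pol_induct)
      (simp_all add: algebra_simps perm_pol_add mult_single perm_pol_single perm_exp_add)
  with add show ?case by (simp add: algebra_simps perm_pol_add)
qed

lemma perm_pol_const [simp]: "perm_pol \<sigma> (const c) = const c"
  by (simp add: const_def perm_pol_single)

lemma perm_pol_one [simp]: "perm_pol \<sigma> 1 = (1 :: (_, _::zero_neq_one) pol)"
  by (simp add: perm_pol_single flip: single_one)

lemma perm_pol_eq_0_iff [simp]: "perm_pol \<sigma> p = 0 \<longleftrightarrow> p = 0"
  by (metis perm_pol_0 perm_pol_1 perm_pol_times perm.left_inverse)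

lift_definition perm_rat :: "'n::linorder perm \<Rightarrow> 'n ratx \<Rightarrow> 'n ratx"
  is "\<lambda>\<sigma> (a, b). (perm_pol \<sigma> a, perm_pol \<sigma> b)"
  by (auto simp flip: perm_pol_mult)

lemma perm_rat_Fract:
  "b \<noteq> 0 \<Longrightarrow>
    perm_rat \<sigma> (Fraction_Field.Fract a b) =
      Fraction_Field.Fract (perm_pol \<sigma> a) (perm_pol \<sigma> b)"
  by transfer auto

lemma perm_rat_1 [simp]: "perm_rat 1 q = q"
  by (cases q) (simp add: perm_rat_Fract)

lemma perm_rat_times: "perm_rat (\<sigma> * \<tau>) q = perm_rat \<sigma> (perm_rat \<tau> q)"
  by (cases q) (simp add: perm_rat_Fract perm_pol_times)

lemma perm_rat_0 [simp]: "perm_rat \<sigma> 0 = 0"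
  by (simp add: Zero_fract_def perm_rat_Fract)

lemma perm_rat_one [simp]: "perm_rat \<sigma> 1 = 1"
  by (simp add: One_fract_def perm_rat_Fract)

lemma perm_rat_add: "perm_rat \<sigma> (p + q) = perm_rat \<sigma> p + perm_rat \<sigma> q"
  by (cases p; cases q) (simp add: perm_rat_Fract perm_pol_add perm_pol_mult)

lemma perm_rat_mult: "perm_rat \<sigma> (p * q) = perm_rat \<sigma> p * perm_rat \<sigma> q"
  by (cases p; cases q) (simp add: perm_rat_Fract perm_pol_mult)

definition perm_ratpol :: "'n::linorder perm \<Rightarrow> 'n ratx_poly \<Rightarrow> 'n ratx_poly" where
  "perm_ratpol \<sigma> f = Poly_Mapping.map (perm_rat \<sigma>) (perm_pol \<sigma> f)"

lemma lookup_perm_ratpol [simp]: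
  "Poly_Mapping.lookup (perm_ratpol \<sigma> f) m =
     perm_rat \<sigma> (Poly_Mapping.lookup f (perm_exp (inverse \<sigma>) m))"
  by (simp add: perm_ratpol_def map.rep_eq when_def)

lemma perm_ratpol_1 [simp]: "perm_ratpol 1 f = f"
  by (rule poly_mapping_eqI) simp

lemma perm_ratpol_times: "perm_ratpol (\<sigma> * \<tau>) f = perm_ratpol \<sigma> (perm_ratpol \<tau> f)"
  by (rule poly_mapping_eqI) (simp add: perm_exp_times perm_rat_times)

lemma perm_ratpol_0 [simp]: "perm_ratpol \<sigma> 0 = 0"
  by (rule poly_mapping_eqI) simp

lemma perm_ratpol_add: "perm_ratpol \<sigma> (f + g) = perm_ratpol \<sigma> f + perm_ratpol \<sigma> g"
  by (rule poly_mapping_eqI) (simp add: lookup_add perm_rat_add)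

lemma perm_ratpol_sum: "perm_ratpol \<sigma> (sum f A) = (\<Sum>a\<in>A. perm_ratpol \<sigma> (f a))"
  by (induction A rule: infinite_finite_induct) (simp_all add: perm_ratpol_add)

lemma perm_ratpol_single:
  "perm_ratpol \<sigma> (Poly_Mapping.single m c) = Poly_Mapping.single (perm_exp \<sigma> m) (perm_rat \<sigma> c)"
  by (simp add: perm_ratpol_def perm_pol_single)

lemma perm_ratpol_mult: "perm_ratpol \<sigma> (f * g) = perm_ratpol \<sigma> f * perm_ratpol \<sigma> g"
proof (induction f rule: pol_induct)
  case zero
  show ?case by simp
next
  case (add m c f)
  have "perm_ratpol \<sigma> (Poly_Mapping.single m c * g) =
      perm_ratpol \<sigma> (Poly_Mapping.single m c) * perm_ratpol \<sigma> g"
    by (induction g rule: pol_induct)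
      (simp_all add: algebra_simps perm_ratpol_add mult_single perm_ratpol_single
        perm_exp_add perm_rat_mult)
  with add show ?case by (simp add: algebra_simps perm_ratpol_add)
qed

lemma perm_ratpol_one [simp]: "perm_ratpol \<sigma> 1 = 1"
  by (simp add: perm_ratpol_single flip: single_one)


section \<open>The smash product of \<open>F[y]\<close> with the symmetric group\<close>

text \<open>
  The function \<open>f\<close> stands for \<open>\<Sum>\<^bsub>\<sigma>\<^esub> f \<sigma> \<cdot> \<sigma>\<close>, coefficients on the left.
\<close>

typedef (overloaded) 'n smash = "UNIV :: ('n::linorder perm \<Rightarrow> 'n ratx_poly) set"
  morphisms smash_coeff Smash ..

lemma smash_coeff_Smash [simp]: "smash_coeff (Smash f) = f"
  by (simp add: Smash_inverse)

lemma smash_eqI: "(\<And>\<sigma>. smash_coeff a \<sigma> = smash_coeff b \<sigma>) \<Longrightarrow> a = b"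
  by (metis smash_coeff_inject ext)

instance perm :: (finite) finite
proof
  have "inj (apply :: 'a perm \<Rightarrow> 'a \<Rightarrow> 'a)"
    by (simp add: inj_def apply_inject)
  then show "finite (UNIV :: 'a perm set)"
    using finite_imageD[of "apply" UNIV] by (metis finite finite_code)
qed

instantiation smash :: ("{finite, linorder}") ring_1
begin

definition zero_smash :: "'a smash" where
  "zero_smash = Smash (\<lambda>_. 0)"

definition one_smash :: "'a smash" where
  "one_smash = Smash (\<lambda>\<sigma>. if \<sigma> = 1 then 1 else 0)"

definition plus_smash :: "'a smash \<Rightarrow> 'a smash \<Rightarrow> 'a smash" where
  "a + b = Smash (\<lambda>\<sigma>. smash_coeff a \<sigma> + smash_coeff b \<sigma>)"

definition uminus_smash :: "'a smash \<Rightarrow> 'a smash" where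
  "- a = Smash (\<lambda>\<sigma>. - smash_coeff a \<sigma>)"

definition minus_smash :: "'a smash \<Rightarrow> 'a smash \<Rightarrow> 'a smash" where
  "a - b = Smash (\<lambda>\<sigma>. smash_coeff a \<sigma> - smash_coeff b \<sigma>)"

text \<open>\<open>(f \<sigma>) (g \<tau>) = f \<sigma>(g) (\<sigma>\<tau>)\<close>, collected at \<open>\<rho> = \<sigma>\<tau>\<close>.\<close>

definition times_smash :: "'a smash \<Rightarrow> 'a smash \<Rightarrow> 'a smash" where
  "a * b = Smash (\<lambda>\<rho>. \<Sum>\<sigma>\<in>UNIV. smash_coeff a \<sigma> * perm_ratpol \<sigma> (smash_coeff b (inverse \<sigma> * \<rho>)))"

instance
proof
  fix a b c :: "'a smash"
  show "a * b * c = a * (b * c)"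
  proof (rule smash_eqI)
    fix \<rho> :: "'a perm"
    have bij: "bij (\<lambda>\<sigma>. inverse \<tau> * \<sigma>)" for \<tau> :: "'a perm"
      by (rule o_bij[where g = "\<lambda>\<sigma>. \<tau> * \<sigma>"]) (auto simp: fun_eq_iff simp flip: mult.assoc)
    have "smash_coeff (a * (b * c)) \<rho> = (\<Sum>\<tau>\<in>UNIV. smash_coeff a \<tau> * perm_ratpol \<tau>
        (\<Sum>\<mu>\<in>UNIV. smash_coeff b \<mu> * perm_ratpol \<mu> (smash_coeff c (inverse \<mu> * (inverse \<tau> * \<rho>)))))"
      by (simp add: times_smash_def)
    also have "\<dots> = (\<Sum>\<tau>\<in>UNIV. \<Sum>\<mu>\<in>UNIV. smash_coeff a \<tau> * perm_ratpol \<tau> (smash_coeff b \<mu>) *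
        perm_ratpol (\<tau> * \<mu>) (smash_coeff c (inverse (\<tau> * \<mu>) * \<rho>)))"
      by (simp add: perm_ratpol_sum perm_ratpol_mult sum_distrib_left perm_ratpol_times mult.assoc)
    also have "\<dots> = (\<Sum>\<tau>\<in>UNIV. \<Sum>\<sigma>\<in>UNIV. smash_coeff a \<tau> * perm_ratpol \<tau> (smash_coeff b (inverse \<tau> * \<sigma>)) *
        perm_ratpol \<sigma> (smash_coeff c (inverse \<sigma> * \<rho>)))"
    proof (rule sum.cong[OF refl])
      fix \<tau> :: "'a perm"
      show "(\<Sum>\<mu>\<in>UNIV. smash_coeff a \<tau> * perm_ratpol \<tau> (smash_coeff b \<mu>) *
          perm_ratpol (\<tau> * \<mu>) (smash_coeff c (inverse (\<tau> * \<mu>) * \<rho>))) =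
        (\<Sum>\<sigma>\<in>UNIV. smash_coeff a \<tau> * perm_ratpol \<tau> (smash_coeff b (inverse \<tau> * \<sigma>)) *
          perm_ratpol \<sigma> (smash_coeff c (inverse \<sigma> * \<rho>)))"
        by (subst sum.reindex_bij_betw[OF bij[of \<tau>], symmetric])
          (simp flip: mult.assoc)
    qed
    also have "\<dots> = smash_coeff (a * b * c) \<rho>"
      by (simp add: times_smash_def sum_distrib_right)
        (rule sum.swap)
    finally show "smash_coeff (a * b * c) \<rho> = smash_coeff (a * (b * c)) \<rho>" ..
  qed
  show "1 * a = a"
    by (rule smash_eqI) (simp add: times_smash_def one_smash_def if_distrib[where f = "\<lambda>x. x * _"]
        cong: if_cong)
  show "a * 1 = a"
  proof (rule smash_eqI)
    fix \<rho> :: "'a perm"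
    have "inverse \<sigma> * \<rho> = 1 \<longleftrightarrow> \<sigma> = \<rho>" for \<sigma>
    proof
      assume "inverse \<sigma> * \<rho> = 1"
      then have "\<sigma> * (inverse \<sigma> * \<rho>) = \<sigma>" by simp
      then show "\<sigma> = \<rho>" by (simp flip: mult.assoc)
    qed simp
    then have "smash_coeff (a * 1) \<rho> = (\<Sum>\<sigma>\<in>UNIV. if \<sigma> = \<rho> then smash_coeff a \<sigma> else 0)"
      unfolding times_smash_def smash_coeff_Smash one_smash_def by (intro sum.cong) auto
    then show "smash_coeff (a * 1) \<rho> = smash_coeff a \<rho>" by simp
  qed
  show "(a + b) * c = a * c + b * c"
    by (rule smash_eqI) (simp add: times_smash_def plus_smash_def algebra_simps sum.distrib)
  show "a * (b + c) = a * b + a * c"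
    by (rule smash_eqI)
      (simp add: times_smash_def plus_smash_def perm_ratpol_add algebra_simps sum.distrib)
  show "(0::'a smash) \<noteq> 1"
  proof
    assume "(0::'a smash) = 1"
    then have "smash_coeff (0::'a smash) 1 = smash_coeff 1 1" by simp
    then show False by (simp add: zero_smash_def one_smash_def)
  qed
qed (auto intro!: smash_eqI simp: zero_smash_def plus_smash_def uminus_smash_def minus_smash_def
    algebra_simps)

end

definition of_ratpol :: "'n ratx_poly \<Rightarrow> 'n::linorder smash" where
  "of_ratpol f = Smash (\<lambda>\<sigma>. if \<sigma> = 1 then f else 0)"

definition of_ratx :: "'n ratx \<Rightarrow> 'n::linorder smash" where
  "of_ratx q = of_ratpol (const q)"

definition of_pol :: "'n::linorder polx \<Rightarrow> 'n smash" where
  "of_pol p = of_ratx (to_ratx p)"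

definition of_cplx :: "complex \<Rightarrow> 'n::linorder smash" where
  "of_cplx c = of_pol (const c)"

definition of_perm :: "'n perm \<Rightarrow> 'n::linorder smash" where
  "of_perm \<sigma> = Smash (\<lambda>\<tau>. if \<tau> = \<sigma> then 1 else 0)"

definition xvar :: "'n \<Rightarrow> 'n::linorder smash" where
  "xvar i = of_pol (var i)"

definition yvar :: "'n \<Rightarrow> 'n::linorder smash" where
  "yvar i = of_ratpol (var i)"

lemma coeff_of_perm_times:
  "smash_coeff (of_perm \<sigma> * a) \<rho> = perm_ratpol \<sigma> (smash_coeff a (inverse \<sigma> * \<rho>))"
  for a :: "'n::{finite,linorder} smash"
proof -
  have "smash_coeff (of_perm \<sigma> * a) \<rho> =
      (\<Sum>\<tau>\<in>UNIV. if \<tau> = \<sigma> then perm_ratpol \<tau> (smash_coeff a (inverse \<tau> * \<rho>)) else 0)"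
    unfolding times_smash_def smash_coeff_Smash of_perm_def by (intro sum.cong) auto
  then show ?thesis by simp
qed

lemma coeff_of_ratpol_times: "smash_coeff (of_ratpol f * a) \<rho> = f * smash_coeff a \<rho>"
  for a :: "'n::{finite,linorder} smash"
proof -
  have "smash_coeff (of_ratpol f * a) \<rho> =
      (\<Sum>\<tau>\<in>UNIV. if \<tau> = 1 then f * perm_ratpol \<tau> (smash_coeff a (inverse \<tau> * \<rho>)) else 0)"
    unfolding times_smash_def smash_coeff_Smash of_ratpol_def by (intro sum.cong) auto
  then show ?thesis by simp
qed

lemma of_ratpol_mult: "of_ratpol f * of_ratpol g = (of_ratpol (f * g) :: 'n::{finite,linorder} smash)"
  by (rule smash_eqI) (simp add: coeff_of_ratpol_times, simp add: of_ratpol_def)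

lemma of_perm_mult: "of_perm \<sigma> * of_perm \<tau> = (of_perm (\<sigma> * \<tau>) :: 'n::{finite,linorder} smash)"
proof (rule smash_eqI)
  fix \<rho> :: "'n perm"
  have "inverse \<sigma> * \<rho> = \<tau> \<longleftrightarrow> \<rho> = \<sigma> * \<tau>"
  proof
    assume "inverse \<sigma> * \<rho> = \<tau>"
    then have "\<sigma> * (inverse \<sigma> * \<rho>) = \<sigma> * \<tau>" by simp
    then show "\<rho> = \<sigma> * \<tau>" by (simp flip: mult.assoc)
  next
    assume "\<rho> = \<sigma> * \<tau>"
    then show "inverse \<sigma> * \<rho> = \<tau>" by (simp flip: mult.assoc)
  qed
  then show "smash_coeff (of_perm \<sigma> * of_perm \<tau>) \<rho> = smash_coeff (of_perm (\<sigma> * \<tau>)) \<rho>"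
    by (simp add: coeff_of_perm_times) (simp add: of_perm_def)
qed

lemma of_perm_of_ratpol:
  "of_perm \<sigma> * of_ratpol f = of_ratpol (perm_ratpol \<sigma> f) * (of_perm \<sigma> :: 'n::{finite,linorder} smash)"
proof (rule smash_eqI)
  fix \<rho> :: "'n perm"
  have "inverse \<sigma> * \<rho> = 1 \<longleftrightarrow> \<rho> = \<sigma>"
  proof
    assume "inverse \<sigma> * \<rho> = 1"
    then have "\<sigma> * (inverse \<sigma> * \<rho>) = \<sigma>" by simp
    then show "\<rho> = \<sigma>" by (simp flip: mult.assoc)
  qed simp
  then show "smash_coeff (of_perm \<sigma> * of_ratpol f) \<rho> =
      smash_coeff (of_ratpol (perm_ratpol \<sigma> f) * of_perm \<sigma>) \<rho>"
    by (simp add: coeff_of_perm_times coeff_of_ratpol_times) (simp add: of_ratpol_def of_perm_def)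
qed

lemma perm_xvar: "of_perm \<sigma> * xvar i = xvar (\<sigma> \<langle>$\<rangle> i) * (of_perm \<sigma> :: 'n::{finite,linorder} smash)"
  by (simp add: xvar_def of_pol_def of_ratx_def of_perm_of_ratpol const_def perm_ratpol_single
      to_ratx_def perm_rat_Fract perm_pol_var)

lemma perm_yvar: "of_perm \<sigma> * yvar i = yvar (\<sigma> \<langle>$\<rangle> i) * (of_perm \<sigma> :: 'n::{finite,linorder} smash)"
  by (simp add: yvar_def of_perm_of_ratpol var_def perm_ratpol_single perm_exp_single)

lemma xvar_yvar_commute: "xvar i * yvar j = yvar j * (xvar i :: 'n::{finite,linorder} smash)"
  by (simp add: xvar_def yvar_def of_pol_def of_ratx_def of_ratpol_mult mult.commute)


section \<open>The module \<open>M\<^sub>k\<close>\<close>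

definition covers :: "'n::linorder \<Rightarrow> 'n \<Rightarrow> bool" where
  "covers i j \<longleftrightarrow> i < j \<and> \<not> (\<exists>l. i < l \<and> l < j)"

text \<open>\<open>A\<^sub>i\<close> is \<open>demazure i j\<close> for \<open>j = i + 1\<close>, i.e. when \<open>covers i j\<close>.\<close>

definition demazure :: "'n \<Rightarrow> 'n \<Rightarrow> 'n::{finite,linorder} smash" where
  "demazure i j = of_ratx (1 / to_ratx (var i - var j)) * (1 - of_perm \<langle>i \<leftrightarrow> j\<rangle>)"

definition csubalgebra :: "'n::{finite,linorder} smash set \<Rightarrow> bool" where
  "csubalgebra U \<longleftrightarrow> 1 \<in> U \<and> (\<forall>a\<in>U. \<forall>b\<in>U. a + b \<in> U \<and> a * b \<in> U) \<and>
     (\<forall>c. \<forall>a\<in>U. of_cplx c * a \<in> U)"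

text \<open>
  The image of the equivariant Borel-Moore homology \<open>H\<^sub>*\<^sup>T(Z)\<close> in the smash product under
  localization to the torus fixed points, through its description by algebra generators.
\<close>

definition HTZ :: "'n::{finite,linorder} smash set" where
  "HTZ = csubalgebra hull ({demazure i j |i j. covers i j} \<union> range xvar \<union> range yvar)"

definition polynomial_part :: "'n::linorder smash set" where
  "polynomial_part = {w. \<forall>\<sigma> m. \<exists>p. Poly_Mapping.lookup (smash_coeff w \<sigma>) m = to_ratx p}"

definition vandermonde :: "'n::{finite,linorder} polx" where
  "vandermonde = (\<Prod>(i, j)\<in>{(i, j). i < j}. var i - var j)"

definition M_mod :: "nat \<Rightarrow> 'n::{finite,linorder} smash set" where
  "M_mod k = HTZ \<inter> (\<lambda>w. of_ratx (1 / to_ratx (vandermonde ^ k)) * w) ` polynomial_part"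


lemma to_ratx_add: "to_ratx p + to_ratx q = to_ratx (p + q)"
  by (simp add: to_ratx_def)

lemma to_ratx_mult: "to_ratx p * to_ratx q = to_ratx (p * q)"
  by (simp add: to_ratx_def)

lemma to_ratx_0: "to_ratx 0 = 0"
  by (simp add: to_ratx_def Zero_fract_def)

lemma to_ratx_1: "to_ratx 1 = 1"
  by (simp add: to_ratx_def One_fract_def)

lemma range_to_ratx_sum: "(\<And>a. f a \<in> range to_ratx) \<Longrightarrow> sum f A \<in> range to_ratx"
proof (induction A rule: infinite_finite_induct)
  case (insert a A)
  then obtain p q where "f a = to_ratx p" "sum f A = to_ratx q" by blast
  with insert show ?case by (simp add: to_ratx_add)
qed (simp_all flip: to_ratx_0)

lemma polynomial_part_times:
  fixes w :: "'n::{finite,linorder} smash"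
  assumes f: "\<And>m. Poly_Mapping.lookup f m \<in> range to_ratx" and w: "w \<in> polynomial_part"
  shows "of_ratpol f * w \<in> polynomial_part"
proof -
  have w': "Poly_Mapping.lookup (smash_coeff w \<sigma>) m \<in> range to_ratx" for \<sigma> m
    using w unfolding polynomial_part_def by blast
  have "Poly_Mapping.lookup (f * smash_coeff w \<sigma>) m \<in> range to_ratx" for \<sigma> m
  proof -
    have *: "(Poly_Mapping.lookup (smash_coeff w \<sigma>) q when m = l + q) \<in> range to_ratx" for l q
      using w' by (auto simp: when_def simp flip: to_ratx_0)
    have "Poly_Mapping.lookup f l *
        (\<Sum>q. Poly_Mapping.lookup (smash_coeff w \<sigma>) q when m = l + q) \<in> range to_ratx" for l
    proof -
      have "(\<Sum>q. Poly_Mapping.lookup (smash_coeff w \<sigma>) q when m = l + q) \<in> range to_ratx"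
        unfolding Sum_any.expand_set by (rule range_to_ratx_sum) (rule *)
      with f[of l] show ?thesis by (auto simp: to_ratx_mult)
    qed
    then show ?thesis
      unfolding times_poly_mapping.rep_eq prod_fun_def Sum_any.expand_set[of "\<lambda>l. _ l * _ l"]
      by (rule range_to_ratx_sum)
  qed
  then show ?thesis
    by (simp add: polynomial_part_def coeff_of_ratpol_times) blast
qed

lemma csubalgebra_HTZ: "csubalgebra HTZ"
  unfolding HTZ_def by (rule hull_in) (auto simp: csubalgebra_def)

lemma of_ratpol_times_M_mod:
  fixes v :: "'n::{finite,linorder} smash"
  assumes "\<And>m. Poly_Mapping.lookup f m \<in> range to_ratx" "of_ratpol f \<in> (HTZ :: 'n smash set)"
    and "v \<in> M_mod k"
  shows "of_ratpol f * v \<in> M_mod k"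
proof -
  let ?d = "of_ratx (1 / to_ratx (vandermonde ^ k)) :: 'n smash"
  obtain w where w: "w \<in> polynomial_part" "v = ?d * w" and v: "v \<in> HTZ"
    using assms(3) by (auto simp: M_mod_def)
  have "of_ratpol f * v = ?d * (of_ratpol f * w)"
    unfolding w(2) of_ratx_def by (simp add: of_ratpol_mult mult.commute flip: mult.assoc)
  moreover have "of_ratpol f * v \<in> HTZ"
    using csubalgebra_HTZ assms(2) v by (auto simp: csubalgebra_def)
  ultimately show ?thesis
    using polynomial_part_times[OF assms(1) w(1)] by (auto simp: M_mod_def)
qed

lemma xvar_times_M_mod: "v \<in> M_mod k \<Longrightarrow> xvar i * v \<in> M_mod k"
proof -
  assume v: "v \<in> M_mod k"
  have "xvar i \<in> HTZ" unfolding HTZ_def by (rule hull_inc) auto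
  then show ?thesis unfolding xvar_def of_pol_def of_ratx_def
    by (intro of_ratpol_times_M_mod v)
      (auto simp: const_def lookup_single when_def simp flip: to_ratx_0)
qed

lemma yvar_times_M_mod: "v \<in> M_mod k \<Longrightarrow> yvar i * v \<in> M_mod k"
proof -
  assume v: "v \<in> M_mod k"
  have "yvar i \<in> HTZ" unfolding HTZ_def by (rule hull_inc) auto
  then show ?thesis unfolding yvar_def
    by (intro of_ratpol_times_M_mod v)
      (auto simp: var_def lookup_single when_def simp flip: to_ratx_0 to_ratx_1)
qed


section \<open>The bigrading and \<open>GL\<^sub>2\<close>-actions\<close>

definition homogeneous :: "nat \<Rightarrow> 'n::finite polx \<Rightarrow> bool" where
  "homogeneous a p \<longleftrightarrow> (\<forall>m\<in>Poly_Mapping.keys p. mdeg m = a)"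

definition bihomogeneous :: "nat \<Rightarrow> nat \<Rightarrow> 'n::{finite,linorder} smash \<Rightarrow> bool" where
  "bihomogeneous a b w \<longleftrightarrow>
     (\<forall>\<sigma>. \<forall>m\<in>Poly_Mapping.keys (smash_coeff w \<sigma>).
        mdeg m = b \<and> (\<exists>p. homogeneous a p \<and> Poly_Mapping.lookup (smash_coeff w \<sigma>) m = to_ratx p))"

text \<open>
  The bidegrees are those of \<open>\<Delta>\<^sup>k v\<close>, so the degree in the \<open>x\<close>-variables of \<open>v\<close> itself is
  \<open>a - k (n choose 2)\<close>.
\<close>

definition M_bideg :: "nat \<Rightarrow> nat \<Rightarrow> nat \<Rightarrow> 'n::{finite,linorder} smash set" where
  "M_bideg k a b = {v \<in> M_mod k. bihomogeneous a b (of_pol (vandermonde ^ k) * v)}"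

definition mat2 :: "complex \<Rightarrow> complex \<Rightarrow> complex \<Rightarrow> complex \<Rightarrow> complex^2^2" where
  "mat2 a b c d = vector [vector [a, b], vector [c, d]]"

definition GL2_action ::
    "'n::{finite,linorder} smash set \<Rightarrow> (complex^2^2 \<Rightarrow> 'n smash \<Rightarrow> 'n smash) \<Rightarrow> bool" where
  "GL2_action V \<rho> \<longleftrightarrow>
     (\<forall>g. invertible g \<longrightarrow>
        (\<forall>v\<in>V. \<rho> g v \<in> V) \<and>
        (\<forall>v\<in>V. \<forall>w\<in>V. \<rho> g (v + w) = \<rho> g v + \<rho> g w) \<and>
        (\<forall>c. \<forall>v\<in>V. \<rho> g (of_cplx c * v) = of_cplx c * \<rho> g v)) \<and>
     (\<forall>v\<in>V. \<rho> (mat 1) v = v) \<and>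
     (\<forall>g h. invertible g \<longrightarrow> invertible h \<longrightarrow> (\<forall>v\<in>V. \<rho> (g ** h) v = \<rho> g (\<rho> h v)))"

text \<open>
  The diagonal torus acts through the bigrading: \<open>M_mod k\<close> is the sum of its bihomogeneous pieces,
  and the piece of bidegree \<open>(a, b)\<close> is exactly the weight space of the character
  \<open>diag(t, u) \<mapsto> t\<^sup>a u\<^sup>b\<close>.  No rationality of the action has to be required: since the
  pieces of fixed total degree are finite-dimensional and the diagonal torus acts on them
  algebraically, it is automatic.
\<close>

definition torus_bigrading ::
    "nat \<Rightarrow> (complex^2^2 \<Rightarrow> 'n::{finite,linorder} smash \<Rightarrow> 'n smash) \<Rightarrow> bool" where
  "torus_bigrading k \<rho> \<longleftrightarrow>
     (\<forall>a b. M_bideg k a b =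
        {v \<in> M_mod k. \<forall>t u. t \<noteq> 0 \<longrightarrow> u \<noteq> 0 \<longrightarrow> \<rho> (mat2 t 0 0 u) v = of_cplx (t ^ a * u ^ b) * v}) \<and>
     (\<forall>v\<in>(M_mod k :: 'n smash set). \<exists>D f. finite D \<and> (\<forall>(a, b)\<in>D. f a b \<in> M_bideg k a b) \<and> v = (\<Sum>(a, b)\<in>D. f a b))"

end

theory Submission
  imports Defs
begin

text \<open>
  Multiplication by \<open>\<Delta>\<^sup>k\<close> identifies \<open>M\<^sub>k\<close> with a subspace of \<open>\<complex>[x,y] \<rtimes> S\<^sub>n\<close>, on which \<open>GL\<^sub>2\<close> acts by
  linear substitutions mixing each \<open>x\<^sub>i\<close> with \<open>y\<^sub>i\<close>.  This subspace is stable because it is cut out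
  by invariant conditions: \<open>\<Sum> r\<^sub>\<sigma> \<sigma>\<close> belongs to it iff, for every transposition \<open>s = (i j)\<close> with
  ideal \<open>J = (x\<^sub>i - x\<^sub>j, y\<^sub>i - y\<^sub>j)\<close>, one has \<open>r\<^sub>\<sigma> \<in> J\<^bsup>k-1\<^esup>\<close> and \<open>r\<^sub>\<sigma> + r\<^bsub>s\<sigma>\<^esub> \<in> J\<^sup>k\<close>.

  The conditions are necessary because their localized form is preserved under left
  multiplication by the generators of the algebra.  For sufficiency, the symmetrizer
  \<open>\<omega> = (\<Sum> \<sigma>) \<Delta>\<^sup>-\<^sup>1\<close> satisfies \<open>v p \<omega> = v(p) \<omega>\<close>, and \<open>1\<close> lies in \<open>\<complex>[x] \<omega> \<complex>[x]\<close>; so only the elements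
  \<open>v(p) = \<Delta>\<^sup>-\<^sup>k R\<close> with \<open>R\<close> in every \<open>J\<^sup>k\<close> matter.  Writing \<open>y\<^sub>i = \<phi>(x\<^sub>i)\<close> for the Newton interpolation
  polynomial \<open>\<phi>\<close>, whose coefficients are divided differences and lie in the algebra, turns \<open>R\<close> into a
  polynomial divisible by all \<open>(x\<^sub>i - x\<^sub>j)\<^sup>k\<close>, hence by \<open>\<Delta>\<^sup>k\<close>.
\<close>

section \<open>Polynomials in two sets of variables\<close>

text \<open>The generators treat x and y differently, so an action of GL_2 cannot be read off from
  them; this forces a description by conditions in which x and y play the same role. The exponents
  record what the operators \<open>demazure\<close> do: a coefficient may acquire a simple pole
  along x_i = x_j, but the polar parts at \<sigma> and s\<sigma> cancel. After multiplication by
  \<Delta>^k the pole costs one power of J, and the sum costs none. Passing from v to v(p) regains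
  the lost power, because p - s(p) vanishes on the diagonal. The remaining obstacle is that J cuts
  out a locus of codimension two. It is not principal, so lying in every J^k does not mean
  divisibility by \<Delta>^k. Interpolation removes this: \<phi>(x_i) - \<phi>(x_j) is a multiple of
  x_i - x_j, so the image of J is generated by x_i - x_j alone. The order of vanishing along the
  locus is additive on products and so extends to quotients, which is what gives the localized
  conditions a meaning. For this reason it is measured by a substitution into polynomials in one
  variable T.\<close>

definition rhom :: "('a::comm_ring_1 \<Rightarrow> 'b::comm_ring_1) \<Rightarrow> bool" where
  "rhom h \<longleftrightarrow> h 1 = 1 \<and> (\<forall>a b. h (a + b) = h a + h b) \<and> (\<forall>a b. h (a * b) = h a * h b)"

lemma rhomI:
  assumes "h 1 = 1" "\<And>a b. h (a + b) = h a + h b" "\<And>a b. h (a * b) = h a * h b"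
  shows "rhom h"
  using assms by (simp add: rhom_def)

lemma rhom_1: "rhom h \<Longrightarrow> h 1 = 1"
  and rhom_add: "rhom h \<Longrightarrow> h (a + b) = h a + h b"
  and rhom_mult: "rhom h \<Longrightarrow> h (a * b) = h a * h b"
  by (simp_all add: rhom_def)

lemma rhom_0: "rhom h \<Longrightarrow> h 0 = 0"
  using rhom_add[of h 0 0] by simp

lemma rhom_uminus: "rhom h \<Longrightarrow> h (- a) = - h a"
  using rhom_add[of h a "- a"] by (simp add: rhom_0 eq_neg_iff_add_eq_0 add.commute)

lemma rhom_diff: "rhom h \<Longrightarrow> h (a - b) = h a - h b"
  using rhom_add[of h a "- b"] by (simp add: rhom_uminus)

lemma rhom_sum: "rhom h \<Longrightarrow> h (sum f A) = (\<Sum>a\<in>A. h (f a))"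
  by (induction A rule: infinite_finite_induct) (simp_all add: rhom_0 rhom_add)

lemma rhom_prod: "rhom h \<Longrightarrow> h (prod f A) = (\<Prod>a\<in>A. h (f a))"
  by (induction A rule: infinite_finite_induct) (simp_all add: rhom_1 rhom_mult)

lemma rhom_power: "rhom h \<Longrightarrow> h (a ^ k) = h a ^ k"
  by (induction k) (simp_all add: rhom_1 rhom_mult)

lemma rhom_dvd: "rhom h \<Longrightarrow> a dvd b \<Longrightarrow> h a dvd h b"
  by (auto simp: dvd_def rhom_mult)

lemma rhom_comp: "rhom g \<Longrightarrow> rhom h \<Longrightarrow> rhom (\<lambda>a. g (h a))"
  by (simp add: rhom_def)

lemma rhom_id: "rhom (\<lambda>a. a)"
  by (simp add: rhom_def)

lemmas rhom_simps = rhom_0 rhom_1 rhom_add rhom_mult rhom_uminus rhom_diff rhom_sum rhom_prod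
  rhom_power

lemma rhom_const: "rhom (const :: 'c::comm_ring_1 \<Rightarrow> ('n, 'c) pol)"
  by (rule rhomI) (simp_all add: const_def mult_single single_add)

lemma single_eq_const_times: "Poly_Mapping.single m c = const c * Poly_Mapping.single m (1::'c::comm_ring_1)"
  by (simp add: const_def mult_single)

section \<open>Evaluation homomorphisms, determined by their values on generators\<close>

definition peval :: "('c::comm_ring_1 \<Rightarrow> 'r::comm_ring_1) \<Rightarrow> ('n::finite \<Rightarrow> 'r) \<Rightarrow> ('n, 'c) pol \<Rightarrow> 'r" where
  "peval h f p =
     (\<Sum>m\<in>Poly_Mapping.keys p. h (Poly_Mapping.lookup p m) * (\<Prod>i\<in>UNIV. f i ^ Poly_Mapping.lookup m i))"

lemma peval_superset:
  assumes "rhom h" "finite A" "Poly_Mapping.keys p \<subseteq> A"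
  shows "peval h f p =
    (\<Sum>m\<in>A. h (Poly_Mapping.lookup p m) * (\<Prod>i\<in>UNIV. f i ^ Poly_Mapping.lookup m i))"
  unfolding peval_def using assms
  by (intro sum.mono_neutral_left) (auto simp: in_keys_iff rhom_0)

lemma peval_single:
  assumes "rhom h"
  shows "peval h f (Poly_Mapping.single m c) = h c * (\<Prod>i\<in>UNIV. f i ^ Poly_Mapping.lookup m i)"
  by (subst peval_superset[OF assms, of "{m}"]) auto

lemma peval_add:
  assumes h: "rhom h"
  shows "peval h f (p + q) = peval h f p + peval h f q"
proof -
  let ?A = "Poly_Mapping.keys p \<union> Poly_Mapping.keys q"
  have "peval h f r = (\<Sum>m\<in>?A. h (Poly_Mapping.lookup r m) * (\<Prod>i\<in>UNIV. f i ^ Poly_Mapping.lookup m i))"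
    if "Poly_Mapping.keys r \<subseteq> ?A" for r
    by (rule peval_superset[OF h _ that]) simp
  from this[of p] this[of q] this[of "p + q"] show ?thesis
    using keys_add[of p q] by (simp add: lookup_add rhom_add[OF h] distrib_right sum.distrib)
qed

lemma rhom_peval:
  fixes f :: "'n::finite \<Rightarrow> 'r::comm_ring_1"
  assumes h: "rhom h"
  shows "rhom (peval h f)"
proof (rule rhomI)
  show "peval h f 1 = 1"
    using peval_single[OF h, of f 0 1] by (simp add: rhom_1[OF h])
  show *: "peval h f (p + q) = peval h f p + peval h f q" for p q
    by (rule peval_add[OF h])
  have 0: "peval h f 0 = 0" by (simp add: peval_def)
  show "peval h f (p * q) = peval h f p * peval h f q" for p q
  proof (induction p rule: pol_induct)
    case zero
    show ?case by (simp add: 0)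
  next
    case (add m c p)
    have "peval h f (Poly_Mapping.single m c * q) = peval h f (Poly_Mapping.single m c) * peval h f q"
    proof (induction q rule: pol_induct)
      case zero
      show ?case by (simp add: 0)
    next
      case (add m' c' q)
      have "peval h f (Poly_Mapping.single m c * Poly_Mapping.single m' c') =
          peval h f (Poly_Mapping.single m c) * peval h f (Poly_Mapping.single m' c')"
        by (simp add: mult_single peval_single[OF h] rhom_mult[OF h] lookup_add power_add
            prod.distrib mult_ac)
      with add show ?case by (simp add: distrib_left *)
    qed
    with add show ?case by (simp add: distrib_right *)
  qed
qed

lemma peval_const:
  fixes f :: "'n::finite \<Rightarrow> 'r::comm_ring_1"
  assumes "rhom h"
  shows "peval h f (const c) = h c"
  by (simp add: const_def peval_single[OF assms])

lemma peval_var: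
  fixes f :: "'n::finite \<Rightarrow> 'r::comm_ring_1"
  assumes "rhom h"
  shows "peval h f (var i) = f i"
proof -
  have "(\<Prod>j\<in>UNIV. f j ^ Poly_Mapping.lookup (Poly_Mapping.single i (1::nat)) j) =
      (\<Prod>j\<in>UNIV. if j = i then f j else 1)"
    by (intro prod.cong) (auto simp: lookup_single when_def)
  then show ?thesis by (simp add: var_def peval_single[OF assms] rhom_1[OF assms])
qed

lemma single_eq_prod_var:
  "Poly_Mapping.single m (1::'c::comm_ring_1) = (\<Prod>i\<in>(UNIV::'n::finite set). var i ^ Poly_Mapping.lookup m i)"
proof -
  have "var i ^ k = Poly_Mapping.single (Poly_Mapping.single i k) (1::'c)" for i :: 'n and k
    by (induction k) (simp_all add: var_def mult_single flip: single_add)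
  then have "(\<Prod>i\<in>A. var i ^ Poly_Mapping.lookup m i) =
      Poly_Mapping.single (\<Sum>i\<in>A. Poly_Mapping.single i (Poly_Mapping.lookup m i)) (1::'c)"
    for A :: "'n set"
    by (induction A rule: infinite_finite_induct) (simp_all add: mult_single)
  moreover have "(\<Sum>i\<in>UNIV. Poly_Mapping.single i (Poly_Mapping.lookup m i)) = m"
  proof (rule poly_mapping_eqI)
    fix j
    have "(\<Sum>i\<in>UNIV. Poly_Mapping.lookup (Poly_Mapping.single i (Poly_Mapping.lookup m i)) j) =
        (\<Sum>i\<in>UNIV. if i = j then Poly_Mapping.lookup m i else 0)"
      by (intro sum.cong) (auto simp: lookup_single when_def)
    then show "Poly_Mapping.lookup (\<Sum>i\<in>UNIV. Poly_Mapping.single i (Poly_Mapping.lookup m i)) j =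
        Poly_Mapping.lookup m j"
      by (simp add: lookup_sum)
  qed
  ultimately show ?thesis by simp
qed

lemma pol_ring_induct [case_names const var add mult]:
  fixes p :: "('n::finite, 'c::comm_ring_1) pol"
  assumes "\<And>c. P (const c)" "\<And>i. P (var i)"
    and "\<And>p q. P p \<Longrightarrow> P q \<Longrightarrow> P (p + q)" "\<And>p q. P p \<Longrightarrow> P q \<Longrightarrow> P (p * q)"
  shows "P p"
proof (induction p rule: pol_induct)
  case zero
  show ?case using assms(1)[of 0] by (simp add: const_def)
next
  case (add m c p)
  have P1: "P 1" using assms(1)[of 1] by (simp add: const_def)
  then have pow: "P (q ^ k)" if "P q" for q k
    using that by (induction k) (simp_all add: assms(4))
  have "P (\<Prod>i\<in>A. var i ^ Poly_Mapping.lookup m i)" for A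
    by (induction A rule: infinite_finite_induct) (simp_all add: P1 assms(2,4) pow)
  with assms(1,3,4) add show ?case
    by (simp add: single_eq_const_times[of m c] single_eq_prod_var)
qed

text \<open>Taking polynomials in y over \<complex>[x], instead of one set of 2n variables, matches
  the coefficients of the smash product: only the coefficient ring has to be enlarged to its
  fraction field.\<close>

type_synonym 'n pxy = "('n, 'n polx) pol"

definition xx :: "'n \<Rightarrow> 'n pxy" where "xx i = const (var i)"

definition yy :: "'n \<Rightarrow> 'n pxy" where "yy i = var i"

definition cc :: "complex \<Rightarrow> 'n pxy" where "cc c = const (const c)"

lemma rhom_cc: "rhom (cc :: complex \<Rightarrow> 'n pxy)"
  using rhom_comp[OF rhom_const rhom_const] by (simp add: cc_def[abs_def])

lemma pxy_induct [case_names cc xx yy add mult]: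
  fixes r :: "'n::finite pxy"
  assumes "\<And>c. P (cc c)" "\<And>i. P (xx i)" "\<And>i. P (yy i)"
    and add: "\<And>p q. P p \<Longrightarrow> P q \<Longrightarrow> P (p + q)" and mult: "\<And>p q. P p \<Longrightarrow> P q \<Longrightarrow> P (p * q)"
  shows "P r"
proof (induction r rule: pol_ring_induct)
  case (const c)
  show ?case
  proof (induction c rule: pol_ring_induct)
    case (add p q)
    then show ?case using assms(4) by (simp add: rhom_add[OF rhom_const])
  next
    case (mult p q)
    then show ?case using assms(5) by (simp add: rhom_mult[OF rhom_const])
  qed (use assms in \<open>auto simp: cc_def xx_def\<close>)
qed (use assms in \<open>auto simp: yy_def\<close>)

text \<open>Constants and variables generate the ring. The identities between substitutions below
  (composition laws, behaviour of dilations, interpolation) are all reduced in this way to three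
  checks.\<close>

lemma pxy_hom_eqI:
  fixes r :: "'n::finite pxy"
  assumes "rhom g" "rhom h"
    and "\<And>c. g (cc c) = h (cc c)" "\<And>i. g (xx i) = h (xx i)" "\<And>i. g (yy i) = h (yy i)"
  shows "g r = h r"
  by (induction r rule: pxy_induct) (simp_all add: assms rhom_add rhom_mult)

definition xyeval :: "(complex \<Rightarrow> 'r::comm_ring_1) \<Rightarrow> ('n::finite \<Rightarrow> 'r) \<Rightarrow> ('n \<Rightarrow> 'r) \<Rightarrow> 'n pxy \<Rightarrow> 'r" where
  "xyeval h X Y = peval (peval h X) Y"

context
  fixes h :: "complex \<Rightarrow> 'r::comm_ring_1" and X Y :: "'n::finite \<Rightarrow> 'r"
  assumes h: "rhom h"
begin

lemma rhom_xyeval: "rhom (xyeval h X Y)"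
  unfolding xyeval_def by (intro rhom_peval h)

lemma xyeval_cc: "xyeval h X Y (cc c) = h c"
  by (simp add: xyeval_def cc_def peval_const rhom_peval h)

lemma xyeval_xx: "xyeval h X Y (xx i) = X i"
  by (simp add: xyeval_def xx_def peval_const peval_var rhom_peval h)

lemma xyeval_yy: "xyeval h X Y (yy i) = Y i"
  by (simp add: xyeval_def yy_def peval_var rhom_peval h)

end

lemmas xyeval_simps = xyeval_cc xyeval_xx xyeval_yy

text \<open>Evaluation at \<open>t\<close> combined with a ring map \<open>h\<close> on the
  coefficients. Applied to a dilated polynomial it turns divisibility by T^k into divisibility by
  \<open>t ^ k\<close>, for whatever \<open>h\<close> is convenient.\<close>

definition hpoly :: "('a::comm_ring_1 \<Rightarrow> 'b::comm_ring_1) \<Rightarrow> 'b \<Rightarrow> 'a poly \<Rightarrow> 'b" where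
  "hpoly h t p = poly (map_poly h p) t"

lemma hpoly_pCons: "rhom h \<Longrightarrow> hpoly h t (pCons a p) = h a + t * hpoly h t p"
  by (simp add: hpoly_def map_poly_pCons rhom_0)

lemma hpoly_0 [simp]: "hpoly h t 0 = 0"
  by (simp add: hpoly_def)

lemma rhom_hpoly:
  assumes h: "rhom h"
  shows "rhom (hpoly h t)"
proof (rule rhomI)
  show "hpoly h t 1 = 1"
    by (simp add: one_pCons hpoly_pCons[OF h] rhom_1[OF h])
  show *: "hpoly h t (p + q) = hpoly h t p + hpoly h t q" for p q
    by (induction p q rule: poly_induct2)
      (simp_all add: hpoly_pCons[OF h] rhom_add[OF h] algebra_simps)
  have **: "hpoly h t (smult a p) = h a * hpoly h t p" for a p
    by (induction p) (simp_all add: hpoly_pCons[OF h] rhom_mult[OF h] algebra_simps)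
  show "hpoly h t (p * q) = hpoly h t p * hpoly h t q" for p q
    by (induction p) (simp_all add: hpoly_pCons[OF h] * ** rhom_0[OF h] algebra_simps)
qed

lemma rhom_coeff_poly: "rhom (\<lambda>a. [:a:])"
  by (rule rhomI) simp_all

section \<open>Symmetries of the polynomial ring\<close>

definition iota :: "'n::linorder pxy \<Rightarrow> 'n ratx_poly" where
  "iota r = Poly_Mapping.map to_ratx r"

lemma lookup_iota [simp]: "Poly_Mapping.lookup (iota r) m = to_ratx (Poly_Mapping.lookup r m)"
  by (simp add: iota_def map.rep_eq when_def to_ratx_0)

lemma to_ratx_eq_iff [simp]: "to_ratx p = to_ratx q \<longleftrightarrow> p = q"
  by (simp add: to_ratx_def eq_fract)

lemma to_ratx_eq_0_iff [simp]: "to_ratx p = 0 \<longleftrightarrow> p = 0"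
  by (simp flip: to_ratx_0)

lemma rhom_to_ratx: "rhom to_ratx"
  by (rule rhomI) (simp_all add: to_ratx_add to_ratx_mult to_ratx_1)

lemma iota_eq_iff [simp]: "iota p = iota q \<longleftrightarrow> p = q"
  by (auto intro!: poly_mapping_eqI simp: poly_mapping_eq_iff fun_eq_iff)

lemma iota_single: "iota (Poly_Mapping.single m c) = Poly_Mapping.single m (to_ratx c)"
  by (rule poly_mapping_eqI) (simp add: lookup_single when_def to_ratx_0)

lemma rhom_iota: "rhom (iota :: 'n::linorder pxy \<Rightarrow> 'n ratx_poly)"
proof (rule rhomI)
  show "iota (1 :: 'n pxy) = 1"
    using iota_single[of 0 1] by (simp add: to_ratx_1)
  show *: "iota (p + q) = iota p + iota q" for p q :: "'n pxy"
    by (rule poly_mapping_eqI) (simp add: lookup_add to_ratx_add)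
  have 0: "iota (0 :: 'n pxy) = 0"
    by (rule poly_mapping_eqI) (simp add: to_ratx_0)
  show "iota (p * q) = iota p * iota q" for p q :: "'n pxy"
  proof (induction p rule: pol_induct)
    case (add m c p)
    have "iota (Poly_Mapping.single m c * q) = iota (Poly_Mapping.single m c) * iota q"
      by (induction q rule: pol_induct)
        (simp_all add: algebra_simps * 0 iota_single mult_single to_ratx_mult)
    with add show ?case by (simp add: distrib_right *)
  qed (simp add: 0)
qed

lemma iota_const: "iota (const p) = const (to_ratx p)"
  by (simp add: const_def iota_single)

lemma iota_yy: "iota (yy i) = var i"
  by (simp add: yy_def var_def iota_single to_ratx_1)

definition pperm :: "'n::finite perm \<Rightarrow> 'n pxy \<Rightarrow> 'n pxy" where
  "pperm \<sigma> = xyeval cc (\<lambda>i. xx (\<sigma> \<langle>$\<rangle> i)) (\<lambda>i. yy (\<sigma> \<langle>$\<rangle> i))"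

lemma rhom_pperm: "rhom (pperm \<sigma>)"
  unfolding pperm_def by (rule rhom_xyeval[OF rhom_cc])

lemma pperm_gen [simp]:
  "pperm \<sigma> (cc c) = cc c" "pperm \<sigma> (xx i) = xx (\<sigma> \<langle>$\<rangle> i)" "pperm \<sigma> (yy i) = yy (\<sigma> \<langle>$\<rangle> i)"
  by (simp_all add: pperm_def xyeval_simps[OF rhom_cc])

lemma pperm_times: "pperm (\<sigma> * \<tau>) r = pperm \<sigma> (pperm \<tau> r)"
  by (rule pxy_hom_eqI[OF rhom_pperm rhom_comp[OF rhom_pperm rhom_pperm]])
    (simp_all add: apply_sequence)

lemma pperm_one [simp]: "pperm 1 r = r"
  by (rule pxy_hom_eqI[OF rhom_pperm rhom_id]) simp_all

lemma pperm_const: "pperm \<sigma> (const p) = const (perm_pol \<sigma> p)"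
proof (induction p rule: pol_ring_induct)
  case (const c)
  then show ?case using pperm_gen(1)[of \<sigma> c] by (simp add: cc_def)
next
  case (var i)
  then show ?case using pperm_gen(2)[of \<sigma> i] by (simp add: xx_def perm_pol_var)
qed (simp_all add: perm_pol_add perm_pol_mult rhom_simps[OF rhom_const] rhom_simps[OF rhom_pperm])

lemma rhom_perm_ratpol: "rhom (perm_ratpol \<sigma>)"
  by (rule rhomI) (simp_all add: perm_ratpol_add perm_ratpol_mult)

lemma perm_ratpol_const: "perm_ratpol \<sigma> (const q) = const (perm_rat \<sigma> q)"
  by (simp add: const_def perm_ratpol_single)

lemma perm_rat_to_ratx: "perm_rat \<sigma> (to_ratx p) = to_ratx (perm_pol \<sigma> p)"
  by (simp add: to_ratx_def perm_rat_Fract)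

lemma perm_ratpol_iota: "perm_ratpol \<sigma> (iota r) = iota (pperm \<sigma> r)"
  for r :: "'n::{finite,linorder} pxy"
proof (rule pxy_hom_eqI[OF rhom_comp[OF rhom_perm_ratpol rhom_iota] rhom_comp[OF rhom_iota rhom_pperm]])
  show "perm_ratpol \<sigma> (iota (cc c)) = iota (pperm \<sigma> (cc c))" for c :: complex
    by (simp add: cc_def iota_const perm_ratpol_const perm_rat_to_ratx pperm_const)
  show "perm_ratpol \<sigma> (iota (xx i)) = iota (pperm \<sigma> (xx i))" for i :: 'n
    by (simp add: xx_def iota_const perm_ratpol_const perm_rat_to_ratx pperm_const)
  show "perm_ratpol \<sigma> (iota (yy i)) = iota (pperm \<sigma> (yy i))" for i :: 'n
    by (simp add: iota_yy) (simp add: var_def perm_ratpol_single perm_exp_single)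
qed

text \<open>The columns of \<open>g\<close> are the images of x_i and y_i, so each pair spans a copy
  of the standard representation. Using the rows would reverse the order of products.\<close>

definition gl :: "complex^2^2 \<Rightarrow> 'n::finite pxy \<Rightarrow> 'n pxy" where
  "gl g = xyeval cc (\<lambda>i. cc (g $ 1 $ 1) * xx i + cc (g $ 2 $ 1) * yy i)
     (\<lambda>i. cc (g $ 1 $ 2) * xx i + cc (g $ 2 $ 2) * yy i)"

lemma rhom_gl: "rhom (gl g)"
  unfolding gl_def by (rule rhom_xyeval[OF rhom_cc])

lemma gl_gen:
  "gl g (cc c) = cc c"
  "gl g (xx i) = cc (g $ 1 $ 1) * xx i + cc (g $ 2 $ 1) * yy i"
  "gl g (yy i) = cc (g $ 1 $ 2) * xx i + cc (g $ 2 $ 2) * yy i"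
  by (simp_all add: gl_def xyeval_simps[OF rhom_cc])

lemma gl_times: "gl (g ** h) r = gl g (gl h r)"
  by (rule pxy_hom_eqI[OF rhom_gl rhom_comp[OF rhom_gl rhom_gl]])
    (simp_all add: gl_gen matrix_matrix_mult_def sum_2 rhom_simps[OF rhom_gl] rhom_simps[OF rhom_cc]
      algebra_simps)

lemma gl_mat_1: "gl (mat 1) r = r"
  by (rule pxy_hom_eqI[OF rhom_gl rhom_id]) (simp_all add: gl_gen mat_def rhom_simps[OF rhom_cc])

section \<open>Vanishing orders along the diagonals\<close>

abbreviation TT :: "'a::comm_ring_1 poly" where "TT \<equiv> [:0, 1:]"

text \<open>
  For a transposition \<open>s\<close> of \<open>i\<close> and \<open>j\<close>, this substitution scales the normal directions
  \<open>x\<^sub>i - x\<^sub>j\<close> and \<open>y\<^sub>i - y\<^sub>j\<close> of the locus \<open>x\<^sub>i = x\<^sub>j\<close>, \<open>y\<^sub>i = y\<^sub>j\<close> by \<open>T\<close>; hence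
  \<open>T\<^sup>k\<close> divides \<open>dilate s r\<close> iff \<open>r\<close> lies in the \<open>k\<close>-th power of the ideal of that locus.
\<close>

definition dilate :: "'n::finite perm \<Rightarrow> 'n pxy \<Rightarrow> 'n pxy poly" where
  "dilate s = xyeval (\<lambda>c. [:cc c:])
     (\<lambda>l. [:cc (1/2) * (xx l + xx (s \<langle>$\<rangle> l)), cc (1/2) * (xx l - xx (s \<langle>$\<rangle> l)):])
     (\<lambda>l. [:cc (1/2) * (yy l + yy (s \<langle>$\<rangle> l)), cc (1/2) * (yy l - yy (s \<langle>$\<rangle> l)):])"

lemma rhom_coeff_cc: "rhom (\<lambda>c. [:cc c:])"
  by (rule rhom_comp[OF rhom_coeff_poly rhom_cc])

lemma rhom_dilate: "rhom (dilate s)"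
  unfolding dilate_def by (rule rhom_xyeval[OF rhom_coeff_cc])

lemma dilate_gen:
  "dilate s (cc c) = [:cc c:]"
  "dilate s (xx l) = [:cc (1/2) * (xx l + xx (s \<langle>$\<rangle> l)), cc (1/2) * (xx l - xx (s \<langle>$\<rangle> l)):]"
  "dilate s (yy l) = [:cc (1/2) * (yy l + yy (s \<langle>$\<rangle> l)), cc (1/2) * (yy l - yy (s \<langle>$\<rangle> l)):]"
  by (simp_all add: dilate_def xyeval_simps[OF rhom_coeff_cc])

lemma two_cc_half: "2 * cc (1/2) = (1 :: 'n pxy)"
proof -
  have "cc (1/2) + cc (1/2) = (1 :: 'n pxy)"
    by (simp add: rhom_1[OF rhom_cc] flip: rhom_add[OF rhom_cc])
  then show ?thesis by simp
qed

lemma cc_half: "cc (1/2) * (a + b) + cc (1/2) * (a - b) = (a :: 'n pxy)"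
proof -
  have "cc (1/2) * (a + b) + cc (1/2) * (a - b) = (2 * cc (1/2)) * a"
    by (simp add: algebra_simps)
  then show ?thesis by (simp only: two_cc_half mult_1)
qed

text \<open>Each variable is its symmetric half plus its antisymmetric half, and T = 1 leaves the
  latter unscaled. Hence dilation is injective.\<close>

lemma poly_dilate_1: "hpoly (\<lambda>a. a) 1 (dilate s r) = r"
  by (rule pxy_hom_eqI[OF rhom_comp[OF rhom_hpoly[OF rhom_id] rhom_dilate] rhom_id])
    (simp_all add: dilate_gen hpoly_pCons[OF rhom_id] cc_half)

lemma dilate_eq_0_iff [simp]: "dilate s r = 0 \<longleftrightarrow> r = 0"
  by (metis poly_dilate_1 rhom_0[OF rhom_dilate] hpoly_0)

lemma rhom_coeff_comp: "rhom h \<Longrightarrow> rhom (\<lambda>a. [:h a:])"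
  by (rule rhom_comp[OF rhom_coeff_poly])

lemma hpoly_TT_power: "rhom h \<Longrightarrow> hpoly h t (TT ^ k) = t ^ k"
  by (simp add: rhom_power[OF rhom_hpoly] hpoly_pCons rhom_0 rhom_1)

lemma hpoly_TT_dvd: "rhom h \<Longrightarrow> TT ^ k dvd p \<Longrightarrow> t ^ k dvd hpoly h t p"
  using rhom_dvd[OF rhom_hpoly, of h "TT ^ k" p t] by (simp add: hpoly_TT_power)

text \<open>\<open>gl g\<close> mixes x_l with y_l by coefficients independent of l, so it respects
  the splitting into symmetric and antisymmetric halves. Dilation therefore commutes with it when it
  acts on coefficients and fixes T.\<close>

lemma TT_dvd_dilate_gl:
  assumes "TT ^ k dvd dilate s r"
  shows "TT ^ k dvd dilate s (gl g r)"
proof -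
  note h = rhom_coeff_comp[OF rhom_gl[of g]]
  have "hpoly (\<lambda>a. [:gl g a:]) TT (dilate s r) = dilate s (gl g r)"
    by (rule pxy_hom_eqI[OF rhom_comp[OF rhom_hpoly[OF h] rhom_dilate] rhom_comp[OF rhom_dilate rhom_gl]])
      (simp_all add: dilate_gen gl_gen hpoly_pCons[OF h] rhom_simps[OF rhom_gl] rhom_simps[OF rhom_dilate]
        algebra_simps)
  with hpoly_TT_dvd[OF h assms, of TT] show ?thesis by simp
qed

text \<open>A permutation carries the locus of \<open>s\<close> to the locus of its
  conjugate.\<close>

lemma TT_dvd_dilate_pperm:
  assumes "TT ^ k dvd dilate s r"
  shows "TT ^ k dvd dilate (\<sigma> * s * inverse \<sigma>) (pperm \<sigma> r)"
proof -
  note h = rhom_coeff_comp[OF rhom_pperm[of \<sigma>]]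
  have "hpoly (\<lambda>a. [:pperm \<sigma> a:]) TT (dilate s r) = dilate (\<sigma> * s * inverse \<sigma>) (pperm \<sigma> r)"
    by (rule pxy_hom_eqI[OF rhom_comp[OF rhom_hpoly[OF h] rhom_dilate] rhom_comp[OF rhom_dilate rhom_pperm]])
      (simp_all add: dilate_gen hpoly_pCons[OF h] rhom_simps[OF rhom_pperm] rhom_simps[OF rhom_dilate]
        algebra_simps apply_sequence flip: apply_times)
  with hpoly_TT_dvd[OF h assms, of TT] show ?thesis by simp
qed

text \<open>The transposition fixes the symmetric halves and negates the normal directions, which is
  the effect of T \<mapsto> -T.\<close>

lemma dilate_pperm_swap:
  "dilate \<langle>i \<leftrightarrow> j\<rangle> (pperm \<langle>i \<leftrightarrow> j\<rangle> r) = hpoly (\<lambda>a. [:a:]) (- TT) (dilate \<langle>i \<leftrightarrow> j\<rangle> r)"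
proof -
  have ss: "\<langle>i \<leftrightarrow> j\<rangle> \<langle>$\<rangle> (\<langle>i \<leftrightarrow> j\<rangle> \<langle>$\<rangle> l) = l" for l :: 'a
    by (cases "l = i \<or> l = j") (auto simp: apply_swap_eq_iff swap.rep_eq transpose_def)
  show ?thesis
    by (rule pxy_hom_eqI[OF rhom_comp[OF rhom_dilate rhom_pperm]
          rhom_comp[OF rhom_hpoly[OF rhom_coeff_poly] rhom_dilate]])
      (simp_all add: dilate_gen hpoly_pCons[OF rhom_coeff_poly] rhom_simps[OF rhom_dilate] ss
        algebra_simps)
qed

lemma TT_dvd_iff: "TT dvd p \<longleftrightarrow> poly p 0 = 0" for p :: "'a::comm_ring_1 poly"
  using poly_eq_0_iff_dvd[of p 0] by simp

lemma poly_hpoly_minus_TT: "poly (hpoly (\<lambda>a. [:a:]) (- TT) p) 0 = poly p 0"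
  by (induction p) (simp_all add: hpoly_pCons[OF rhom_coeff_poly])

lemma TT_dvd_diff_minus_TT: "TT dvd p - hpoly (\<lambda>a. [:a:]) (- TT) p"
  by (simp only: TT_dvd_iff poly_diff poly_hpoly_minus_TT diff_self)

section \<open>The order in T as a valuation, and quotients regular along a diagonal\<close>

lemma TT_power_dvd_iff: "p \<noteq> 0 \<Longrightarrow> TT ^ n dvd p \<longleftrightarrow> n \<le> order 0 p"
  for p :: "'a::idom poly"
  using order_divides[of 0 n p] by simp

lemma TT_power_dvd_cancel:
  fixes p q :: "'a::idom poly"
  assumes "p \<noteq> 0" "TT ^ (order 0 p + k) dvd p * q"
  shows "TT ^ k dvd q"
proof (cases "q = 0")
  case False
  with assms show ?thesis by (simp add: TT_power_dvd_iff order_mult)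
qed simp

lemma single_eq_single_iff: "c \<noteq> 0 \<Longrightarrow> Poly_Mapping.single a c = Poly_Mapping.single b c \<longleftrightarrow> a = b"
  by (metis lookup_single_eq lookup_single_not_eq)

lemma xx_eq_iff [simp]: "xx i = xx j \<longleftrightarrow> i = j"
  by (simp add: xx_def const_def var_def single_eq_single_iff inj_eq[OF inj_single])

text \<open>\<open>dilate s\<close> is an injective homomorphism into polynomials over a domain,
  where the order at 0 is additive.\<close>

lemma order_dilate_mult:
  fixes g h :: "'n::{finite,linorder} pxy"
  assumes "g \<noteq> 0" "h \<noteq> 0"
  shows "order 0 (dilate s (g * h)) = order 0 (dilate s g) + order 0 (dilate s h)"
  using assms by (simp add: rhom_mult[OF rhom_dilate] order_mult)

text \<open>\<open>f\<close> is a quotient of polynomials whose order along the locus defined by \<open>s\<close> is nonnegative.\<close>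

definition regular :: "'n::{finite,linorder} perm \<Rightarrow> 'n ratx_poly \<Rightarrow> bool" where
  "regular s f \<longleftrightarrow> (\<exists>h g. h \<noteq> 0 \<and> iota h * f = iota g \<and> TT ^ order 0 (dilate s h) dvd dilate s g)"

lemma regularI:
  "h \<noteq> 0 \<Longrightarrow> iota h * f = iota g \<Longrightarrow> TT ^ order 0 (dilate s h) dvd dilate s g \<Longrightarrow> regular s f"
  by (auto simp: regular_def)

text \<open>T = 0 is restriction to the locus. A denominator that survives it has order 0, which
  leaves no condition on the numerator.\<close>

lemma regular_unit:
  assumes "iota h * f = iota g" "poly (dilate s h) 0 \<noteq> 0"
  shows "regular s f"
proof (rule regularI[OF _ assms(1)])
  show "h \<noteq> 0" using assms(2) by (auto simp: rhom_0[OF rhom_dilate])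
  show "TT ^ order 0 (dilate s h) dvd dilate s g" using assms(2) by (simp add: order_0I)
qed

lemma regular_iota: "regular s (iota r)"
  by (rule regular_unit[of 1 _ r]) (simp_all add: rhom_1[OF rhom_iota] rhom_1[OF rhom_dilate])

lemma regular_add:
  assumes "regular s f" "regular s f'"
  shows "regular s (f + f')"
proof -
  obtain h g where 1: "h \<noteq> 0" "iota h * f = iota g" "TT ^ order 0 (dilate s h) dvd dilate s g"
    using assms(1) by (auto simp: regular_def)
  obtain h' g' where 2: "h' \<noteq> 0" "iota h' * f' = iota g'" "TT ^ order 0 (dilate s h') dvd dilate s g'"
    using assms(2) by (auto simp: regular_def)
  show ?thesis
  proof (rule regularI)
    show "h * h' \<noteq> 0" using 1 2 by simp
    have "iota (h * h') * (f + f') = iota h' * (iota h * f) + iota h * (iota h' * f')"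
      by (simp add: rhom_simps[OF rhom_iota] algebra_simps)
    then show "iota (h * h') * (f + f') = iota (h' * g + h * g')"
      by (simp add: 1 2 rhom_simps[OF rhom_iota])
    have o: "TT ^ order 0 (dilate s h) dvd dilate s h" "TT ^ order 0 (dilate s h') dvd dilate s h'"
      using 1 2 by (simp_all add: TT_power_dvd_iff)
    show "TT ^ order 0 (dilate s (h * h')) dvd dilate s (h' * g + h * g')"
      unfolding order_dilate_mult[OF 1(1) 2(1)] power_add rhom_add[OF rhom_dilate]
        rhom_mult[OF rhom_dilate, of s h'] rhom_mult[OF rhom_dilate, of s h g']
        mult.commute[of "dilate s h'"]
      using 1 2 o by (intro dvd_add mult_dvd_mono)
  qed
qed

lemma regular_mult:
  assumes "regular s f" "regular s f'"
  shows "regular s (f * f')"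
proof -
  obtain h g where 1: "h \<noteq> 0" "iota h * f = iota g" "TT ^ order 0 (dilate s h) dvd dilate s g"
    using assms(1) by (auto simp: regular_def)
  obtain h' g' where 2: "h' \<noteq> 0" "iota h' * f' = iota g'" "TT ^ order 0 (dilate s h') dvd dilate s g'"
    using assms(2) by (auto simp: regular_def)
  show ?thesis
  proof (rule regularI)
    show "h * h' \<noteq> 0" using 1 2 by simp
    have "iota (h * h') * (f * f') = (iota h * f) * (iota h' * f')"
      by (simp add: rhom_simps[OF rhom_iota] algebra_simps)
    then show "iota (h * h') * (f * f') = iota (g * g')"
      by (simp add: 1 2 rhom_simps[OF rhom_iota])
    show "TT ^ order 0 (dilate s (h * h')) dvd dilate s (g * g')"
      unfolding order_dilate_mult[OF 1(1) 2(1)] power_add rhom_mult[OF rhom_dilate, of s g]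
      using 1 2 by (intro mult_dvd_mono)
  qed
qed

lemma regular_iota_mult: "regular s f \<Longrightarrow> regular s (iota r * f)"
  by (rule regular_mult[OF regular_iota])

lemma regular_uminus: "regular s f \<Longrightarrow> regular s (- f)"
  using regular_iota_mult[of s f "-1"] by (simp add: rhom_simps[OF rhom_iota])

lemma regular_diff: "regular s f \<Longrightarrow> regular s f' \<Longrightarrow> regular s (f - f')"
  using regular_add[of s f "- f'"] regular_uminus by auto

lemma swap_conj: "\<sigma> * \<langle>i \<leftrightarrow> j\<rangle> * inverse \<sigma> = \<langle>\<sigma> \<langle>$\<rangle> i \<leftrightarrow> \<sigma> \<langle>$\<rangle> j\<rangle>"
proof (rule perm_eqI)
  fix l
  obtain m where m: "l = \<sigma> \<langle>$\<rangle> m"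
    by (metis apply_one apply_sequence id_apply perm.right_inverse)
  have "inverse \<sigma> \<langle>$\<rangle> (\<sigma> \<langle>$\<rangle> m) = m" by (simp add: apply_sequence)
  then show "(\<sigma> * \<langle>i \<leftrightarrow> j\<rangle> * inverse \<sigma>) \<langle>$\<rangle> l = \<langle>\<sigma> \<langle>$\<rangle> i \<leftrightarrow> \<sigma> \<langle>$\<rangle> j\<rangle> \<langle>$\<rangle> l"
    by (simp add: m apply_times swap.rep_eq Transposition.transpose_def inj_eq[OF inj_apply])
qed

lemma regular_perm:
  assumes "regular s f"
  shows "regular (\<sigma> * s * inverse \<sigma>) (perm_ratpol \<sigma> f)"
proof -
  let ?s = "\<sigma> * s * inverse \<sigma>"
  obtain h g where 1: "h \<noteq> 0" "iota h * f = iota g" "TT ^ order 0 (dilate s h) dvd dilate s g"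
    using assms(1) by (auto simp: regular_def)
  have inv: "pperm (inverse \<sigma>) (pperm \<sigma> r) = r" for r
    by (simp flip: pperm_times)
  have nz: "pperm \<sigma> h \<noteq> 0" using 1(1) inv[of h] by (auto simp: rhom_0[OF rhom_pperm])
  show ?thesis
  proof (rule regularI[OF nz])
    show "iota (pperm \<sigma> h) * perm_ratpol \<sigma> f = iota (pperm \<sigma> g)"
      by (simp flip: perm_ratpol_iota perm_ratpol_mult 1(2))
    \<comment> \<open>Transport back by the inverse permutation bounds the order of the new
      denominator by that of \<open>h\<close>.\<close>
    have "TT ^ order 0 (dilate ?s (pperm \<sigma> h)) dvd dilate ?s (pperm \<sigma> h)"
      using nz by (simp add: TT_power_dvd_iff)
    from TT_dvd_dilate_pperm[OF this, of "inverse \<sigma>"]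
    have "TT ^ order 0 (dilate ?s (pperm \<sigma> h)) dvd dilate s h"
      by (simp add: inv mult.assoc) (simp flip: mult.assoc)
    then have "order 0 (dilate ?s (pperm \<sigma> h)) \<le> order 0 (dilate s h)"
      using 1(1) by (simp add: TT_power_dvd_iff)
    then show "TT ^ order 0 (dilate ?s (pperm \<sigma> h)) dvd dilate ?s (pperm \<sigma> g)"
      by (intro TT_dvd_dilate_pperm) (use 1(3) power_le_dvd in blast)
  qed
qed

lemma dilate_xx_diff:
  assumes "i \<noteq> j"
  shows "dilate \<langle>i \<leftrightarrow> j\<rangle> (xx i - xx j) = [:0, xx i - xx j:]"
proof -
  have "cc (1/2) * (xx i - xx j) - cc (1/2) * (xx j - xx i) = (2 * cc (1/2)) * (xx i - xx j)"
    by (simp add: algebra_simps)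
  then show ?thesis
    by (simp add: rhom_simps[OF rhom_dilate] dilate_gen add.commute two_cc_half)
qed

lemma poly_dilate_xx_diff_neq_0:
  fixes a b i j :: "'n::{finite,linorder}"
  assumes "a \<noteq> b" "{a, b} \<noteq> {i, j}"
  shows "poly (dilate \<langle>i \<leftrightarrow> j\<rangle> (xx a - xx b)) 0 \<noteq> 0"
proof
  let ?s = "\<langle>i \<leftrightarrow> j\<rangle>"
  assume "poly (dilate ?s (xx a - xx b)) 0 = 0"
  then have "cc (1/2) * (xx a + xx (?s \<langle>$\<rangle> a)) = cc (1/2) * (xx b + xx (?s \<langle>$\<rangle> b))"
    by (simp add: rhom_simps[OF rhom_dilate] dilate_gen)
  then have "2 * cc (1/2) * (xx a + xx (?s \<langle>$\<rangle> a)) = 2 * cc (1/2) * (xx b + xx (?s \<langle>$\<rangle> b))"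
    by (simp only: mult.assoc)
  then have "xx a + xx (?s \<langle>$\<rangle> a) = xx b + xx (?s \<langle>$\<rangle> b)"
    by (simp only: two_cc_half mult_1)
  \<comment> \<open>Compare the coefficients of the monomial x_a: it occurs on the left, and on the
    right only if \<open>s\<close> maps \<open>b\<close> to \<open>a\<close>.\<close>
  then have "Poly_Mapping.lookup (Poly_Mapping.lookup (xx a + xx (?s \<langle>$\<rangle> a)) 0) (Poly_Mapping.single a 1) =
      Poly_Mapping.lookup (Poly_Mapping.lookup (xx b + xx (?s \<langle>$\<rangle> b)) 0) (Poly_Mapping.single a 1)"
    by simp
  then have "?s \<langle>$\<rangle> b = a"
    using assms(1) by (auto simp: xx_def const_def var_def lookup_add lookup_single when_def
        single_eq_single_iff split: if_splits)
  with assms show False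
    by (auto simp: swap.rep_eq Transposition.transpose_def split: if_splits)
qed

text \<open>A difference u - s(u) is odd under T \<mapsto> -T over an invariant denominator, so it
  gains one factor T. This pays for the division by x_i - x_j, which has order one.\<close>

lemma regular_twist:
  fixes i j :: "'n::{finite,linorder}"
  assumes ij: "i \<noteq> j" and u: "regular \<langle>i \<leftrightarrow> j\<rangle> u"
    and f: "iota (xx i - xx j) * f = u - perm_ratpol \<langle>i \<leftrightarrow> j\<rangle> u"
  shows "regular \<langle>i \<leftrightarrow> j\<rangle> f"
proof -
  let ?s = "\<langle>i \<leftrightarrow> j\<rangle>"
  obtain h g where 1: "h \<noteq> 0" "iota h * u = iota g" "TT ^ order 0 (dilate ?s h) dvd dilate ?s g"
    using u by (auto simp: regular_def)
  let ?m = "order 0 (dilate ?s h)"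
  have ss: "?s * ?s = 1"
    by (rule perm_eqI) (simp add: apply_times swap.rep_eq)
  have inv: "pperm ?s (pperm ?s r) = r" for r
    using ss by (simp flip: pperm_times)
  \<comment> \<open>The denominator is replaced by an s-invariant one, so that applying s to
    \<open>u\<close> changes only the numerator.\<close>
  define H where "H = h * pperm ?s h"
  define G where "G = g * pperm ?s h"
  have nz: "pperm ?s h \<noteq> 0" using 1(1) inv[of h] by (auto simp: rhom_0[OF rhom_pperm])
  have conj: "?s * ?s * inverse ?s = ?s" by (simp add: ss)
  have dvd_h: "TT ^ n dvd dilate ?s (pperm ?s r)" if "TT ^ n dvd dilate ?s r" for n r
    using TT_dvd_dilate_pperm[OF that, of ?s] by (simp only: conj)
  have ord: "order 0 (dilate ?s (pperm ?s h)) = ?m"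
  proof (rule antisym)
    have "TT ^ order 0 (dilate ?s (pperm ?s h)) dvd dilate ?s (pperm ?s h)"
      using nz by (simp add: TT_power_dvd_iff)
    from dvd_h[OF this] show "order 0 (dilate ?s (pperm ?s h)) \<le> ?m"
      using 1(1) by (simp add: inv TT_power_dvd_iff)
    have "TT ^ ?m dvd dilate ?s h"
      using 1(1) by (simp add: TT_power_dvd_iff)
    from dvd_h[OF this] show "?m \<le> order 0 (dilate ?s (pperm ?s h))"
      using nz by (simp add: TT_power_dvd_iff)
  qed
  have d: "xx i - xx j \<noteq> 0" using ij by simp
  have H0: "H \<noteq> 0" using 1(1) nz by (simp add: H_def)
  have ordd: "order 0 (dilate ?s (xx i - xx j)) = 1"
  proof -
    have "dilate ?s (xx i - xx j) = TT * [:xx i - xx j:]"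
      by (simp add: dilate_xx_diff[OF ij])
    moreover have "order 0 ([:xx i - xx j:]) = 0" using d by (intro order_0I) simp
    moreover have "order 0 (TT :: 'n pxy poly) = 1" using order_power_n_n[of 0 1] by simp
    ultimately show ?thesis using d by (simp add: order_mult del: mult_pCons_left mult_pCons_right)
  qed
  have "TT ^ (2 * ?m) dvd dilate ?s G"
  proof -
    have "TT ^ ?m dvd dilate ?s (pperm ?s h)" using nz by (simp add: TT_power_dvd_iff ord)
    with 1(3) have "TT ^ ?m * TT ^ ?m dvd dilate ?s g * dilate ?s (pperm ?s h)"
      by (rule mult_dvd_mono)
    then show ?thesis by (simp add: G_def rhom_mult[OF rhom_dilate] mult_2 power_add)
  qed
  then obtain P where P: "dilate ?s G = TT ^ (2 * ?m) * P" by (auto simp: dvd_def)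
  let ?e = "hpoly (\<lambda>a. [:a:]) (- TT) :: 'n pxy poly \<Rightarrow> _"
  \<comment> \<open>The exponent is even, so the power of T is unaffected by the sign change and can
    be factored out of the difference.\<close>
  have "?e (dilate ?s G) = TT ^ (2 * ?m) * ?e P"
    by (simp only: P rhom_mult[OF rhom_hpoly[OF rhom_coeff_poly]] hpoly_TT_power[OF rhom_coeff_poly])
      (simp add: power_mult power2_eq_square)
  then have "dilate ?s (G - pperm ?s G) = TT ^ (2 * ?m) * (P - ?e P)"
    by (simp only: rhom_diff[OF rhom_dilate] dilate_pperm_swap P right_diff_distrib)
  moreover have "TT dvd P - ?e P" by (rule TT_dvd_diff_minus_TT)
  ultimately have dvd: "TT ^ (2 * ?m + 1) dvd dilate ?s (G - pperm ?s G)"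
    by (simp only: power_add power_one_right) (rule mult_dvd_mono; simp)
  show ?thesis
  proof (rule regularI)
    show "H * (xx i - xx j) \<noteq> 0" using H0 d by simp
    have Hu: "iota H * u = iota G"
      by (simp add: H_def G_def rhom_mult[OF rhom_iota] mult_ac flip: 1(2))
    have "pperm ?s H = H" by (simp add: H_def rhom_mult[OF rhom_pperm] inv mult.commute)
    then have Hsu: "iota H * perm_ratpol ?s u = iota (pperm ?s G)"
      using arg_cong[OF Hu, of "perm_ratpol ?s"] by (simp add: perm_ratpol_mult perm_ratpol_iota)
    have "iota (H * (xx i - xx j)) * f = iota H * (iota (xx i - xx j) * f)"
      by (simp only: rhom_mult[OF rhom_iota] mult.assoc)
    also have "\<dots> = iota (G - pperm ?s G)"
      unfolding f by (simp only: right_diff_distrib Hu Hsu rhom_diff[OF rhom_iota])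
    finally show "iota (H * (xx i - xx j)) * f = iota (G - pperm ?s G)" .
    have "order 0 (dilate ?s H) = 2 * ?m"
      using 1(1) nz by (simp add: H_def order_dilate_mult ord)
    with dvd show "TT ^ order 0 (dilate ?s (H * (xx i - xx j))) dvd dilate ?s (G - pperm ?s G)"
      by (simp only: order_dilate_mult[OF H0 d] ordd)
  qed
qed

text \<open>At most a simple pole along each diagonal, with cancelling polar parts at \<sigma> and
  s\<sigma>. No \<open>k\<close> appears: it enters only when the powers of \<Delta> are
  cleared.\<close>

definition loc :: "'n::{finite,linorder} smash \<Rightarrow> bool" where
  "loc v \<longleftrightarrow> (\<forall>i j \<sigma>. i \<noteq> j \<longrightarrow>
     regular \<langle>i \<leftrightarrow> j\<rangle> (iota (xx i - xx j) * smash_coeff v \<sigma>) \<and>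
     regular \<langle>i \<leftrightarrow> j\<rangle> (smash_coeff v \<sigma> + smash_coeff v (\<langle>i \<leftrightarrow> j\<rangle> * \<sigma>)))"

lemma smash_coeff_simps [simp]:
  fixes a b :: "'n::{finite,linorder} smash"
  shows "smash_coeff (0 :: 'n smash) \<sigma> = 0"
    "smash_coeff (a + b) \<sigma> = smash_coeff a \<sigma> + smash_coeff b \<sigma>"
    "smash_coeff (a - b) \<sigma> = smash_coeff a \<sigma> - smash_coeff b \<sigma>"
    "smash_coeff (- a) \<sigma> = - smash_coeff a \<sigma>"
  by (simp_all add: zero_smash_def plus_smash_def minus_smash_def uminus_smash_def)

lemma locD:
  assumes "loc v" "i \<noteq> j"
  shows "regular \<langle>i \<leftrightarrow> j\<rangle> (iota (xx i - xx j) * smash_coeff v \<sigma>)"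
    "regular \<langle>i \<leftrightarrow> j\<rangle> (smash_coeff v \<sigma> + smash_coeff v (\<langle>i \<leftrightarrow> j\<rangle> * \<sigma>))"
  using assms by (auto simp: loc_def)

lemma loc_add:
  assumes "loc v" "loc w"
  shows "loc (v + w)"
  unfolding loc_def
proof (intro allI impI conjI)
  fix i j :: 'a and \<sigma>
  assume ij: "i \<noteq> j"
  show "regular \<langle>i \<leftrightarrow> j\<rangle> (iota (xx i - xx j) * smash_coeff (v + w) \<sigma>)"
    using regular_add[OF locD(1)[OF assms(1) ij] locD(1)[OF assms(2) ij]]
    by (simp add: distrib_left)
  show "regular \<langle>i \<leftrightarrow> j\<rangle> (smash_coeff (v + w) \<sigma> + smash_coeff (v + w) (\<langle>i \<leftrightarrow> j\<rangle> * \<sigma>))"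
    using regular_add[OF locD(2)[OF assms(1) ij] locD(2)[OF assms(2) ij]]
    by (simp add: add_ac)
qed

lemma loc_iota_mult:
  assumes "loc v"
  shows "loc (of_ratpol (iota r) * v)"
  unfolding loc_def coeff_of_ratpol_times mult.left_commute[of _ "iota r"] distrib_left[symmetric]
  using assms by (auto intro: regular_iota_mult simp: loc_def)

lemma loc_diff:
  assumes "loc v" "loc w"
  shows "loc (v - w)"
proof -
  have "v - w = v + of_ratpol (iota (- 1)) * w"
    by (rule smash_eqI) (simp add: coeff_of_ratpol_times rhom_simps[OF rhom_iota])
  then show ?thesis using assms by (simp only: loc_add loc_iota_mult)
qed

lemma loc_of_perm_mult:
  assumes v: "loc v"
  shows "loc (of_perm \<tau> * v)"
  unfolding loc_def coeff_of_perm_times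
proof (intro allI impI conjI)
  fix i j :: 'a and \<rho>
  assume "i \<noteq> j"
  \<comment> \<open>\<tau> carries the diagonal of i', j' to that of i, j, so the hypothesis is used
    at the preimages.\<close>
  define i' j' where "i' = inverse \<tau> \<langle>$\<rangle> i" "j' = inverse \<tau> \<langle>$\<rangle> j"
  have i: "\<tau> \<langle>$\<rangle> i' = i" "\<tau> \<langle>$\<rangle> j' = j" by (simp_all add: i'_j'_def apply_sequence)
  then have "i' \<noteq> j'" using \<open>i \<noteq> j\<close> by auto
  have conj: "\<tau> * \<langle>i' \<leftrightarrow> j'\<rangle> * inverse \<tau> = \<langle>i \<leftrightarrow> j\<rangle>" by (simp only: swap_conj i)
  have conj': "\<langle>i' \<leftrightarrow> j'\<rangle> * (inverse \<tau> * \<rho>) = inverse \<tau> * (\<langle>i \<leftrightarrow> j\<rangle> * \<rho>)"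
    unfolding conj[symmetric] by (simp flip: mult.assoc)
  show "regular \<langle>i \<leftrightarrow> j\<rangle> (iota (xx i - xx j) * perm_ratpol \<tau> (smash_coeff v (inverse \<tau> * \<rho>)))"
    using regular_perm[OF locD(1)[OF v \<open>i' \<noteq> j'\<close>], of \<tau> "inverse \<tau> * \<rho>"]
    by (simp only: conj perm_ratpol_mult perm_ratpol_iota rhom_diff[OF rhom_pperm] pperm_gen i)
  show "regular \<langle>i \<leftrightarrow> j\<rangle> (perm_ratpol \<tau> (smash_coeff v (inverse \<tau> * \<rho>)) +
      perm_ratpol \<tau> (smash_coeff v (inverse \<tau> * (\<langle>i \<leftrightarrow> j\<rangle> * \<rho>))))"
    using regular_perm[OF locD(2)[OF v \<open>i' \<noteq> j'\<close>], of \<tau> "inverse \<tau> * \<rho>"]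
    by (simp only: conj conj' perm_ratpol_add)
qed

lemma swap_swap: "\<langle>i \<leftrightarrow> j\<rangle> * (\<langle>i \<leftrightarrow> j\<rangle> * \<rho>) = \<rho>"
  using swap_conj[of "\<langle>i \<leftrightarrow> j\<rangle>" i j]
  by (rule_tac perm_eqI) (simp add: apply_times swap.rep_eq)

lemma iota_xx: "iota (xx i) = const (to_ratx (var i))"
  by (simp add: xx_def iota_const)

lemma const_inverse_xx_diff:
  assumes "i \<noteq> j"
  shows "iota (xx i - xx j) * const (1 / to_ratx (var i - var j)) = 1"
proof -
  have "var i \<noteq> (var j :: 'a polx)"
    using xx_eq_iff[of i j] assms by (auto simp: xx_def)
  then have "to_ratx (var i - var j) \<noteq> 0" by simp
  moreover have "iota (xx i - xx j) = const (to_ratx (var i - var j))"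
    by (simp add: xx_def iota_const flip: rhom_diff[OF rhom_const])
  ultimately show ?thesis
    by (simp add: rhom_1[OF rhom_const] flip: rhom_mult[OF rhom_const])
qed

text \<open>Along its own diagonal, both conditions come from \<open>regular_twist\<close>: for the
  pole, v_\<sigma> - s(v_{s\<sigma>}) is v_\<sigma> + s(v_\<sigma>) minus s of a regular sum; for
  the sum, the numerator has the form u - s(u) with u = v_\<sigma> + v_{s\<sigma>}. Along other
  diagonals the denominator is a unit.\<close>

lemma loc_demazure_mult:
  assumes v: "loc v" and ab: "a \<noteq> b"
  shows "loc (demazure a b * v)"
proof -
  let ?s = "\<langle>a \<leftrightarrow> b\<rangle>" and ?d = "iota (xx a - xx b)"
  let ?q = "const (1 / to_ratx (var a - var b)) :: 'a ratx_poly"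
  define w where "w = v - of_perm ?s * v"
  have w: "loc w" unfolding w_def by (intro loc_diff loc_of_perm_mult v)
  have w_coeff: "smash_coeff w \<rho> = smash_coeff v \<rho> - perm_ratpol ?s (smash_coeff v (?s * \<rho>))" for \<rho>
    by (simp add: w_def coeff_of_perm_times)
  have dq: "?d * ?q = 1" by (rule const_inverse_xx_diff[OF ab])
  have dqc: "?d * (?q * c) = c" for c by (simp only: mult.assoc[symmetric] dq mult_1)
  have Aw: "demazure a b * v = of_ratpol ?q * w"
    by (simp add: demazure_def of_ratx_def w_def algebra_simps)
  have 1: "regular ?s (?d * (?q * smash_coeff w \<sigma>))" for \<sigma>
  proof -
    let ?u = "?d * smash_coeff v \<sigma>" and ?v = "smash_coeff v \<sigma> + smash_coeff v (?s * \<sigma>)"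
    \<comment> \<open>The sign of s on x_a - x_b turns u - s(u), for u = (x_a - x_b) v_\<sigma>,
      into a multiple of a sum instead of a difference.\<close>
    have pd: "perm_ratpol ?s ?d = - ?d"
      unfolding perm_ratpol_iota by (simp add: rhom_simps[OF rhom_pperm] rhom_simps[OF rhom_iota])
    have "regular ?s (smash_coeff v \<sigma> + perm_ratpol ?s (smash_coeff v \<sigma>))"
      by (rule regular_twist[OF ab locD(1)[OF v ab, of \<sigma>]])
        (simp only: perm_ratpol_mult pd, simp add: algebra_simps)
    moreover have "regular ?s (perm_ratpol ?s ?v)"
      using regular_perm[OF locD(2)[OF v ab], of ?s] by (simp add: mult.assoc swap_swap)
    ultimately have "regular ?s (smash_coeff v \<sigma> + perm_ratpol ?s (smash_coeff v \<sigma>) - perm_ratpol ?s ?v)"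
      by (rule regular_diff)
    then show ?thesis by (simp add: dqc w_coeff perm_ratpol_add)
  qed
  have 2: "regular ?s (?q * smash_coeff w \<sigma> + ?q * smash_coeff w (?s * \<sigma>))" for \<sigma>
    by (rule regular_twist[OF ab locD(2)[OF v ab, of \<sigma>]])
      (simp only: distrib_left dqc w_coeff swap_swap perm_ratpol_add, simp add: algebra_simps)
  show ?thesis
    unfolding loc_def Aw coeff_of_ratpol_times
  proof (intro allI impI)
    fix i j :: 'a and \<sigma>
    assume ij: "i \<noteq> j"
    consider "i = a" "j = b" | "i = b" "j = a" | "{a, b} \<noteq> {i, j}"
      unfolding doubleton_eq_iff by blast
    then show "regular \<langle>i \<leftrightarrow> j\<rangle> (iota (xx i - xx j) * (?q * smash_coeff w \<sigma>)) \<and>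
        regular \<langle>i \<leftrightarrow> j\<rangle> (?q * smash_coeff w \<sigma> + ?q * smash_coeff w (\<langle>i \<leftrightarrow> j\<rangle> * \<sigma>))"
    proof cases
      case 1
      then show ?thesis using \<open>\<And>\<sigma>. regular ?s (?d * (?q * smash_coeff w \<sigma>))\<close> 2 by simp
    next
      case 2
      have "iota (xx b - xx a) = - ?d" by (simp flip: rhom_uminus[OF rhom_iota])
      with 2 show ?thesis
        using regular_uminus[OF 1[of \<sigma>]] \<open>\<And>\<sigma>. regular ?s (?q * smash_coeff w \<sigma> + _ \<sigma>)\<close>
        by (simp add: swap_sym[of b a])
    next
      case 3
      have "regular \<langle>i \<leftrightarrow> j\<rangle> ?q"
        by (rule regular_unit[of "xx a - xx b" _ 1])
          (simp_all add: dq rhom_1[OF rhom_iota] poly_dilate_xx_diff_neq_0[OF ab 3])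
      from regular_mult[OF this locD(1)[OF w ij]] regular_mult[OF this locD(2)[OF w ij]]
      show ?thesis by (simp add: mult_ac distrib_left)
    qed
  qed
qed

text \<open>The elements whose left multiplication preserves \<open>loc\<close> form a subalgebra
  without any product rule for \<open>loc\<close> itself. It contains the generators, and it is then
  applied to 1.\<close>

lemma loc_HTZ:
  assumes "v \<in> HTZ"
  shows "loc v"
proof -
  let ?U = "{a :: 'a smash. \<forall>v. loc v \<longrightarrow> loc (a * v)}"
  have cplx: "of_cplx c = of_ratpol (iota (cc c))" for c
    by (simp add: of_cplx_def of_pol_def of_ratx_def cc_def iota_const)
  have "csubalgebra ?U"
    unfolding csubalgebra_def
    by (auto simp: distrib_right mult.assoc cplx intro: loc_add loc_iota_mult)
  moreover have "{demazure i j |i j. covers i j} \<union> range xvar \<union> range yvar \<subseteq> ?U"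
    using loc_iota_mult[of _ "xx _"] loc_iota_mult[of _ "yy _"]
    by (auto simp: covers_def intro!: loc_demazure_mult)
      (simp_all add: xvar_def yvar_def of_pol_def of_ratx_def iota_xx iota_yy)
  ultimately have "HTZ \<subseteq> ?U"
    unfolding HTZ_def by (intro hull_minimal)
  moreover have "loc (1 :: 'a smash)"
  proof -
    have "smash_coeff (1 :: 'a smash) \<sigma> = iota (if \<sigma> = 1 then 1 else 0)" for \<sigma>
      by (simp add: one_smash_def rhom_simps[OF rhom_iota])
    then show ?thesis
      by (simp only: loc_def rhom_add[OF rhom_iota, symmetric] rhom_mult[OF rhom_iota, symmetric]
          regular_iota simp_thms)
  qed
  ultimately show ?thesis using assms by force
qed

section \<open>Elements of the algebra\<close>

abbreviation XX :: "'n::linorder \<Rightarrow> 'n ratx" where "XX i \<equiv> to_ratx (var i)"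

lemma to_ratx_diff: "to_ratx (p - q) = to_ratx p - to_ratx q"
  by (rule rhom_diff[OF rhom_to_ratx])

lemma var_eq_iff [simp]: "var i = (var j :: ('n, 'c::zero_neq_one) pol) \<longleftrightarrow> i = j"
  by (simp add: var_def single_eq_single_iff)

lemma of_ratpol_add: "of_ratpol (f + g) = (of_ratpol f + of_ratpol g :: 'n::{finite,linorder} smash)"
  by (rule smash_eqI) (simp add: of_ratpol_def)

lemma of_ratpol_diff: "of_ratpol (f - g) = (of_ratpol f - of_ratpol g :: 'n::{finite,linorder} smash)"
  by (rule smash_eqI) (simp add: of_ratpol_def)

lemma of_ratpol_0 [simp]: "of_ratpol 0 = (0 :: 'n::{finite,linorder} smash)"
  by (rule smash_eqI) (simp add: of_ratpol_def)

lemma of_ratpol_1 [simp]: "of_ratpol 1 = (1 :: 'n::{finite,linorder} smash)"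
  by (rule smash_eqI) (simp add: of_ratpol_def one_smash_def)

lemma of_ratpol_sum: "of_ratpol (sum f A) = (\<Sum>a\<in>A. of_ratpol (f a) :: 'n::{finite,linorder} smash)"
  by (induction A rule: infinite_finite_induct) (simp_all add: of_ratpol_add)

lemma of_ratx_mult: "of_ratx p * of_ratx q = (of_ratx (p * q) :: 'n::{finite,linorder} smash)"
  by (simp add: of_ratx_def of_ratpol_mult rhom_mult[OF rhom_const])

lemma of_ratx_diff: "of_ratx (p - q) = (of_ratx p - of_ratx q :: 'n::{finite,linorder} smash)"
  by (simp add: of_ratx_def of_ratpol_diff rhom_diff[OF rhom_const])

lemma of_ratx_1 [simp]: "of_ratx 1 = (1 :: 'n::{finite,linorder} smash)"
  by (simp add: of_ratx_def rhom_1[OF rhom_const])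

lemma of_ratx_0 [simp]: "of_ratx 0 = (0 :: 'n::{finite,linorder} smash)"
  by (simp add: of_ratx_def rhom_0[OF rhom_const])

lemma of_perm_1 [simp]: "of_perm 1 = (1 :: 'n::{finite,linorder} smash)"
  by (rule smash_eqI) (simp add: of_perm_def one_smash_def)

lemma of_perm_of_ratx:
  "of_perm \<sigma> * of_ratx q = of_ratx (perm_rat \<sigma> q) * (of_perm \<sigma> :: 'n::{finite,linorder} smash)"
  by (simp add: of_ratx_def of_perm_of_ratpol perm_ratpol_const)

lemma of_ratpol_commute: "of_ratpol f * of_ratpol g = (of_ratpol g * of_ratpol f :: 'n::{finite,linorder} smash)"
  by (simp add: of_ratpol_mult mult.commute)

lemma xvar_eq: "xvar i = of_ratx (XX i)"
  by (simp add: xvar_def of_pol_def)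

lemma rhom_perm_rat: "rhom (perm_rat \<sigma>)"
  by (rule rhomI) (simp_all add: perm_rat_add perm_rat_mult)

lemma perm_rat_divide: "perm_rat \<sigma> (p / q) = perm_rat \<sigma> p / perm_rat \<sigma> q"
proof (cases "q = 0")
  case False
  have "perm_rat \<sigma> q \<noteq> 0"
  proof
    assume "perm_rat \<sigma> q = 0"
    then have "perm_rat (inverse \<sigma>) (perm_rat \<sigma> q) = 0" by simp
    then show False using False by (simp flip: perm_rat_times)
  qed
  moreover have "perm_rat \<sigma> (p / q) * perm_rat \<sigma> q = perm_rat \<sigma> p"
    using False by (simp flip: perm_rat_mult)
  ultimately show ?thesis by (simp add: field_simps)
qed simp

lemma perm_rat_XX [simp]: "perm_rat \<sigma> (XX i) = XX (\<sigma> \<langle>$\<rangle> i)"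
  by (simp add: perm_rat_to_ratx perm_pol_var)

lemma HTZ_1: "1 \<in> HTZ"
  and HTZ_add: "a \<in> HTZ \<Longrightarrow> b \<in> HTZ \<Longrightarrow> a + b \<in> HTZ"
  and HTZ_mult: "a \<in> HTZ \<Longrightarrow> b \<in> HTZ \<Longrightarrow> a * b \<in> HTZ"
  and HTZ_cplx_mult: "a \<in> HTZ \<Longrightarrow> of_cplx c * a \<in> HTZ"
  using csubalgebra_HTZ unfolding csubalgebra_def by auto

lemma HTZ_cplx: "of_cplx c \<in> HTZ"
  using HTZ_cplx_mult[OF HTZ_1] by simp

lemma of_cplx_eq: "of_cplx c = of_ratpol (iota (cc c))"
  by (simp add: of_cplx_def of_pol_def of_ratx_def cc_def iota_const)

lemma of_cplx_minus_1: "of_cplx (-1) = (-1 :: 'n::{finite,linorder} smash)"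
proof -
  have "of_cplx (-1) = (of_ratpol (0 - 1) :: 'n smash)"
    by (simp add: of_cplx_eq rhom_simps[OF rhom_cc] rhom_simps[OF rhom_iota])
  also have "\<dots> = - 1" by (simp only: of_ratpol_diff of_ratpol_0 of_ratpol_1) simp
  finally show ?thesis .
qed

lemma HTZ_diff: "a \<in> HTZ \<Longrightarrow> b \<in> HTZ \<Longrightarrow> a - b \<in> HTZ"
  for a b :: "'n::{finite,linorder} smash"
  using HTZ_add[of a "of_cplx (-1) * b"] HTZ_cplx_mult[of b "-1"] by (simp add: of_cplx_minus_1)

lemma HTZ_xvar: "xvar i \<in> HTZ" and HTZ_yvar: "yvar i \<in> HTZ"
  unfolding HTZ_def by (rule hull_inc; auto)+

lemma demazure_conj:
  "of_perm \<sigma> * demazure a b * of_perm (inverse \<sigma>) =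
     demazure (\<sigma> \<langle>$\<rangle> a) (\<sigma> \<langle>$\<rangle> b)"
  for a b :: "'n::{finite,linorder}"
proof -
  have "of_perm \<sigma> * demazure a b * of_perm (inverse \<sigma>) =
      of_ratx (1 / to_ratx (var (\<sigma> \<langle>$\<rangle> a) - var (\<sigma> \<langle>$\<rangle> b))) *
        (of_perm \<sigma> * (1 - of_perm \<langle>a \<leftrightarrow> b\<rangle>) * of_perm (inverse \<sigma>))"
    unfolding demazure_def mult.assoc[symmetric] of_perm_of_ratx
    by (simp add: perm_rat_divide to_ratx_diff rhom_diff[OF rhom_perm_rat])
  also have "of_perm \<sigma> * (1 - of_perm \<langle>a \<leftrightarrow> b\<rangle>) * of_perm (inverse \<sigma>) =
      (1 - of_perm \<langle>\<sigma> \<langle>$\<rangle> a \<leftrightarrow> \<sigma> \<langle>$\<rangle> b\<rangle> :: 'n smash)"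
    by (simp add: left_diff_distrib right_diff_distrib of_perm_mult swap_conj)
  finally show ?thesis by (simp add: demazure_def)
qed

text \<open>This puts transpositions into the algebra, although only the operators
  \<open>demazure\<close> and the variables are generators.\<close>

lemma of_perm_swap_eq:
  assumes "i \<noteq> j"
  shows "of_perm \<langle>i \<leftrightarrow> j\<rangle> = (1 - (xvar i - xvar j) * demazure i j :: 'n::{finite,linorder} smash)"
proof -
  have "to_ratx (var i - var j :: 'n polx) \<noteq> 0" using assms by simp
  then have "(xvar i - xvar j) * of_ratx (1 / to_ratx (var i - var j)) = (1 :: 'n smash)"
    by (simp add: xvar_eq of_ratx_mult to_ratx_diff flip: of_ratx_diff)
  then show ?thesis by (simp add: demazure_def flip: mult.assoc)
qed

text \<open>Only neighbouring indices give generators. For l strictly between i and j, conjugation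
  by the transposition of l and j moves the pair i, l to i, j, and both shorter intervals contain
  fewer elements.\<close>

lemma HTZ_swap_demazure_less:
  "i < j \<Longrightarrow> of_perm \<langle>i \<leftrightarrow> j\<rangle> \<in> HTZ \<and> demazure i j \<in> HTZ" for i j :: "'n::{finite,linorder}"
proof (induction "card {i<..<j}" arbitrary: i j rule: less_induct)
  case less
  show ?case
  proof (cases "covers i j")
    case True
    then have "demazure i j \<in> HTZ" unfolding HTZ_def by (intro hull_inc) auto
    moreover from this have "of_perm \<langle>i \<leftrightarrow> j\<rangle> \<in> HTZ"
      using less.prems by (subst of_perm_swap_eq) (auto intro!: HTZ_diff HTZ_mult HTZ_1 HTZ_xvar)
    ultimately show ?thesis by simp
  next
    case False
    then obtain l where l: "i < l" "l < j" using less.prems by (auto simp: covers_def)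
    have "card {i<..<l} < card {i<..<j}" "card {l<..<j} < card {i<..<j}"
      using l by (auto intro!: psubset_card_mono)
    with less.hyps l have 1: "of_perm \<langle>i \<leftrightarrow> l\<rangle> \<in> HTZ" "demazure i l \<in> HTZ" "of_perm \<langle>l \<leftrightarrow> j\<rangle> \<in> HTZ"
      by blast+
    have "of_perm \<langle>l \<leftrightarrow> j\<rangle> * demazure i l * of_perm \<langle>l \<leftrightarrow> j\<rangle> = demazure i j"
      using demazure_conj[of "\<langle>l \<leftrightarrow> j\<rangle>" i l] l by simp
    moreover have "of_perm \<langle>l \<leftrightarrow> j\<rangle> * of_perm \<langle>i \<leftrightarrow> l\<rangle> * of_perm \<langle>l \<leftrightarrow> j\<rangle> = (of_perm \<langle>i \<leftrightarrow> j\<rangle> :: 'n smash)"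
      using swap_conj[of "\<langle>l \<leftrightarrow> j\<rangle>" i l] l by (simp add: of_perm_mult)
    ultimately show ?thesis using 1 by (metis HTZ_mult)
  qed
qed

lemma HTZ_swap: "i \<noteq> j \<Longrightarrow> of_perm \<langle>i \<leftrightarrow> j\<rangle> \<in> HTZ" for i j :: "'n::{finite,linorder}"
  using HTZ_swap_demazure_less[of i j] HTZ_swap_demazure_less[of j i]
  by (cases "i < j") (auto simp: swap_sym[of i j])

lemma HTZ_demazure:
  fixes i j :: "'n::{finite,linorder}"
  assumes "i \<noteq> j"
  shows "demazure i j \<in> HTZ"
proof (cases "i < j")
  case False
  then have "of_perm \<langle>i \<leftrightarrow> j\<rangle> * demazure j i * of_perm \<langle>i \<leftrightarrow> j\<rangle> \<in> HTZ"
    using assms HTZ_swap_demazure_less[of j i] by (intro HTZ_mult HTZ_swap) auto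
  then show ?thesis using demazure_conj[of "\<langle>i \<leftrightarrow> j\<rangle>" j i] by simp
qed (use HTZ_swap_demazure_less in blast)

section \<open>Divided differences\<close>

text \<open>Lagrange form of the divided difference with nodes x_i and values \<delta>_i in a
  noncommutative ring; the scalars stay on the left.\<close>

definition divdiff :: "('n \<Rightarrow> 'n smash) \<Rightarrow> 'n set \<Rightarrow> 'n::{finite,linorder} smash" where
  "divdiff \<delta> V = (\<Sum>i\<in>V. of_ratx (\<Prod>j\<in>V - {i}. 1 / (XX i - XX j)) * \<delta> i)"

lemma divdiff_singleton [simp]: "divdiff \<delta> {i} = \<delta> i"
  by (simp add: divdiff_def)

lemma divdiff_insert2:
  fixes \<delta> :: "'n \<Rightarrow> 'n::{finite,linorder} smash"
  assumes "a \<notin> V" "b \<notin> V" "a \<noteq> b"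
  shows "divdiff \<delta> (insert a (insert b V)) =
    of_ratx (1 / (XX a - XX b)) * (divdiff \<delta> (insert a V) - divdiff \<delta> (insert b V))"
proof -
  let ?c = "\<lambda>V i. \<Prod>j\<in>V - {i}. 1 / (XX i - XX j :: 'n ratx)"
  let ?q = "1 / (XX a - XX b) :: 'n ratx"
  have nz: "XX a - XX b \<noteq> (0 :: 'n ratx)" "XX b - XX a \<noteq> (0 :: 'n ratx)" using assms by auto
  \<comment> \<open>Partial fractions in x_i for the two factors with nodes a and b.\<close>
  have 1: "?c (insert a (insert b V)) i = ?q * (?c (insert a V) i - ?c (insert b V) i)" if i: "i \<in> V" for i
  proof -
    have ia: "i \<noteq> a" "i \<noteq> b" using i assms by auto
    then have nz': "XX i - XX a \<noteq> (0 :: 'n ratx)" "XX i - XX b \<noteq> (0 :: 'n ratx)" by auto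
    have e: "insert a (insert b V) - {i} = insert a (insert b (V - {i}))"
      "insert a V - {i} = insert a (V - {i})" "insert b V - {i} = insert b (V - {i})"
      using ia by auto
    show ?thesis
      unfolding e using assms nz nz' by (simp add: prod.insert) (simp add: divide_simps, simp add: algebra_simps)
  qed
  have 2: "?c (insert a (insert b V)) a = ?q * ?c (insert a V) a"
  proof -
    have "insert a (insert b V) - {a} = insert b V" "insert a V - {a} = V" using assms by auto
    then show ?thesis using assms by simp
  qed
  have 3: "?c (insert a (insert b V)) b = - (?q * ?c (insert b V) b)"
  proof -
    have "insert a (insert b V) - {b} = insert a V" "insert b V - {b} = V" using assms by auto
    moreover have "1 / (XX b - XX a) = - ?q" using nz by (simp add: divide_simps)
    ultimately show ?thesis using assms by (simp add: prod.insert)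
  qed
  have m: "of_ratx (- q) = (- of_ratx q :: 'n smash)" for q
    using of_ratx_diff[of 0 q] by simp
  have "divdiff \<delta> (insert a (insert b V)) = of_ratx (?c (insert a (insert b V)) a) * \<delta> a +
      (of_ratx (?c (insert a (insert b V)) b) * \<delta> b + (\<Sum>i\<in>V. of_ratx (?c (insert a (insert b V)) i) * \<delta> i))"
    using assms by (simp add: divdiff_def)
  also have "(\<Sum>i\<in>V. of_ratx (?c (insert a (insert b V)) i) * \<delta> i) =
      (\<Sum>i\<in>V. of_ratx ?q * (of_ratx (?c (insert a V) i) * \<delta> i) - of_ratx ?q * (of_ratx (?c (insert b V) i) * \<delta> i))"
    by (rule sum.cong) (simp_all only: 1 of_ratx_mult[symmetric] of_ratx_diff right_diff_distrib left_diff_distrib mult.assoc)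
  also have "\<dots> = of_ratx ?q * ((\<Sum>i\<in>V. of_ratx (?c (insert a V) i) * \<delta> i) - (\<Sum>i\<in>V. of_ratx (?c (insert b V) i) * \<delta> i))"
    by (simp only: sum_subtractf sum_distrib_left right_diff_distrib)
  also have "of_ratx (?c (insert a (insert b V)) a) * \<delta> a + (of_ratx (?c (insert a (insert b V)) b) * \<delta> b + \<dots>) =
      of_ratx ?q * (of_ratx (?c (insert a V) a) * \<delta> a + (\<Sum>i\<in>V. of_ratx (?c (insert a V) i) * \<delta> i) -
        (of_ratx (?c (insert b V) b) * \<delta> b + (\<Sum>i\<in>V. of_ratx (?c (insert b V) i) * \<delta> i)))"
    unfolding 2 3 m of_ratx_mult[symmetric] by (simp add: algebra_simps)
  also have "\<dots> = of_ratx ?q * (divdiff \<delta> (insert a V) - divdiff \<delta> (insert b V))"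
    using assms by (simp add: divdiff_def)
  finally show ?thesis .
qed

lemma of_perm_divdiff:
  "of_perm \<tau> * divdiff \<delta> V = divdiff (\<lambda>i. of_perm \<tau> * \<delta> (inverse \<tau> \<langle>$\<rangle> i)) (apply \<tau> ` V)"
proof -
  have "of_perm \<tau> * of_ratx (\<Prod>j\<in>V - {i}. 1 / (XX i - XX j)) =
      of_ratx (\<Prod>j\<in>apply \<tau> ` V - {\<tau> \<langle>$\<rangle> i}. 1 / (XX (\<tau> \<langle>$\<rangle> i) - XX j)) * of_perm \<tau>" for i
  proof -
    have "apply \<tau> ` V - {\<tau> \<langle>$\<rangle> i} = apply \<tau> ` (V - {i})" by (auto simp: inj_eq[OF inj_apply])
    then show ?thesis
      by (simp add: of_perm_of_ratx rhom_prod[OF rhom_perm_rat] perm_rat_divide rhom_diff[OF rhom_perm_rat]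
          prod.reindex inj_on_def inj_eq[OF inj_apply])
  qed
  then show ?thesis
    unfolding divdiff_def
    by (simp add: sum.reindex inj_on_def inj_eq[OF inj_apply] sum_distrib_left apply_sequence flip: mult.assoc)
qed

lemma swap_image_insert: "a \<notin> V \<Longrightarrow> b \<notin> V \<Longrightarrow> apply \<langle>a \<leftrightarrow> b\<rangle> ` insert a V = insert b V"
  by (force simp: swap.rep_eq Transposition.transpose_def image_def)

lemma divdiff_cong: "(\<And>i. i \<in> V \<Longrightarrow> \<delta> i = \<delta>' i) \<Longrightarrow> divdiff \<delta> V = divdiff \<delta>' V"
  by (simp add: divdiff_def)

lemma demazure_eq: "demazure a b = of_ratx (1 / (XX a - XX b)) * (1 - of_perm \<langle>a \<leftrightarrow> b\<rangle>)"
  by (simp add: demazure_def to_ratx_diff)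

text \<open>For an equivariant family, s exchanges the two divided differences in the recursion, so
  adding a node is left multiplication by \<open>demazure a b\<close>.\<close>

lemma HTZ_divdiff_equivariant:
  fixes \<delta> :: "'n \<Rightarrow> 'n::{finite,linorder} smash"
  assumes inv: "\<And>a b i. a \<in> U \<Longrightarrow> b \<in> U \<Longrightarrow> i \<in> U \<Longrightarrow> of_perm \<langle>a \<leftrightarrow> b\<rangle> * \<delta> i = \<delta> (\<langle>a \<leftrightarrow> b\<rangle> \<langle>$\<rangle> i)"
    and in_HTZ: "\<And>i. i \<in> U \<Longrightarrow> \<delta> i \<in> HTZ"
    and "V \<subseteq> U" "a \<in> U" "a \<notin> V"
  shows "divdiff \<delta> (insert a V) \<in> HTZ"
proof -
  have "finite V" by simp
  then show ?thesis using assms(3-5)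
  proof (induction V rule: finite_induct)
    case empty
    then show ?case by (simp add: in_HTZ)
  next
    case (insert b V)
    let ?s = "\<langle>a \<leftrightarrow> b\<rangle>"
    have ab: "a \<noteq> b" "a \<in> U" "b \<in> U" "a \<notin> V" "b \<notin> V" "V \<subseteq> U" using insert by auto
    have U: "?s \<langle>$\<rangle> i \<in> U" if "i \<in> U" for i
      using that ab by (auto simp: swap.rep_eq Transposition.transpose_def)
    have "of_perm ?s * divdiff \<delta> (insert a V) = divdiff \<delta> (insert b V)"
      unfolding of_perm_divdiff swap_image_insert[OF ab(4,5)]
    proof (rule divdiff_cong)
      fix i assume "i \<in> insert b V"
      then have "i \<in> U" using ab by auto
      then show "of_perm ?s * \<delta> (inverse ?s \<langle>$\<rangle> i) = \<delta> i"
        by (simp add: inv[OF ab(2,3) U] apply_sequence swap_swap[of a b 1, simplified])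
    qed
    then have "divdiff \<delta> (insert a (insert b V)) = demazure a b * divdiff \<delta> (insert a V)"
      unfolding divdiff_insert2[OF ab(4,5,1)] demazure_eq by (simp add: algebra_simps)
    then show ?case using insert ab by (simp add: HTZ_mult HTZ_demazure)
  qed
qed

text \<open>The y_i are equivariant only under conjugation, so s f = g s for the two shorter divided
  differences f and g. The twisted commutator A f - g A then replaces A f: its terms ending in s
  cancel and the recursion remains.\<close>

lemma HTZ_divdiff_yvar:
  fixes a :: "'n::{finite,linorder}"
  assumes "a \<notin> V"
  shows "divdiff yvar (insert a V) \<in> HTZ"
proof -
  have "finite V" by simp
  then show ?thesis using assms
  proof (induction V arbitrary: a rule: finite_induct)
    case empty
    then show ?case by (simp add: HTZ_yvar)
  next
    case (insert b V)
    let ?s = "\<langle>a \<leftrightarrow> b\<rangle>" and ?q = "1 / (XX a - XX b) :: 'n ratx"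
    have ab: "a \<noteq> b" "a \<notin> V" "b \<notin> V" using insert by auto
    let ?f = "divdiff yvar (insert a V)" and ?g = "divdiff yvar (insert b V)"
    \<comment> \<open>Divided differences of the y_i lie in F[y], which is commutative, so scalars
      may be moved past them.\<close>
    have "divdiff yvar W = of_ratpol (\<Sum>i\<in>W. const (\<Prod>j\<in>W - {i}. 1 / (XX i - XX j)) * var i)" for W :: "'n set"
      by (simp add: divdiff_def of_ratpol_sum of_ratx_def yvar_def of_ratpol_mult)
    then have comm: "of_ratx ?q * ?g = ?g * of_ratx ?q"
      by (simp only: of_ratx_def of_ratpol_commute)
    have "of_perm ?s * divdiff (\<lambda>i. yvar i * of_perm ?s) (insert a V) =
        divdiff (\<lambda>i. of_perm ?s * (yvar (inverse ?s \<langle>$\<rangle> i) * of_perm ?s)) (insert b V)"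
      unfolding of_perm_divdiff swap_image_insert[OF ab(2,3)] ..
    also have "\<dots> = ?g"
    proof (rule divdiff_cong)
      fix i
      have "of_perm ?s * (yvar (inverse ?s \<langle>$\<rangle> i) * of_perm ?s) = (of_perm ?s * yvar (inverse ?s \<langle>$\<rangle> i)) * of_perm ?s"
        by (simp only: mult.assoc)
      also have "\<dots> = yvar i * (of_perm ?s * of_perm ?s)"
        by (simp add: perm_yvar apply_sequence swap_swap[of a b 1, simplified] mult.assoc)
      also have "\<dots> = yvar i"
        using swap_swap[of a b 1] by (simp add: of_perm_mult)
      finally show "of_perm ?s * (yvar (inverse ?s \<langle>$\<rangle> i) * of_perm ?s) = yvar i" .
    qed
    also have "divdiff (\<lambda>i. yvar i * of_perm ?s) (insert a V) = ?f * of_perm ?s"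
      by (simp add: divdiff_def sum_distrib_right mult.assoc)
    finally have "of_perm ?s * (?f * of_perm ?s) * of_perm ?s = ?g * of_perm ?s" by simp
    then have fg: "of_perm ?s * ?f = ?g * of_perm ?s"
      using swap_swap[of a b 1] by (simp add: of_perm_mult mult.assoc)
    have "divdiff yvar (insert a (insert b V)) = of_ratx ?q * ?f - of_ratx ?q * ?g"
      unfolding divdiff_insert2[OF ab(2,3,1)] by (simp add: right_diff_distrib)
    also have "\<dots> = demazure a b * ?f - ?g * demazure a b"
      unfolding demazure_eq right_diff_distrib left_diff_distrib mult_1_right mult.assoc fg
      unfolding mult.assoc[symmetric] comm by simp
    finally show ?case using insert ab by (simp add: HTZ_mult HTZ_demazure HTZ_diff)
  qed
qed

lemma newton_interpolation:
  fixes i :: "'n::{finite,linorder}"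
  shows "yvar i = (\<Sum>j\<in>UNIV. divdiff yvar {..j} * of_ratx (\<Prod>l\<in>{..<j}. XX i - XX l))"
proof -
  let ?C = "divdiff yvar"
  let ?P = "\<lambda>V. of_ratx (\<Prod>l\<in>V. XX i - XX l) :: 'n smash"
  \<comment> \<open>Newton's formula with remainder on an initial segment that does not contain i.
    Taking all indices below i makes the remainder the term j = i.\<close>
  have step: "yvar i = (\<Sum>j\<in>V. ?C {..j} * ?P {..<j}) + ?C (insert i V) * ?P V"
    if "\<And>v w. v \<in> V \<Longrightarrow> w < v \<Longrightarrow> w \<in> V" "i \<notin> V" "finite V" for V
    using that(3,1,2)
  proof (induction V rule: finite_linorder_max_induct)
    case empty
    then show ?case by simp
  next
    case (insert v V)
    have vi: "v \<noteq> i" "v \<notin> V" "i \<notin> V" using insert by auto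
    have V: "V = {..<v}" using insert.prems(1)[of v] insert.hyps(2) by auto
    then have Vv: "insert v V = {..v}" by auto
    have down: "\<And>u w. u \<in> V \<Longrightarrow> w < u \<Longrightarrow> w \<in> V" using V by auto
    let ?d = "XX i - XX v :: 'n ratx"
    have "?d \<noteq> 0" using vi by simp
    have "?C (insert i (insert v V)) * of_ratx ?d = ?C (insert i V) - ?C {..v}"
    proof -
      have "of_ratx ?d * (of_ratx (1 / ?d) * w) = w" for w :: "'n smash"
        using \<open>?d \<noteq> 0\<close> by (simp add: of_ratx_mult flip: mult.assoc)
      then have 1: "of_ratx ?d * ?C (insert i (insert v V)) = ?C (insert i V) - ?C (insert v V)"
        unfolding divdiff_insert2[OF vi(3,2) not_sym[OF vi(1)]] .
      have "?C W = of_ratpol (\<Sum>i\<in>W. const (\<Prod>j\<in>W - {i}. 1 / (XX i - XX j)) * var i)" for W :: "'n set"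
        by (simp add: divdiff_def of_ratpol_sum of_ratx_def yvar_def of_ratpol_mult)
      then have "of_ratx ?d * ?C W = ?C W * of_ratx ?d" for W
        by (simp only: of_ratx_def of_ratpol_commute)
      with 1 show ?thesis by (simp only: Vv)
    qed
    moreover have "?P (insert v V) = of_ratx ?d * ?P V"
      using vi by (simp add: of_ratx_mult)
    ultimately have "?C (insert i (insert v V)) * ?P (insert v V) = (?C (insert i V) - ?C {..v}) * ?P V"
      by (simp only: mult.assoc[symmetric])
    then have "(\<Sum>j\<in>insert v V. ?C {..j} * ?P {..<j}) + ?C (insert i (insert v V)) * ?P (insert v V) =
        (\<Sum>j\<in>V. ?C {..j} * ?P {..<j}) + ?C (insert i V) * ?P V"
      using vi by (simp add: V algebra_simps)
    with insert.IH[OF down vi(3)] show ?case by simp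
  qed
  have "yvar i = (\<Sum>j\<in>{..<i}. ?C {..j} * ?P {..<j}) + ?C (insert i {..<i}) * ?P {..<i}"
    by (rule step) auto
  also have "insert i {..<i} = {..i}" by auto
  also have "(\<Sum>j\<in>{..<i}. ?C {..j} * ?P {..<j}) + ?C {..i} * ?P {..<i} = (\<Sum>j\<in>{..i}. ?C {..j} * ?P {..<j})"
    by (simp add: add.commute flip: \<open>insert i {..<i} = {..i}\<close>)
  also have "\<dots> = (\<Sum>j\<in>UNIV. ?C {..j} * ?P {..<j})"
  proof (rule sum.mono_neutral_left)
    \<comment> \<open>Beyond i the product contains the factor with l = i, which is zero.\<close>
    show "\<forall>j\<in>UNIV - {..i}. ?C {..j} * ?P {..<j} = 0"
    proof
      fix j assume "j \<in> UNIV - {..i}"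
      then have "(\<Prod>l\<in>{..<j}. XX i - XX l :: 'n ratx) = 0" by (intro prod_zero) auto
      then show "?C {..j} * ?P {..<j} = 0" by (simp only: of_ratx_0 mult_zero_right)
    qed
  qed auto
  finally show ?thesis .
qed

section \<open>The symmetrizer\<close>

definition fixing :: "'n set \<Rightarrow> 'n perm set" where
  "fixing U = {\<sigma>. \<forall>i. i \<notin> U \<longrightarrow> \<sigma> \<langle>$\<rangle> i = i}"

definition vdm :: "'n set \<Rightarrow> 'n::{finite,linorder} ratx" where
  "vdm U = (\<Prod>(i, j)\<in>{(i, j). i \<in> U \<and> j \<in> U \<and> i < j}. XX i - XX j)"

text \<open>Since \<sigma> multiplies the Vandermonde product of U by its sign, this is the
  antisymmetrizer divided by that product: the Demazure operator of the longest element of the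
  symmetric group on U.\<close>

definition symmetrizer :: "'n set \<Rightarrow> 'n::{finite,linorder} smash" where
  "symmetrizer U = (\<Sum>\<sigma>\<in>fixing U. of_perm \<sigma> * of_ratx (1 / vdm U))"

lemma vdm_insert_min:
  assumes "\<And>j. j \<in> U \<Longrightarrow> u < j"
  shows "vdm (insert u U) = vdm U * (\<Prod>j\<in>U. XX u - XX j)"
proof -
  have "{(i, j). i \<in> insert u U \<and> j \<in> insert u U \<and> i < j} =
      {(i, j). i \<in> U \<and> j \<in> U \<and> i < j} \<union> Pair u ` U"
    using assms by (auto dest: less_asym)
  moreover have "{(i, j). i \<in> U \<and> j \<in> U \<and> i < j} \<inter> Pair u ` U = {}"
    using assms by auto
  ultimately show ?thesis
    by (simp add: vdm_def prod.union_disjoint prod.reindex inj_on_def)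
qed

lemma perm_inverse_eq_iff: "inverse \<sigma> \<langle>$\<rangle> i = j \<longleftrightarrow> i = \<sigma> \<langle>$\<rangle> j"
  by (metis apply_sequence apply_one id_apply perm.right_inverse perm.left_inverse)

text \<open>When a new minimum u joins U, the larger group splits into cosets according to the image
  of u. The coset sums are an equivariant family, and their divided difference is the new
  symmetrizer.\<close>

lemma HTZ_symmetrizer: "symmetrizer U \<in> HTZ" for U :: "'n::{finite,linorder} set"
proof -
  have "finite U" by simp
  then show ?thesis
  proof (induction U rule: finite_linorder_min_induct)
    case empty
    have "fixing {} = {1 :: 'n perm}"
      by (auto simp: fixing_def intro: perm_eqI)
    then show ?case by (simp add: symmetrizer_def vdm_def HTZ_1)
  next
    case (insert u U)
    let ?U = "insert u U" and ?c = "1 / vdm U :: 'n ratx"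
    have u: "u \<notin> U" using insert by auto
    \<comment> \<open>The coset sum still carries only the Vandermonde denominator of U; the missing
      factors come from the divided difference.\<close>
    define \<delta> where "\<delta> i = (\<Sum>\<sigma>\<in>{\<sigma> \<in> fixing ?U. \<sigma> \<langle>$\<rangle> u = i}. of_perm \<sigma> * of_ratx ?c)" for i
    have perm_\<delta>: "of_perm \<tau> * \<delta> i = \<delta> (\<tau> \<langle>$\<rangle> i)" if \<tau>: "\<tau> \<in> fixing ?U" for \<tau> i
    proof -
      have \<tau>': "inverse \<tau> \<in> fixing ?U" using \<tau> by (simp add: fixing_def perm_inverse_eq_iff)
      have prod: "\<mu> * \<nu> \<in> fixing ?U" if "\<mu> \<in> fixing ?U" "\<nu> \<in> fixing ?U" for \<mu> \<nu>
        using that by (simp add: fixing_def apply_times)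
      have "of_perm \<tau> * \<delta> i = (\<Sum>\<sigma>\<in>{\<sigma> \<in> fixing ?U. \<sigma> \<langle>$\<rangle> u = i}. of_perm (\<tau> * \<sigma>) * of_ratx ?c)"
        by (simp add: \<delta>_def sum_distrib_left of_perm_mult flip: mult.assoc)
      also have "\<dots> = \<delta> (\<tau> \<langle>$\<rangle> i)"
        unfolding \<delta>_def
        by (rule sum.reindex_bij_witness[where i = "\<lambda>\<sigma>. inverse \<tau> * \<sigma>" and j = "\<lambda>\<sigma>. \<tau> * \<sigma>"])
          (use \<tau> \<tau>' in \<open>auto simp: prod apply_times perm_inverse_eq_iff simp flip: mult.assoc\<close>)
      finally show ?thesis .
    qed
    have swap_fixing: "\<langle>a \<leftrightarrow> b\<rangle> \<in> fixing ?U" if "a \<in> ?U" "b \<in> ?U" for a b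
      using that by (auto simp: fixing_def swap.rep_eq Transposition.transpose_def)
    have "{\<sigma> \<in> fixing ?U. \<sigma> \<langle>$\<rangle> u = u} = fixing U"
      using u by (auto simp: fixing_def)
    then have \<delta>_u: "\<delta> u = symmetrizer U" by (simp add: \<delta>_def symmetrizer_def)
    have \<delta>_HTZ: "\<delta> i \<in> HTZ" if i: "i \<in> ?U" for i
    proof (cases "i = u")
      case True
      then show ?thesis using insert.IH \<delta>_u by simp
    next
      case False
      have "of_perm \<langle>u \<leftrightarrow> i\<rangle> * \<delta> u \<in> HTZ"
        using False insert.IH by (simp add: \<delta>_u HTZ_mult HTZ_swap)
      then show ?thesis using perm_\<delta>[OF swap_fixing[of u i], of u] i by simp
    qed
    have "divdiff \<delta> ?U \<in> HTZ"
      by (rule HTZ_divdiff_equivariant[where U = ?U]) (auto simp: u intro!: perm_\<delta> swap_fixing \<delta>_HTZ)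
    also have "divdiff \<delta> ?U = symmetrizer ?U"
    proof -
      let ?g = "\<lambda>i. \<Prod>j\<in>?U - {i}. 1 / (XX i - XX j) :: 'n ratx"
      \<comment> \<open>Moved to the right of \<sigma>, the Lagrange coefficient at \<sigma>(u)
        becomes the one at u, which extends the Vandermonde denominator of U by the factors with
        u.\<close>
      have summand: "of_ratx (?g (\<sigma> \<langle>$\<rangle> u)) * (of_perm \<sigma> * of_ratx ?c) =
          of_perm \<sigma> * (of_ratx (1 / vdm ?U) :: 'n smash)"
        if "\<sigma> \<in> fixing ?U" for \<sigma>
      proof -
        have "apply \<sigma> ` ?U \<subseteq> ?U"
        proof
          fix j assume "j \<in> apply \<sigma> ` ?U"
          then obtain i where i: "i \<in> ?U" "j = \<sigma> \<langle>$\<rangle> i" by auto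
          show "j \<in> ?U"
          proof (rule ccontr)
            assume "j \<notin> ?U"
            then have "\<sigma> \<langle>$\<rangle> j = j" using that by (simp add: fixing_def)
            then have "j = i" using i(2) by (metis inj_eq[OF inj_apply])
            then show False using i(1) \<open>j \<notin> ?U\<close> by simp
          qed
        qed
        then have "apply \<sigma> ` ?U = ?U"
          by (rule endo_inj_surj[OF finite _ inj_on_subset[OF inj_apply subset_UNIV]])
        moreover have "apply \<sigma> ` (?U - {u}) = apply \<sigma> ` ?U - {\<sigma> \<langle>$\<rangle> u}"
          by (simp only: image_set_diff[OF inj_apply] image_insert image_empty)
        moreover have "?U - {u} = U" using u by auto
        ultimately have "?U - {\<sigma> \<langle>$\<rangle> u} = apply \<sigma> ` U" by simp
        then have "?g (\<sigma> \<langle>$\<rangle> u) = perm_rat \<sigma> (\<Prod>j\<in>U. 1 / (XX u - XX j))"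
          by (simp add: rhom_prod[OF rhom_perm_rat] perm_rat_divide rhom_diff[OF rhom_perm_rat]
              prod.reindex inj_on_def inj_eq[OF inj_apply])
        then have "of_ratx (?g (\<sigma> \<langle>$\<rangle> u)) * (of_perm \<sigma> * of_ratx ?c) =
            of_perm \<sigma> * (of_ratx (\<Prod>j\<in>U. 1 / (XX u - XX j)) * (of_ratx ?c :: 'n smash))"
          by (simp only: of_perm_of_ratx[symmetric] mult.assoc[symmetric])
        also have "of_ratx (\<Prod>j\<in>U. 1 / (XX u - XX j)) * (of_ratx ?c :: 'n smash) = of_ratx (1 / vdm ?U)"
          using insert.hyps by (simp add: of_ratx_mult vdm_insert_min prod_dividef mult.commute)
        finally show ?thesis .
      qed
      have "divdiff \<delta> ?U = (\<Sum>i\<in>?U. \<Sum>\<sigma>\<in>{\<sigma> \<in> fixing ?U. \<sigma> \<langle>$\<rangle> u = i}. of_ratx (?g i) * (of_perm \<sigma> * of_ratx ?c))"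
        by (simp only: divdiff_def \<delta>_def sum_distrib_left)
      also have "\<dots> = (\<Sum>i\<in>?U. \<Sum>\<sigma>\<in>{\<sigma> \<in> fixing ?U. \<sigma> \<langle>$\<rangle> u = i}. of_perm \<sigma> * of_ratx (1 / vdm ?U))"
        by (intro sum.cong refl) (use summand in auto)
      also have "\<dots> = (\<Sum>\<sigma>\<in>fixing ?U. of_perm \<sigma> * of_ratx (1 / vdm ?U))"
      proof (rule sum.group)
        show "(\<lambda>\<sigma>. \<sigma> \<langle>$\<rangle> u) ` fixing ?U \<subseteq> ?U"
        proof safe
          fix \<sigma> assume \<sigma>: "\<sigma> \<in> fixing ?U" "\<sigma> \<langle>$\<rangle> u \<notin> U"
          show "\<sigma> \<langle>$\<rangle> u = u"
          proof (rule ccontr)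
            assume "\<sigma> \<langle>$\<rangle> u \<noteq> u"
            then have "\<sigma> \<langle>$\<rangle> (\<sigma> \<langle>$\<rangle> u) = \<sigma> \<langle>$\<rangle> u" using \<sigma> by (simp add: fixing_def)
            then show False using \<open>\<sigma> \<langle>$\<rangle> u \<noteq> u\<close> by (simp add: inj_eq[OF inj_apply])
          qed
        qed
      qed simp_all
      finally show ?thesis by (simp add: symmetrizer_def)
    qed
    finally show ?case .
  qed
qed

text \<open>Otherwise the preimage of the smallest moved point would lie below it, hence be
  fixed.\<close>

lemma perm_descent:
  fixes \<sigma> :: "'n::{finite,linorder} perm"
  assumes "\<sigma> \<noteq> 1"
  shows "\<exists>j. \<sigma> \<langle>$\<rangle> j < j"
proof (rule ccontr)
  assume "\<not> ?thesis"
  then have ge: "j \<le> \<sigma> \<langle>$\<rangle> j" for j by (auto simp: not_less)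
  let ?A = "{j. \<sigma> \<langle>$\<rangle> j \<noteq> j}"
  have "?A \<noteq> {}" using assms by (auto intro: perm_eqI)
  then have j: "Min ?A \<in> ?A" by (intro Min_in) auto
  define m where "m = inverse \<sigma> \<langle>$\<rangle> (Min ?A)"
  have m: "\<sigma> \<langle>$\<rangle> m = Min ?A" by (simp add: m_def apply_sequence)
  with j have "m \<noteq> Min ?A" by auto
  with ge[of m] m have "m < Min ?A" by simp
  then have "m \<notin> ?A" by (metis Min_le finite leD)
  with m \<open>m \<noteq> Min ?A\<close> show False by simp
qed

lemma of_perm_times_symmetrizer: "of_perm \<tau> * symmetrizer UNIV = symmetrizer UNIV"
proof -
  have "of_perm \<tau> * symmetrizer UNIV = (\<Sum>\<sigma>\<in>UNIV. of_perm (\<tau> * \<sigma>) * of_ratx (1 / vdm UNIV))"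
    by (simp add: symmetrizer_def fixing_def sum_distrib_left of_perm_mult flip: mult.assoc)
  also have "\<dots> = symmetrizer UNIV"
    unfolding symmetrizer_def
    by (rule sum.reindex_bij_witness[where i = "\<lambda>\<sigma>. inverse \<tau> * \<sigma>" and j = "\<lambda>\<sigma>. \<tau> * \<sigma>"])
      (auto simp: fixing_def simp flip: mult.assoc)
  finally show ?thesis .
qed

text \<open>
  The double Schubert polynomial of the longest element, \<open>\<Prod>\<^bsub>i<j\<^esub> (x\<^sub>i - z\<^sub>j)\<close>, vanishes at
  \<open>z = \<sigma> x\<close> unless \<open>\<sigma> = 1\<close>; so multiplying the symmetrizer by \<open>x\<^sub>i\<close> on the left minus \<open>x\<^sub>j\<close> on
  the right, for all \<open>i < j\<close>, gives \<open>1\<close>.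
\<close>

lemma HTZ_by_symmetrizer:
  fixes v :: "'n::{finite,linorder} smash"
  assumes v: "\<And>p. v * of_pol p * symmetrizer UNIV \<in> HTZ"
  shows "v \<in> HTZ"
proof -
  let ?c = "of_ratx (1 / vdm UNIV) :: 'n smash"
  \<comment> \<open>The factors are inserted one pair at a time, interpolating between the
    symmetrizer (no pair) and 1 (all pairs i < j).\<close>
  define w where "w A = (\<Sum>\<sigma>\<in>UNIV. of_ratx (\<Prod>(i, j)\<in>A. XX i - XX (\<sigma> \<langle>$\<rangle> j)) * of_perm \<sigma> * ?c)"
    for A :: "('n \<times> 'n) set"
  have w_insert: "w (insert (i, j) A) = xvar i * w A - w A * xvar j" if "(i, j) \<notin> A" for i j A
  proof -
    have "of_ratx (\<Prod>(i, j)\<in>insert (i, j) A. XX i - XX (\<sigma> \<langle>$\<rangle> j)) * of_perm \<sigma> * ?c =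
        xvar i * (of_ratx (\<Prod>(i, j)\<in>A. XX i - XX (\<sigma> \<langle>$\<rangle> j)) * of_perm \<sigma> * ?c) -
        of_ratx (\<Prod>(i, j)\<in>A. XX i - XX (\<sigma> \<langle>$\<rangle> j)) * of_perm \<sigma> * ?c * xvar j" for \<sigma>
    proof -
      let ?p = "\<Prod>(i, j)\<in>A. XX i - XX (\<sigma> \<langle>$\<rangle> j) :: 'n ratx"
      have "of_ratx ?p * of_perm \<sigma> * ?c * xvar j = of_ratx ?p * (of_perm \<sigma> * of_ratx (XX j)) * ?c"
        by (simp add: xvar_eq of_ratx_mult mult.assoc mult.commute)
      also have "\<dots> = of_ratx (?p * XX (\<sigma> \<langle>$\<rangle> j)) * of_perm \<sigma> * ?c"
        by (simp add: of_perm_of_ratx mult.assoc flip: of_ratx_mult)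
      finally have "of_ratx ?p * of_perm \<sigma> * ?c * xvar j = of_ratx (XX (\<sigma> \<langle>$\<rangle> j) * ?p) * of_perm \<sigma> * ?c"
        by (simp only: mult.commute)
      then show ?thesis
        using that by (simp add: left_diff_distrib of_ratx_diff xvar_eq of_ratx_mult flip: mult.assoc)
    qed
    then show ?thesis by (simp add: w_def sum_subtractf sum_distrib_left sum_distrib_right)
  qed
  \<comment> \<open>\<open>p\<close> must vary in the induction: the factor x_i created to the left
    of \<open>w A\<close> is absorbed into it.\<close>
  have "v * of_pol p * w A \<in> HTZ" for p A
  proof -
    have "finite A" by simp
    then show ?thesis
    proof (induction A arbitrary: p rule: finite_induct)
      case empty
      have "w {} = symmetrizer UNIV" by (simp add: w_def symmetrizer_def fixing_def)
      then show ?case using v by simp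
    next
      case (insert a A)
      obtain i j where a: "a = (i, j)" by (cases a)
      have "of_pol p * xvar i = of_pol (p * var i)"
        by (simp add: xvar_def of_pol_def of_ratx_mult to_ratx_mult)
      then have "v * of_pol p * w (insert a A) = v * of_pol (p * var i) * w A - v * of_pol p * w A * xvar j"
        using insert.hyps by (simp add: a w_insert right_diff_distrib mult.assoc)
          (simp flip: mult.assoc)
      then show ?case using insert.IH by (simp add: HTZ_diff HTZ_mult HTZ_xvar)
    qed
  qed
  from this[of 1 "{(i, j). i < j}"] have "v * w {(i, j). i < j} \<in> HTZ"
    by (simp add: of_pol_def to_ratx_1)
  moreover have "w {(i, j). i < j} = 1"
  proof -
    have "of_ratx (\<Prod>(i, j)\<in>{(i, j). i < j}. XX i - XX (\<sigma> \<langle>$\<rangle> j)) * of_perm \<sigma> * ?c = (if \<sigma> = 1 then 1 else 0)" for \<sigma>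
    proof (cases "\<sigma> = 1")
      case True
      have "vdm UNIV \<noteq> (0 :: 'n ratx)" by (auto simp: vdm_def)
      moreover have "(\<Prod>(i, j)\<in>{(i, j). i < j}. XX i - XX j) = (vdm UNIV :: 'n ratx)"
        by (simp add: vdm_def)
      ultimately show ?thesis using True by (simp add: of_ratx_mult)
    next
      case False
      then obtain j where "\<sigma> \<langle>$\<rangle> j < j" using perm_descent by blast
      then have "(\<Prod>(i, j)\<in>{(i, j). i < j}. XX i - XX (\<sigma> \<langle>$\<rangle> j)) = (0 :: 'n ratx)"
        by (intro prod_zero bexI[of _ "(\<sigma> \<langle>$\<rangle> j, j)"]) auto
      with False show ?thesis by (simp only: of_ratx_0 mult_zero_left if_False)
    qed
    then show ?thesis unfolding w_def by simp
  qed
  ultimately show ?thesis by simp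
qed

section \<open>Interpolation coordinates\<close>

text \<open>
  \<open>newton\<close> expresses the \<open>y\<^sub>i\<close> as values at the \<open>x\<^sub>i\<close> of a polynomial in Newton form, whose
  coefficients are named by the \<open>y\<close>-variables of the target; \<open>newton_eval\<close> substitutes the actual
  coefficients, which are divided differences.
\<close>

definition newton :: "'n::{finite,linorder} pxy \<Rightarrow> 'n pxy" where
  "newton = xyeval cc xx (\<lambda>i. \<Sum>j\<in>UNIV. yy j * (\<Prod>l\<in>{..<j}. xx i - xx l))"

text \<open>The divided differences of the y_i, taken in F[y] because evaluation requires a
  commutative target.\<close>

definition newton_coeff :: "'n \<Rightarrow> 'n::{finite,linorder} ratx_poly" where
  "newton_coeff j = (\<Sum>i\<in>{..j}. const (\<Prod>l\<in>{..j} - {i}. 1 / (XX i - XX l)) * var i)"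

definition newton_eval :: "'n::{finite,linorder} pxy \<Rightarrow> 'n ratx_poly" where
  "newton_eval = xyeval (\<lambda>c. const (to_ratx (const c))) (\<lambda>i. const (XX i)) newton_coeff"

lemma rhom_newton: "rhom newton"
  unfolding newton_def by (rule rhom_xyeval[OF rhom_cc])

lemma newton_gen:
  "newton (cc c) = cc c" "newton (xx i) = xx i"
  "newton (yy i) = (\<Sum>j\<in>UNIV. yy j * (\<Prod>l\<in>{..<j}. xx i - xx l))"
  by (simp_all add: newton_def xyeval_simps[OF rhom_cc])

lemma rhom_const_ratx: "rhom (\<lambda>c. const (to_ratx (const c)) :: 'n::linorder ratx_poly)"
  by (rule rhom_comp[OF rhom_const rhom_comp[OF rhom_to_ratx rhom_const]])

lemma rhom_newton_eval: "rhom newton_eval"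
  unfolding newton_eval_def by (rule rhom_xyeval[OF rhom_const_ratx])

lemma newton_eval_gen:
  "newton_eval (cc c) = const (to_ratx (const c))" "newton_eval (xx i) = const (XX i)"
  "newton_eval (yy i) = newton_coeff i"
  by (simp_all add: newton_eval_def xyeval_simps[OF rhom_const_ratx])

lemma of_ratpol_newton_coeff: "of_ratpol (newton_coeff j) = divdiff yvar {..j}"
  by (simp add: divdiff_def newton_coeff_def of_ratpol_sum of_ratx_def yvar_def of_ratpol_mult)

lemma of_ratpol_eq_iff [simp]: "of_ratpol f = (of_ratpol g :: 'n::{finite,linorder} smash) \<longleftrightarrow> f = g"
proof
  assume "of_ratpol f = (of_ratpol g :: 'n smash)"
  then have "smash_coeff (of_ratpol f :: 'n smash) 1 = smash_coeff (of_ratpol g) 1" by simp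
  then show "f = g" by (simp add: of_ratpol_def)
qed simp

lemma newton_eval_newton: "newton_eval (newton r) = iota r" for r :: "'n::{finite,linorder} pxy"
proof (rule pxy_hom_eqI[OF rhom_comp[OF rhom_newton_eval rhom_newton] rhom_iota])
  show "newton_eval (newton (cc c)) = iota (cc c)" for c :: complex
    unfolding newton_gen newton_eval_gen by (simp add: cc_def iota_const)
  show "newton_eval (newton (xx i)) = iota (xx i)" for i :: 'n
    by (simp add: newton_gen newton_eval_gen iota_xx)
  fix i :: 'n
  have "of_ratpol (newton_eval (newton (yy i))) = (yvar i :: 'n smash)"
    unfolding newton_interpolation[of i]
    by (simp add: newton_gen rhom_simps[OF rhom_newton_eval] newton_eval_gen of_ratpol_sum
        of_ratx_def of_ratpol_newton_coeff rhom_simps[OF rhom_const] flip: of_ratpol_mult)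
  then show "newton_eval (newton (yy i)) = iota (yy i)"
    by (simp add: yvar_def iota_yy)
qed

text \<open>The constants, the x_i and the divided differences of the y_i all lie in the algebra. So
  a division carried out in the interpolation coordinates stays in the algebra after
  evaluation.\<close>

lemma HTZ_newton_eval: "of_ratpol (newton_eval r) \<in> HTZ" for r :: "'n::{finite,linorder} pxy"
proof (induction r rule: pxy_induct)
  case (cc c)
  then show ?case
    using HTZ_cplx[of c, where 'a = 'n] by (simp add: newton_eval_gen of_cplx_def of_pol_def of_ratx_def)
next
  case (xx i)
  then show ?case
    using HTZ_xvar[of i] by (simp add: newton_eval_gen xvar_eq of_ratx_def)
next
  case (yy i)
  have "insert i {..<i} = {..i}" by auto
  then show ?case
    using HTZ_divdiff_yvar[of i "{..<i}"] by (simp add: newton_eval_gen of_ratpol_newton_coeff)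
qed (simp_all add: rhom_simps[OF rhom_newton_eval] of_ratpol_add HTZ_add HTZ_mult flip: of_ratpol_mult)

lemma newton_eval_const: "newton_eval (const p) = const (to_ratx p)"
proof (induction p rule: pol_ring_induct)
  case (const c)
  then show ?case using newton_eval_gen(1)[of c] by (simp add: cc_def)
next
  case (var i)
  then show ?case using newton_eval_gen(2)[of i] by (simp add: xx_def)
qed (simp_all add: rhom_simps[OF rhom_const] rhom_simps[OF rhom_newton_eval] rhom_simps[OF rhom_to_ratx])

lemma dvd_prod_diff:
  fixes f g :: "'a \<Rightarrow> 'b::comm_ring_1"
  assumes "\<And>l. d dvd f l - g l"
  shows "d dvd prod f A - prod g A"
proof (induction A rule: infinite_finite_induct)
  case (insert a A)
  have "prod f (insert a A) - prod g (insert a A) = (f a - g a) * prod f A + g a * (prod f A - prod g A)"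
    using insert by (simp add: algebra_simps)
  then show ?case using insert assms by (simp add: dvd_mult dvd_mult2)
qed simp_all

text \<open>In interpolation coordinates both normal directions are multiples of x_i - x_j. Thus
  \<open>newton r\<close> is the dilation of \<open>r\<close> at T = x_i - x_j with the normal
  coordinates replaced by their quotients, and T^k becomes (x_i - x_j)^k.\<close>

lemma xx_diff_dvd_newton:
  fixes r :: "'n::{finite,linorder} pxy"
  assumes ij: "i \<noteq> j" and r: "TT ^ k dvd dilate \<langle>i \<leftrightarrow> j\<rangle> r"
  shows "(xx i - xx j) ^ k dvd newton r"
proof -
  let ?s = "\<langle>i \<leftrightarrow> j\<rangle>" and ?d = "xx i - xx j :: 'n pxy" and ?h = "cc (1/2) :: 'n pxy"
  have "?d dvd (\<Sum>l\<in>UNIV. yy l * ((\<Prod>m\<in>{..<l}. xx i - xx m) - (\<Prod>m\<in>{..<l}. xx j - xx m)))"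
    by (intro dvd_sum dvd_mult dvd_prod_diff) simp
  then have "?d dvd newton (yy i) - newton (yy j)"
    by (simp add: newton_gen right_diff_distrib sum_subtractf)
  then obtain u where u: "newton (yy i) - newton (yy j) = ?d * u" by (auto simp: dvd_def)
  \<comment> \<open>\<open>\<kappa> l\<close> is the quotient of x_l - x_{s l} by x_i - x_j.\<close>
  define \<kappa> :: "'n \<Rightarrow> 'n pxy" where "\<kappa> l = (if l = i then 1 else if l = j then - 1 else 0)" for l
  have s: "?s \<langle>$\<rangle> l = (if l = i then j else if l = j then i else l)" for l
    by (simp add: swap.rep_eq Transposition.transpose_def)
  have ss: "?s \<langle>$\<rangle> (?s \<langle>$\<rangle> l) = l" for l by (simp add: s)
  have \<kappa>s: "\<kappa> (?s \<langle>$\<rangle> l) = - \<kappa> l" for l using ij by (simp add: s \<kappa>_def)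
  have \<kappa>x: "?d * \<kappa> l = xx l - xx (?s \<langle>$\<rangle> l)" for l using ij by (simp add: s \<kappa>_def)
  have \<kappa>y: "?d * (\<kappa> l * u) = newton (yy l) - newton (yy (?s \<langle>$\<rangle> l))" for l
    using ij u by (simp add: s \<kappa>_def flip: u)
  \<comment> \<open>Symmetric halves are kept, antisymmetric halves are divided by x_i - x_j;
    evaluation at T = x_i - x_j undoes the division.\<close>
  define \<eta> :: "'n pxy \<Rightarrow> 'n pxy" where
    "\<eta> = xyeval cc (\<lambda>l. ?h * (xx l + xx (?s \<langle>$\<rangle> l)) + ?h * \<kappa> l)
      (\<lambda>l. ?h * (newton (yy l) + newton (yy (?s \<langle>$\<rangle> l))) + ?h * (\<kappa> l * u))"
  have \<eta>: "rhom \<eta>" unfolding \<eta>_def by (rule rhom_xyeval[OF rhom_cc])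
  have \<eta>_gen: "\<eta> (cc c) = cc c" "\<eta> (xx l) = ?h * (xx l + xx (?s \<langle>$\<rangle> l)) + ?h * \<kappa> l"
    "\<eta> (yy l) = ?h * (newton (yy l) + newton (yy (?s \<langle>$\<rangle> l))) + ?h * (\<kappa> l * u)" for c l
    by (simp_all add: \<eta>_def xyeval_simps[OF rhom_cc])
  have half: "?h * (2 * a) = a" for a
    using two_cc_half by (metis mult.assoc mult.commute mult_1)
  have comb: "?h * ((?h * a + ?h * b) + (?h * a + ?h * (- b))) + d * (?h * ((?h * a + ?h * b) - (?h * a + ?h * (- b)))) =
      ?h * a + ?h * (d * b)" for a b d
  proof -
    have "(?h * a + ?h * b) + (?h * a + ?h * (- b)) = ?h * (2 * a)"
      "(?h * a + ?h * b) - (?h * a + ?h * (- b)) = ?h * (2 * b)"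
      by (simp_all add: algebra_simps)
    then show ?thesis by (simp only: half mult.left_commute[of d])
  qed
  have "hpoly \<eta> ?d (dilate ?s r) = newton r"
  proof (rule pxy_hom_eqI[OF rhom_comp[OF rhom_hpoly[OF \<eta>] rhom_dilate] rhom_newton])
    show "hpoly \<eta> ?d (dilate ?s (cc c)) = newton (cc c)" for c
      by (simp add: dilate_gen newton_gen hpoly_pCons[OF \<eta>] \<eta>_gen)
    fix l
    have "hpoly \<eta> ?d (dilate ?s (xx l)) = ?h * (\<eta> (xx l) + \<eta> (xx (?s \<langle>$\<rangle> l))) + ?d * (?h * (\<eta> (xx l) - \<eta> (xx (?s \<langle>$\<rangle> l))))"
      by (simp only: dilate_gen hpoly_pCons[OF \<eta>] hpoly_0 rhom_simps[OF \<eta>] \<eta>_gen(1) mult_zero_right add_0_right)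
    also have "\<dots> = ?h * (xx l + xx (?s \<langle>$\<rangle> l)) + ?h * (?d * \<kappa> l)"
      unfolding \<eta>_gen \<kappa>s ss add.commute[of "xx (?s \<langle>$\<rangle> l)"] by (rule comb)
    also have "\<dots> = xx l" by (simp only: \<kappa>x cc_half)
    finally show "hpoly \<eta> ?d (dilate ?s (xx l)) = newton (xx l)" by (simp only: newton_gen)
    have "hpoly \<eta> ?d (dilate ?s (yy l)) = ?h * (\<eta> (yy l) + \<eta> (yy (?s \<langle>$\<rangle> l))) + ?d * (?h * (\<eta> (yy l) - \<eta> (yy (?s \<langle>$\<rangle> l))))"
      by (simp only: dilate_gen hpoly_pCons[OF \<eta>] hpoly_0 rhom_simps[OF \<eta>] \<eta>_gen(1) mult_zero_right add_0_right)
    also have "\<dots> = ?h * (newton (yy l) + newton (yy (?s \<langle>$\<rangle> l))) + ?h * (?d * (\<kappa> l * u))"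
      unfolding \<eta>_gen \<kappa>s ss add.commute[of "newton (yy (?s \<langle>$\<rangle> l))"] mult_minus_left by (rule comb)
    also have "\<dots> = newton (yy l)" by (simp only: \<kappa>y cc_half)
    finally show "hpoly \<eta> ?d (dilate ?s (yy l)) = newton (yy l)" .
  qed
  with hpoly_TT_dvd[OF \<eta> r, of ?d] show ?thesis by simp
qed

section \<open>Divisibility by the Vandermonde determinant\<close>

definition collapse :: "'n \<Rightarrow> 'n \<Rightarrow> 'n::finite pxy \<Rightarrow> 'n pxy" where
  "collapse i j = xyeval cc (\<lambda>l. xx (if l = i then j else l)) yy"

lemma rhom_collapse: "rhom (collapse i j)"
  unfolding collapse_def by (rule rhom_xyeval[OF rhom_cc])

lemma collapse_gen:
  "collapse i j (cc c) = cc c" "collapse i j (xx l) = xx (if l = i then j else l)"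
  "collapse i j (yy l) = yy l"
  by (simp_all only: collapse_def xyeval_simps[OF rhom_cc])

lemma xx_diff_dvd_diff_collapse: "xx i - xx j dvd r - collapse i j r"
proof (induction r rule: pxy_induct)
  case (add p q)
  have "p + q - collapse i j (p + q) = (p - collapse i j p) + (q - collapse i j q)"
    by (simp add: rhom_add[OF rhom_collapse])
  with add show ?case by (simp only: dvd_add)
next
  case (mult p q)
  have "p * q - collapse i j (p * q) = (p - collapse i j p) * q + collapse i j p * (q - collapse i j q)"
    by (simp add: rhom_mult[OF rhom_collapse] algebra_simps)
  with mult show ?case by (simp only: dvd_add dvd_mult dvd_mult2)
qed (simp_all add: collapse_gen)

lemma xx_diff_dvd_iff: "xx i - xx j dvd r \<longleftrightarrow> collapse i j r = 0"
proof
  assume "xx i - xx j dvd r"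
  then show "collapse i j r = 0"
    by (auto simp: dvd_def rhom_simps[OF rhom_collapse] collapse_gen)
next
  assume "collapse i j r = 0"
  then show "xx i - xx j dvd r" using xx_diff_dvd_diff_collapse[of i j r] by simp
qed

text \<open>Its multiples are the kernel of the homomorphism \<open>collapse i j\<close> into a
  domain.\<close>

lemma prime_elem_xx_diff:
  fixes i j :: "'n::{finite,linorder}"
  assumes "i \<noteq> j"
  shows "prime_elem (xx i - xx j)"
  unfolding prime_elem_def using assms
  by (auto simp: xx_diff_dvd_iff rhom_simps[OF rhom_collapse])

lemma prime_elem_power_dvd_cancel:
  fixes p :: "'a::idom"
  assumes p: "prime_elem p" "\<not> p dvd a" and "p ^ k dvd a * b"
  shows "p ^ k dvd b"
  using assms(3)
proof (induction k)
  case (Suc k)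
  then have "p ^ k dvd b" by (metis dvd_trans le_imp_power_dvd lessI less_imp_le)
  then obtain c where c: "b = p ^ k * c" by (auto simp: dvd_def)
  have "p ^ k * p dvd p ^ k * (a * c)" using Suc.prems by (simp add: c mult_ac)
  then have "p dvd a * c" using p(1) by (simp add: prime_elem_def)
  then have "p dvd c" using p by (simp add: prime_elem_dvd_mult_iff)
  then show ?case by (simp add: c mult.commute[of p] mult_dvd_mono)
qed simp

lemma const_vandermonde: "const vandermonde = (\<Prod>(i, j)\<in>{(i, j). i < j}. xx i - xx j)"
  by (simp add: vandermonde_def rhom_prod[OF rhom_const] rhom_diff[OF rhom_const] xx_def case_prod_unfold)

lemma vandermonde_power_dvd:
  fixes r :: "'n::{finite,linorder} pxy"
  assumes "\<And>i j. i < j \<Longrightarrow> (xx i - xx j) ^ k dvd r"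
  shows "const vandermonde ^ k dvd r"
proof -
  have "(\<Prod>(i, j)\<in>A. xx i - xx j) ^ k dvd r" if "A \<subseteq> {(i, j). i < j}" for A :: "('n \<times> 'n) set"
  proof -
    have "finite A" by simp
    then show ?thesis using that
    proof (induction A rule: finite_induct)
      case (insert a A)
      obtain i j where a: "a = (i, j)" by (cases a)
      have ij: "i < j" using insert.prems by (simp add: a)
      obtain q where q: "r = (\<Prod>(i, j)\<in>A. xx i - xx j) ^ k * q"
        using insert by (auto simp: dvd_def)
      have prime: "prime_elem (xx i - xx j :: 'n pxy)" using ij by (intro prime_elem_xx_diff) simp
      have "\<not> xx i - xx j dvd (\<Prod>(i, j)\<in>A. xx i - xx j :: 'n pxy)"
      proof -
        \<comment> \<open>Both pairs are increasing, so distinct ordered pairs are also distinct as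
          sets; otherwise setting x_i = x_j could kill the factor.\<close>
        have "collapse i j (xx b - xx c) \<noteq> 0" if "(b, c) \<in> A" for b c
        proof -
          have "b < c" "(b, c) \<noteq> (i, j)" using that insert.prems insert.hyps a by auto
          then show ?thesis using ij by (auto simp: rhom_diff[OF rhom_collapse] collapse_gen)
        qed
        then show ?thesis
          by (auto simp: xx_diff_dvd_iff rhom_prod[OF rhom_collapse])
      qed
      then have "\<not> xx i - xx j dvd (\<Prod>(i, j)\<in>A. xx i - xx j :: 'n pxy) ^ k"
        using prime_elem_dvd_power[OF prime] by blast
      then have "(xx i - xx j) ^ k dvd q"
        using assms[OF ij] unfolding q by (rule prime_elem_power_dvd_cancel[OF prime])
      then show ?case using insert.hyps
        by (simp add: a q power_mult_distrib mult.commute[of "(xx i - xx j) ^ k"] mult_dvd_mono)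
    qed simp
  qed
  then show ?thesis by (simp add: const_vandermonde)
qed

abbreviation inv_vandermonde :: "nat \<Rightarrow> 'n::{finite,linorder} ratx_poly" where
  "inv_vandermonde k \<equiv> const (1 / to_ratx (vandermonde ^ k))"

lemma vandermonde_neq_0: "vandermonde \<noteq> (0 :: 'n::{finite,linorder} polx)"
  by (auto simp: vandermonde_def)

lemma inv_vandermonde:
  "inv_vandermonde k * iota (const (vandermonde ^ k)) = (1 :: 'n::{finite,linorder} ratx_poly)"
  using vandermonde_neq_0[where 'n = 'n]
  by (simp add: iota_const rhom_1[OF rhom_const] flip: rhom_mult[OF rhom_const])

text \<open>\<open>newton\<close> makes the division by \<Delta>^k possible, and
  \<open>newton_eval\<close> fixes polynomials in x, so the quotient evaluates to the given
  element.\<close>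

lemma HTZ_inv_vandermonde_mult:
  fixes r :: "'n::{finite,linorder} pxy"
  assumes "\<And>i j. i \<noteq> j \<Longrightarrow> TT ^ k dvd dilate \<langle>i \<leftrightarrow> j\<rangle> r"
  shows "of_ratpol (inv_vandermonde k * iota r) \<in> HTZ"
proof -
  have "const vandermonde ^ k dvd newton r"
    by (rule vandermonde_power_dvd, rule xx_diff_dvd_newton) (simp_all add: assms)
  then obtain q where q: "newton r = const (vandermonde ^ k) * q"
    by (auto simp: dvd_def rhom_power[OF rhom_const])
  have "iota r = newton_eval (newton r)" by (simp only: newton_eval_newton)
  also have "\<dots> = iota (const (vandermonde ^ k)) * newton_eval q"
    by (simp only: q rhom_mult[OF rhom_newton_eval] newton_eval_const iota_const)
  finally have "inv_vandermonde k * iota r = inv_vandermonde k * iota (const (vandermonde ^ k)) * newton_eval q"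
    by (simp only: mult.assoc)
  then have "inv_vandermonde k * iota r = newton_eval q"
    by (simp only: inv_vandermonde mult_1)
  then show ?thesis by (simp only: HTZ_newton_eval)
qed

section \<open>Characterization of the module\<close>

definition emb :: "nat \<Rightarrow> ('n perm \<Rightarrow> 'n pxy) \<Rightarrow> 'n::{finite,linorder} smash" where
  "emb k r = of_ratpol (inv_vandermonde k) * Smash (\<lambda>\<sigma>. iota (r \<sigma>))"

text \<open>
  Multiplying by the extra \<open>T\<close> expresses membership in the power \<open>k - 1\<close> of the ideal without a
  truncated subtraction.
\<close>

definition vanishing :: "nat \<Rightarrow> ('n perm \<Rightarrow> 'n::finite pxy) \<Rightarrow> bool" where
  "vanishing k r \<longleftrightarrow> (\<forall>i j \<sigma>. i \<noteq> j \<longrightarrow>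
     TT ^ k dvd TT * dilate \<langle>i \<leftrightarrow> j\<rangle> (r \<sigma>) \<and>
     TT ^ k dvd dilate \<langle>i \<leftrightarrow> j\<rangle> (r \<sigma> + r (\<langle>i \<leftrightarrow> j\<rangle> * \<sigma>)))"

lemma smash_coeff_emb: "smash_coeff (emb k r) \<sigma> = inv_vandermonde k * iota (r \<sigma>)"
  by (simp add: emb_def coeff_of_ratpol_times)

lemma vandermonde_mult_emb: "of_pol (vandermonde ^ k) * emb k r = Smash (\<lambda>\<sigma>. iota (r \<sigma>))"
proof -
  have "of_pol (vandermonde ^ k) * of_ratpol (inv_vandermonde k) = (of_ratpol (inv_vandermonde k * iota (const (vandermonde ^ k))) :: 'a smash)"
    by (simp add: of_pol_def of_ratx_def iota_const of_ratpol_mult mult.commute)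
  then show ?thesis by (simp add: emb_def inv_vandermonde flip: mult.assoc)
qed

lemma emb_eq_iff [simp]: "emb k r = emb k r' \<longleftrightarrow> r = r'"
proof
  assume "emb k r = emb k r'"
  then have "Smash (\<lambda>\<sigma>. iota (r \<sigma>)) = Smash (\<lambda>\<sigma>. iota (r' \<sigma>))"
    by (metis vandermonde_mult_emb)
  then have "iota (r \<sigma>) = iota (r' \<sigma>)" for \<sigma> by (metis smash_coeff_Smash)
  then show "r = r'" by auto
qed simp

text \<open>\<Delta> vanishes on the locus, so clearing \<Delta>^k from a regular quotient leaves at
  least k factors T on the numerator.\<close>

lemma regular_imp_TT_dvd:
  fixes p :: "'n::{finite,linorder} pxy"
  assumes "regular \<langle>i \<leftrightarrow> j\<rangle> (inv_vandermonde k * iota p)" "i \<noteq> j"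
  shows "TT ^ k dvd dilate \<langle>i \<leftrightarrow> j\<rangle> p"
proof -
  let ?s = "\<langle>i \<leftrightarrow> j\<rangle>"
  obtain h g where h: "h \<noteq> 0" "iota h * (inv_vandermonde k * iota p) = iota g"
    "TT ^ order 0 (dilate ?s h) dvd dilate ?s g"
    using assms(1) by (auto simp: regular_def)
  have "iota (h * p) = inv_vandermonde k * iota (const (vandermonde ^ k)) * iota (h * p)"
    by (simp only: inv_vandermonde mult_1)
  also have "\<dots> = iota (const (vandermonde ^ k)) * (iota h * (inv_vandermonde k * iota p))"
    by (simp only: rhom_mult[OF rhom_iota] mult_ac)
  also have "\<dots> = iota (const (vandermonde ^ k) * g)"
    by (simp only: h(2) rhom_mult[OF rhom_iota])
  finally have hp: "h * p = const vandermonde ^ k * g"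
    by (simp only: iota_eq_iff rhom_power[OF rhom_const])
  have "TT dvd dilate ?s (const vandermonde)"
  proof -
    \<comment> \<open>\<Delta> contains the difference in increasing order only, so it matches up to
      sign.\<close>
    have "(if i < j then xx i - xx j else xx j - xx i) dvd (const vandermonde :: 'n pxy)"
      unfolding const_vandermonde
      using assms(2) dvd_prodI[of "{(i, j). i < j}" "(i, j)" "\<lambda>(i, j). xx i - xx j :: 'n pxy"]
        dvd_prodI[of "{(i, j). i < j}" "(j, i)" "\<lambda>(i, j). xx i - xx j :: 'n pxy"] by auto
    then have "xx i - xx j dvd (const vandermonde :: 'n pxy)"
      by (metis minus_diff_eq minus_dvd_iff)
    then have "dilate ?s (xx i - xx j) dvd dilate ?s (const vandermonde)"
      by (rule rhom_dvd[OF rhom_dilate])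
    moreover have "TT dvd dilate ?s (xx i - xx j)" by (simp add: dilate_xx_diff[OF assms(2)] TT_dvd_iff)
    ultimately show ?thesis by (rule dvd_trans[rotated])
  qed
  then have "TT ^ k * TT ^ order 0 (dilate ?s h) dvd dilate ?s (const vandermonde) ^ k * dilate ?s g"
    by (intro mult_dvd_mono dvd_power_same h(3))
  then have "TT ^ (order 0 (dilate ?s h) + k) dvd dilate ?s h * dilate ?s p"
    by (simp only: power_add mult.commute[of "TT ^ k"] flip: rhom_mult[OF rhom_dilate] rhom_power[OF rhom_dilate] hp)
  then show ?thesis
    by (rule TT_power_dvd_cancel[rotated]) (simp only: dilate_eq_0_iff h(1) not_False_eq_True)
qed

lemma vanishing_if_HTZ:
  assumes "emb k r \<in> HTZ"
  shows "vanishing k r"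
  unfolding vanishing_def
proof (intro allI impI conjI)
  fix i j \<sigma>
  assume ij: "i \<noteq> (j :: 'a)"
  let ?s = "\<langle>i \<leftrightarrow> j\<rangle>" and ?d = "xx i - xx j :: 'a pxy"
  note l = locD[OF loc_HTZ[OF assms] ij, of \<sigma>]
  have "iota ?d * smash_coeff (emb k r) \<sigma> = inv_vandermonde k * iota (?d * r \<sigma>)"
    by (simp only: smash_coeff_emb rhom_mult[OF rhom_iota] mult_ac)
  with l(1) have "TT ^ k dvd dilate ?s (?d * r \<sigma>)"
    by (intro regular_imp_TT_dvd[OF _ ij]) simp
  moreover have "dilate ?s (?d * r \<sigma>) = [:?d:] * (TT * dilate ?s (r \<sigma>))"
    by (simp add: rhom_mult[OF rhom_dilate] dilate_xx_diff[OF ij] del: mult_pCons_left)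
  \<comment> \<open>x_i - x_j dilates to T times a nonzero constant in T; the constant cancels and
    the T is the extra factor in \<open>vanishing\<close>.\<close>
  moreover have "order 0 [:?d:] = 0" "[:?d:] \<noteq> 0" using ij by (simp_all add: order_0I)
  ultimately show "TT ^ k dvd TT * dilate ?s (r \<sigma>)"
    using TT_power_dvd_cancel[of "[:?d:]" k "TT * dilate ?s (r \<sigma>)"] by (simp del: mult_pCons_left)
  have "smash_coeff (emb k r) \<sigma> + smash_coeff (emb k r) (?s * \<sigma>) = inv_vandermonde k * iota (r \<sigma> + r (?s * \<sigma>))"
    by (simp only: smash_coeff_emb rhom_add[OF rhom_iota] distrib_left)
  with l(2) show "TT ^ k dvd dilate ?s (r \<sigma> + r (?s * \<sigma>))"
    by (intro regular_imp_TT_dvd[OF _ ij]) simp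
qed

lemma smash_expand: "v = (\<Sum>\<sigma>\<in>UNIV. of_ratpol (smash_coeff v \<sigma>) * of_perm \<sigma>)"
  for v :: "'n::{finite,linorder} smash"
proof (rule smash_eqI)
  fix \<tau> :: "'n perm"
  have "smash_coeff (sum f A) \<tau> = (\<Sum>\<sigma>\<in>A. smash_coeff (f \<sigma>) \<tau>)" for f :: "'n perm \<Rightarrow> 'n smash" and A
    by (induction A rule: infinite_finite_induct) simp_all
  then have "smash_coeff (\<Sum>\<sigma>\<in>UNIV. of_ratpol (smash_coeff v \<sigma>) * of_perm \<sigma>) \<tau> =
      (\<Sum>\<sigma>\<in>UNIV. if \<tau> = \<sigma> then smash_coeff v \<sigma> else 0)"
    by (simp only: coeff_of_ratpol_times) (intro sum.cong; simp add: of_perm_def)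
  then show "smash_coeff v \<tau> = smash_coeff (\<Sum>\<sigma>\<in>UNIV. of_ratpol (smash_coeff v \<sigma>) * of_perm \<sigma>) \<tau>"
    by simp
qed

lemma HTZ_if_vanishing:
  fixes r :: "'n::{finite,linorder} perm \<Rightarrow> 'n pxy"
  assumes r: "vanishing k r"
  shows "emb k r \<in> HTZ"
proof (rule HTZ_by_symmetrizer)
  fix p :: "'n polx"
  \<comment> \<open>\<open>R\<close> is \<Delta>^k v(p) for v = \<open>emb k r\<close>.\<close>
  define R where "R = (\<Sum>\<sigma>\<in>UNIV. r \<sigma> * pperm \<sigma> (const p))"
  have "TT ^ k dvd dilate \<langle>i \<leftrightarrow> j\<rangle> R" if ij: "i \<noteq> j" for i j
  proof -
    let ?s = "\<langle>i \<leftrightarrow> j\<rangle>"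
    let ?a = "\<lambda>\<sigma>. pperm \<sigma> (const p) :: 'n pxy"
    have "(\<Sum>\<sigma>\<in>UNIV. r (?s * \<sigma>) * ?a (?s * \<sigma>)) = R"
      unfolding R_def
      by (rule sum.reindex_bij_witness[where i = "\<lambda>\<sigma>. ?s * \<sigma>" and j = "\<lambda>\<sigma>. ?s * \<sigma>"])
        (simp_all add: swap_swap)
    \<comment> \<open>Pairing \<sigma> with s\<sigma> over the whole group counts every term twice;
      the factor 2 is removed at the end.\<close>
    then have "R + R = (\<Sum>\<sigma>\<in>UNIV. r \<sigma> * ?a \<sigma> + r (?s * \<sigma>) * ?a (?s * \<sigma>))"
      by (simp only: sum.distrib R_def)
    \<comment> \<open>The first product has order k by the condition on sums. In the second, the
      coefficient has order k - 1 and the difference of \<open>?a\<close> supplies one more.\<close>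
    also have "\<dots> = (\<Sum>\<sigma>\<in>UNIV. (r \<sigma> + r (?s * \<sigma>)) * ?a \<sigma> - r (?s * \<sigma>) * (?a \<sigma> - pperm ?s (?a \<sigma>)))"
      by (rule sum.cong) (simp_all add: pperm_times algebra_simps)
    finally have RR: "dilate ?s (R + R) = (\<Sum>\<sigma>\<in>UNIV. dilate ?s (r \<sigma> + r (?s * \<sigma>)) * dilate ?s (?a \<sigma>) -
        dilate ?s (r (?s * \<sigma>)) * dilate ?s (?a \<sigma> - pperm ?s (?a \<sigma>)))"
      by (simp only: rhom_sum[OF rhom_dilate] rhom_diff[OF rhom_dilate, of _ "_ * _"] rhom_mult[OF rhom_dilate])
    have "TT ^ k dvd dilate ?s (R + R)"
      unfolding RR
    proof (intro dvd_sum dvd_diff)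
      fix \<sigma>
      show "TT ^ k dvd dilate ?s (r \<sigma> + r (?s * \<sigma>)) * dilate ?s (?a \<sigma>)"
        using r ij by (simp add: vanishing_def dvd_mult2)
      have "TT dvd dilate ?s (?a \<sigma> - pperm ?s (?a \<sigma>))"
        by (simp only: rhom_diff[OF rhom_dilate] dilate_pperm_swap TT_dvd_diff_minus_TT)
      then have "dilate ?s (r (?s * \<sigma>)) * TT dvd dilate ?s (r (?s * \<sigma>)) * dilate ?s (?a \<sigma> - pperm ?s (?a \<sigma>))"
        by (rule mult_dvd_mono[OF dvd_refl])
      moreover have "TT ^ k dvd TT * dilate ?s (r (?s * \<sigma>))"
        using r ij unfolding vanishing_def by blast
      ultimately show "TT ^ k dvd dilate ?s (r (?s * \<sigma>)) * dilate ?s (?a \<sigma> - pperm ?s (?a \<sigma>))"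
        unfolding mult.commute[of _ TT] by (rule dvd_trans[rotated])
    qed
    then have "TT ^ k dvd dilate ?s (cc (1/2)) * dilate ?s (R + R)" by (rule dvd_mult)
    moreover have "cc (1/2) * (R + R) = R"
      using cc_half[of R 0] by (simp add: algebra_simps)
    ultimately show ?thesis by (simp only: flip: rhom_mult[OF rhom_dilate])
  qed
  then have "of_ratpol (inv_vandermonde k * iota R) * symmetrizer UNIV \<in> HTZ"
    by (intro HTZ_mult HTZ_inv_vandermonde_mult HTZ_symmetrizer)
  also have "of_ratpol (inv_vandermonde k * iota R) * symmetrizer UNIV = emb k r * of_pol p * symmetrizer UNIV"
  proof -
    let ?q = "inv_vandermonde k"
    have "of_ratpol (?q * iota (r \<sigma>)) * of_perm \<sigma> * of_pol p * symmetrizer UNIV =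
        of_ratpol (?q * iota (r \<sigma> * pperm \<sigma> (const p))) * symmetrizer UNIV" for \<sigma>
    proof -
      have "of_perm \<sigma> * of_pol p = of_ratpol (iota (pperm \<sigma> (const p))) * (of_perm \<sigma> :: 'n smash)"
        by (simp add: of_pol_def of_ratx_def of_perm_of_ratpol perm_ratpol_iota flip: iota_const)
      then have "of_ratpol (?q * iota (r \<sigma>)) * of_perm \<sigma> * of_pol p * symmetrizer UNIV =
          of_ratpol (?q * iota (r \<sigma>)) * of_ratpol (iota (pperm \<sigma> (const p))) * (of_perm \<sigma> * symmetrizer UNIV)"
        by (simp only: mult.assoc)
      then show ?thesis
        by (simp only: of_perm_times_symmetrizer of_ratpol_mult rhom_mult[OF rhom_iota] mult.assoc)
    qed
    moreover have "emb k r = (\<Sum>\<sigma>\<in>UNIV. of_ratpol (?q * iota (r \<sigma>)) * of_perm \<sigma>)"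
      using smash_expand[of "emb k r"] by (simp only: smash_coeff_emb)
    ultimately have "emb k r * of_pol p * symmetrizer UNIV =
        (\<Sum>\<sigma>\<in>UNIV. of_ratpol (?q * iota (r \<sigma> * pperm \<sigma> (const p))) * symmetrizer UNIV)"
      by (simp only: sum_distrib_right)
    also have "\<dots> = of_ratpol (?q * iota R) * symmetrizer UNIV"
      by (simp only: R_def rhom_sum[OF rhom_iota] sum_distrib_left of_ratpol_sum sum_distrib_right)
    finally show ?thesis ..
  qed
  finally show "emb k r * of_pol p * symmetrizer UNIV \<in> HTZ" .
qed

lemma polynomial_partE:
  assumes "w \<in> polynomial_part"
  obtains r where "w = Smash (\<lambda>\<sigma>. iota (r \<sigma>))"
proof
  have "\<exists>p. Poly_Mapping.lookup (smash_coeff w \<sigma>) m = to_ratx p" for \<sigma> m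
    using assms by (simp add: polynomial_part_def)
  then have *: "to_ratx (inv to_ratx (Poly_Mapping.lookup (smash_coeff w \<sigma>) m)) =
      Poly_Mapping.lookup (smash_coeff w \<sigma>) m" for \<sigma> m
    by (metis f_inv_into_f rangeI)
  \<comment> \<open>\<open>Poly_Mapping.map\<close> keeps zero coefficients at 0, so it agrees with
    the chosen inverse only if that inverse sends 0 to 0.\<close>
  have "inv to_ratx (0 :: 'a ratx) = 0"
    by (metis inv_f_f injI to_ratx_eq_iff to_ratx_0)
  then have "Poly_Mapping.lookup (Poly_Mapping.map (inv to_ratx) (smash_coeff w \<sigma>)) m =
      inv to_ratx (Poly_Mapping.lookup (smash_coeff w \<sigma>) m)" for \<sigma> m
    by (simp add: map.rep_eq when_def)
  with * have "iota (Poly_Mapping.map (inv to_ratx) (smash_coeff w \<sigma>)) = smash_coeff w \<sigma>" for \<sigma>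
    by (intro poly_mapping_eqI) simp
  then show "w = Smash (\<lambda>\<sigma>. iota (Poly_Mapping.map (inv to_ratx) (smash_coeff w \<sigma>)))"
    by (intro smash_eqI) simp
qed

lemma emb_in_M_mod_iff: "emb k r \<in> M_mod k \<longleftrightarrow> vanishing k r"
proof
  assume "emb k r \<in> M_mod k"
  then show "vanishing k r" by (intro vanishing_if_HTZ) (simp add: M_mod_def)
next
  assume "vanishing k r"
  moreover have "Smash (\<lambda>\<sigma>. iota (r \<sigma>)) \<in> polynomial_part"
    by (auto simp: polynomial_part_def)
  ultimately show "emb k r \<in> M_mod k"
    by (auto simp: M_mod_def HTZ_if_vanishing) (simp add: emb_def of_ratx_def)
qed

lemma M_modE:
  assumes "v \<in> M_mod k"
  obtains r where "v = emb k r" "vanishing k r"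
proof -
  obtain w where "w \<in> polynomial_part" "v = of_ratpol (inv_vandermonde k) * w"
    using assms by (auto simp: M_mod_def of_ratx_def)
  with polynomial_partE[of w] have "\<exists>r. v = emb k r" by (metis emb_def)
  with that assms emb_in_M_mod_iff show thesis by blast
qed

section \<open>The action and the bigrading\<close>

lemma vanishing_add: "vanishing k r \<Longrightarrow> vanishing k r' \<Longrightarrow> vanishing k (\<lambda>\<sigma>. r \<sigma> + r' \<sigma>)"
  unfolding vanishing_def
proof (intro allI impI conjI)
  fix i j :: 'a and \<sigma>
  let ?s = "\<langle>i \<leftrightarrow> j\<rangle>"
  assume *: "\<forall>i j \<sigma>. i \<noteq> j \<longrightarrow> TT ^ k dvd TT * dilate \<langle>i \<leftrightarrow> j\<rangle> (r \<sigma>) \<and> TT ^ k dvd dilate \<langle>i \<leftrightarrow> j\<rangle> (r \<sigma> + r (\<langle>i \<leftrightarrow> j\<rangle> * \<sigma>))"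
    "\<forall>i j \<sigma>. i \<noteq> j \<longrightarrow> TT ^ k dvd TT * dilate \<langle>i \<leftrightarrow> j\<rangle> (r' \<sigma>) \<and> TT ^ k dvd dilate \<langle>i \<leftrightarrow> j\<rangle> (r' \<sigma> + r' (\<langle>i \<leftrightarrow> j\<rangle> * \<sigma>))"
    "i \<noteq> j"
  then have "TT ^ k dvd TT * dilate ?s (r \<sigma>) + TT * dilate ?s (r' \<sigma>)"
    by (intro dvd_add) blast+
  then show "TT ^ k dvd TT * dilate ?s (r \<sigma> + r' \<sigma>)"
    by (simp only: rhom_add[OF rhom_dilate] distrib_left)
  have "TT ^ k dvd dilate ?s (r \<sigma> + r (?s * \<sigma>)) + dilate ?s (r' \<sigma> + r' (?s * \<sigma>))"
    using * by (intro dvd_add) blast+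
  then show "TT ^ k dvd dilate ?s (r \<sigma> + r' \<sigma> + (r (?s * \<sigma>) + r' (?s * \<sigma>)))"
    by (simp only: rhom_add[OF rhom_dilate] add_ac)
qed

lemma vanishing_mult: "vanishing k r \<Longrightarrow> vanishing k (\<lambda>\<sigma>. c * r \<sigma>)"
  unfolding vanishing_def distrib_left[symmetric] rhom_mult[OF rhom_dilate, of _ c] mult.left_commute[of TT]
  by (blast intro: dvd_mult)

lemma vanishing_0: "vanishing k (\<lambda>\<sigma>. 0)"
  by (simp add: vanishing_def rhom_0[OF rhom_dilate])

lemma vanishing_sum:
  "(\<And>a. a \<in> A \<Longrightarrow> vanishing k (r a)) \<Longrightarrow> vanishing k (\<lambda>\<sigma>. \<Sum>a\<in>A. r a \<sigma>)"
  by (induction A rule: infinite_finite_induct) (auto intro: vanishing_0 vanishing_add)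

text \<open>The ideals of the diagonals are stable under GL_2. The case split on \<open>k\<close>
  cancels the auxiliary T before the order is transported.\<close>

lemma vanishing_gl:
  fixes r :: "'n::{finite,linorder} perm \<Rightarrow> 'n pxy"
  assumes "vanishing k r"
  shows "vanishing k (\<lambda>\<sigma>. gl g (r \<sigma>))"
proof -
  have "TT ^ k dvd TT * dilate s (gl g p)" if "TT ^ k dvd TT * dilate s p" for s and p :: "'n pxy"
  proof (cases k)
    case (Suc m)
    have TT: "(TT :: 'n pxy poly) \<noteq> 0" by simp
    then have "TT ^ m dvd dilate s p"
      using that unfolding Suc power_Suc by (metis dvd_mult_cancel_left)
    from TT_dvd_dilate_gl[OF this] show ?thesis
      unfolding Suc power_Suc by (rule mult_dvd_mono[OF dvd_refl])
  qed simp
  then show ?thesis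
    using assms unfolding vanishing_def rhom_add[OF rhom_gl, symmetric]
    by (blast intro: TT_dvd_dilate_gl)
qed

text \<open>GL_2 acts on the coefficients of \<Delta>^k v, not of v, which is the origin of the
  degree shift. Outside the range of \<open>emb k\<close> the inverse is arbitrary, but M_k lies
  inside that range.\<close>

definition gl_action :: "nat \<Rightarrow> complex^2^2 \<Rightarrow> 'n smash \<Rightarrow> 'n::{finite,linorder} smash" where
  "gl_action k g v = emb k (\<lambda>\<sigma>. gl g (inv (emb k) v \<sigma>))"

lemma inv_emb [simp]: "inv (emb k) (emb k r) = r"
  by (rule inv_f_f) (simp add: inj_def)

lemma gl_action_emb: "gl_action k g (emb k r) = emb k (\<lambda>\<sigma>. gl g (r \<sigma>))"
  by (simp add: gl_action_def)

lemma emb_add: "emb k r + emb k r' = emb k (\<lambda>\<sigma>. r \<sigma> + r' \<sigma>)"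
  by (rule smash_eqI) (simp add: smash_coeff_emb rhom_add[OF rhom_iota] distrib_left)

lemma iota_mult_emb: "of_ratpol (iota c) * emb k r = emb k (\<lambda>\<sigma>. c * r \<sigma>)"
  by (rule smash_eqI)
    (simp add: smash_coeff_emb rhom_mult[OF rhom_iota] coeff_of_ratpol_times mult_ac)

lemma of_cplx_mult_emb: "of_cplx c * emb k r = emb k (\<lambda>\<sigma>. cc c * r \<sigma>)"
  by (simp only: of_cplx_eq iota_mult_emb)

lemma xvar_mult_emb: "xvar i * emb k r = emb k (\<lambda>\<sigma>. xx i * r \<sigma>)"
  by (simp add: xvar_eq of_ratx_def iota_mult_emb flip: iota_xx)

lemma yvar_mult_emb: "yvar i * emb k r = emb k (\<lambda>\<sigma>. yy i * r \<sigma>)"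
  by (simp add: yvar_def iota_mult_emb flip: iota_yy)

lemma emb_sum: "(\<Sum>a\<in>A. emb k (r a)) = emb k (\<lambda>\<sigma>. \<Sum>a\<in>A. r a \<sigma>)"
proof (induction A rule: infinite_finite_induct)
  case (insert a A)
  then show ?case by (simp add: emb_add)
qed (auto intro!: smash_eqI simp: smash_coeff_emb rhom_0[OF rhom_iota])

lemma GL2_action_gl_action: "GL2_action (M_mod k) (gl_action k)"
  unfolding GL2_action_def
proof (intro conjI allI impI ballI)
  fix g h :: "complex^2^2" and v w :: "'a smash" and c :: complex
  assume "v \<in> M_mod k"
  then obtain r where r: "v = emb k r" "vanishing k r" by (rule M_modE)
  show "gl_action k g v \<in> M_mod k"
    using r by (simp add: gl_action_emb emb_in_M_mod_iff vanishing_gl)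
  show "gl_action k g (of_cplx c * v) = of_cplx c * gl_action k g v"
    by (simp add: r gl_action_emb of_cplx_mult_emb rhom_mult[OF rhom_gl] gl_gen)
  show "gl_action k (mat 1) v = v"
    by (simp add: r gl_action_emb gl_mat_1)
  show "gl_action k (g ** h) v = gl_action k g (gl_action k h v)"
    by (simp add: r gl_action_emb gl_times)
  assume "w \<in> M_mod k"
  then obtain r' where r': "w = emb k r'" by (rule M_modE)
  show "gl_action k g (v + w) = gl_action k g v + gl_action k g w"
    by (simp add: r r' gl_action_emb emb_add rhom_add[OF rhom_gl])
qed

section \<open>The coordinate swap and the weights of the diagonal torus\<close>

lemma mat2_nth [simp]:
  "mat2 a b c d $ 1 $ 1 = a" "mat2 a b c d $ 1 $ 2 = b"
  "mat2 a b c d $ 2 $ 1 = c" "mat2 a b c d $ 2 $ 2 = d"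
  by (simp_all add: mat2_def)

lemma gl_swap_conj: "gl (mat2 0 1 1 0) (xx i * gl (mat2 0 1 1 0) r) = yy i * r"
proof -
  have "mat2 0 1 1 0 ** mat2 0 1 1 0 = (mat 1 :: complex^2^2)"
    by (simp add: vec_eq_iff forall_2 matrix_matrix_mult_def sum_2 mat_def)
  then have "gl (mat2 0 1 1 0) (gl (mat2 0 1 1 0) r) = r"
    by (simp add: gl_mat_1 flip: gl_times)
  then show ?thesis
    by (simp add: rhom_mult[OF rhom_gl] gl_gen rhom_0[OF rhom_cc] rhom_1[OF rhom_cc])
qed

lemma lookup_const_mult: "Poly_Mapping.lookup (const c * p) m = c * Poly_Mapping.lookup p m"
  for c :: "'c::comm_ring_1"
  by (simp add: const_def map.rep_eq when_def flip: mult_map_scale_conv_mult)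

lemma lookup_cc_mult:
  "Poly_Mapping.lookup (Poly_Mapping.lookup (cc c * r) m) l = c * Poly_Mapping.lookup (Poly_Mapping.lookup r m) l"
  by (simp add: cc_def lookup_const_mult)

lemma gl_diag_single:
  "gl (mat2 t 0 0 u) (Poly_Mapping.single m (Poly_Mapping.single l z)) =
     cc (t ^ mdeg l * u ^ mdeg m) * Poly_Mapping.single m (Poly_Mapping.single l z)"
  for m l :: "'n::finite \<Rightarrow>\<^sub>0 nat"
proof -
  have x: "Poly_Mapping.single l z = const z * (\<Prod>i\<in>UNIV. var i ^ Poly_Mapping.lookup l i)"
    by (simp add: single_eq_const_times[of l z] single_eq_prod_var)
  have *: "Poly_Mapping.single m (Poly_Mapping.single l z) =
      cc z * (\<Prod>i\<in>UNIV. xx i ^ Poly_Mapping.lookup l i) * (\<Prod>i\<in>UNIV. yy i ^ Poly_Mapping.lookup m i)"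
    unfolding x single_eq_const_times[of m "const z * _"]
    by (simp add: single_eq_prod_var rhom_simps[OF rhom_const] cc_def xx_def yy_def)
  show ?thesis
    unfolding * mdeg_def
    by (simp add: rhom_simps[OF rhom_gl] gl_gen rhom_simps[OF rhom_cc] power_mult_distrib prod.distrib
        power_sum mult_ac)
qed

lemma lookup_gl_diag:
  "Poly_Mapping.lookup (Poly_Mapping.lookup (gl (mat2 t 0 0 u) r) m) l =
     t ^ mdeg l * u ^ mdeg m * Poly_Mapping.lookup (Poly_Mapping.lookup r m) l"
  for r :: "'n::finite pxy"
proof (induction r rule: pol_induct)
  case zero
  then show ?case by (simp add: rhom_0[OF rhom_gl])
next
  case (add m' c r)
  have "Poly_Mapping.lookup (Poly_Mapping.lookup (gl (mat2 t 0 0 u) (Poly_Mapping.single m' c)) m) l =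
     t ^ mdeg l * u ^ mdeg m * Poly_Mapping.lookup (Poly_Mapping.lookup (Poly_Mapping.single m' c) m) l"
  proof (induction c rule: pol_induct)
    case zero
    then show ?case by (simp add: rhom_0[OF rhom_gl])
  next
    case (add l' z c)
    then show ?case
      by (simp add: single_add rhom_add[OF rhom_gl] lookup_add gl_diag_single lookup_cc_mult distrib_left)
        (simp add: lookup_single when_def)
  qed
  with add show ?case by (simp add: rhom_add[OF rhom_gl] lookup_add distrib_left)
qed

definition bihom :: "nat \<Rightarrow> nat \<Rightarrow> 'n::finite pxy \<Rightarrow> bool" where
  "bihom a b r \<longleftrightarrow> (\<forall>m l. Poly_Mapping.lookup (Poly_Mapping.lookup r m) l \<noteq> 0 \<longrightarrow> mdeg l = a \<and> mdeg m = b)"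

lemma emb_in_M_bideg_iff:
  "emb k r \<in> M_bideg k a b \<longleftrightarrow> vanishing k r \<and> (\<forall>\<sigma>. bihom a b (r \<sigma>))"
proof -
  have "bihomogeneous a b (of_pol (vandermonde ^ k) * emb k r) \<longleftrightarrow> (\<forall>\<sigma>. bihom a b (r \<sigma>))"
  proof -
    have "(\<forall>m\<in>Poly_Mapping.keys (iota p). mdeg m = b \<and> (\<exists>q. homogeneous a q \<and> Poly_Mapping.lookup (iota p) m = to_ratx q)) \<longleftrightarrow>
        bihom a b p" (is "?L \<longleftrightarrow> ?R") for p :: "'a pxy"
    proof
      assume ?L
      then have *: "mdeg m = b \<and> homogeneous a (Poly_Mapping.lookup p m)" if "Poly_Mapping.lookup p m \<noteq> 0" for m
        using that by (auto simp: in_keys_iff)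
      show ?R
        unfolding bihom_def
      proof (intro allI impI)
        fix m l
        assume z: "Poly_Mapping.lookup (Poly_Mapping.lookup p m) l \<noteq> 0"
        then have "Poly_Mapping.lookup p m \<noteq> 0" by auto
        from *[OF this] z show "mdeg l = a \<and> mdeg m = b"
          by (auto simp: homogeneous_def in_keys_iff)
      qed
    next
      assume R: ?R
      show ?L
      proof
        fix m
        assume "m \<in> Poly_Mapping.keys (iota p)"
        then have "Poly_Mapping.lookup p m \<noteq> 0" by (simp add: in_keys_iff)
        then obtain l where "Poly_Mapping.lookup (Poly_Mapping.lookup p m) l \<noteq> 0"
          by (metis lookup_zero poly_mapping_eqI)
        moreover have "homogeneous a (Poly_Mapping.lookup p m)"
          using R by (auto simp: homogeneous_def bihom_def in_keys_iff)
        ultimately show "mdeg m = b \<and> (\<exists>q. homogeneous a q \<and> Poly_Mapping.lookup (iota p) m = to_ratx q)"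
          using R by (auto simp: bihom_def)
      qed
    qed
    then show ?thesis by (simp add: vandermonde_mult_emb bihomogeneous_def)
  qed
  then show ?thesis by (simp add: M_bideg_def emb_in_M_mod_iff)
qed

lemma bihom_iff_weight:
  "bihom a b r \<longleftrightarrow> (\<forall>t u. t \<noteq> 0 \<longrightarrow> u \<noteq> 0 \<longrightarrow> gl (mat2 t 0 0 u) r = cc (t ^ a * u ^ b) * r)"
  (is "_ \<longleftrightarrow> ?W")
proof
  assume "bihom a b r"
  then have "gl (mat2 t 0 0 u) r = cc (t ^ a * u ^ b) * r" for t u
    by (intro poly_mapping_eqI) (auto simp: lookup_gl_diag lookup_cc_mult bihom_def)
  then show ?W by simp
next
  assume W: ?W
  have pow: "k = l" if "(2 :: complex) ^ k = 2 ^ l" for k l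
  proof -
    have "(2 :: real) ^ k = 2 ^ l" using arg_cong[OF that, of norm] by (simp add: norm_power)
    then show ?thesis by simp
  qed
  show "bihom a b r"
    unfolding bihom_def
  proof (intro allI impI)
    fix m l
    let ?z = "Poly_Mapping.lookup (Poly_Mapping.lookup r m) l"
    assume z: "?z \<noteq> 0"
    have "t ^ mdeg l * u ^ mdeg m * ?z = t ^ a * u ^ b * ?z" if "t \<noteq> 0" "u \<noteq> 0" for t u
      using W that lookup_gl_diag[of t u r m l] by (auto simp: lookup_cc_mult)
    with z have "t ^ mdeg l * u ^ mdeg m = t ^ a * u ^ b" if "t \<noteq> 0" "u \<noteq> 0" for t u :: complex
      using that by simp
    \<comment> \<open>Powers of 2 are pairwise distinct, so these two torus elements already
      separate all bidegrees.\<close>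
    from this[of 2 1] this[of 1 2] show "mdeg l = a \<and> mdeg m = b"
      by (simp add: pow)
  qed
qed

text \<open>A geometric sum whose ratio is an N-th root of unity vanishes unless the ratio is
  1.\<close>

lemma sum_root_of_unity_powers:
  assumes "0 < N"
  defines "\<omega> \<equiv> exp (2 * of_real pi * \<i> * (of_nat 1 / of_nat N))"
  shows "(\<Sum>p<N. (\<omega> ^ p) ^ e) = (if N dvd e then of_nat N else 0)"
proof -
  have pow: "\<omega> ^ e = exp (2 * of_real pi * \<i> * (of_nat e / of_nat N))"
    by (simp add: \<omega>_def mult_ac flip: exp_of_nat_mult)
  have 1: "\<omega> ^ e = 1 \<longleftrightarrow> N dvd e"
    unfolding pow using assms(1) complex_root_unity_eq_1[of N e] by simp
  have "\<omega> ^ N = 1"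
    using assms(1) by (simp add: \<omega>_def flip: exp_of_nat_mult)
  then have N: "(\<omega> ^ e) ^ N = 1" by (metis power_commutes power_mult power_one mult.commute)
  have "(\<Sum>p<N. (\<omega> ^ p) ^ e) = (\<Sum>p<N. (\<omega> ^ e) ^ p)"
    by (simp add: mult.commute flip: power_mult)
  also have "\<dots> = (if N dvd e then of_nat N else 0)"
    using 1 N by (auto simp: sum_gp_strict)
  finally show ?thesis .
qed

text \<open>Fourier inversion over the \<open>N\<close>-torsion of the diagonal torus extracts the bihomogeneous part.\<close>

lemma vanishing_bihom_component:
  fixes r :: "'n::{finite,linorder} perm \<Rightarrow> 'n pxy"
  assumes r: "vanishing k r" and ab: "a < N" "b < N"
    and N: "\<And>\<sigma> m l. Poly_Mapping.lookup (Poly_Mapping.lookup (r \<sigma>) m) l \<noteq> 0 \<Longrightarrow> mdeg l < N \<and> mdeg m < N"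
  obtains c where "vanishing k c"
    "\<And>\<sigma> m l. Poly_Mapping.lookup (Poly_Mapping.lookup (c \<sigma>) m) l =
       (if mdeg l = a \<and> mdeg m = b then Poly_Mapping.lookup (Poly_Mapping.lookup (r \<sigma>) m) l else 0)"
proof
  define \<omega> :: complex where "\<omega> = exp (2 * of_real pi * \<i> * (of_nat 1 / of_nat N))"
  \<comment> \<open>The exponents N - a and N - b stand for -a and -b modulo N; division by N^2
    normalizes the double sum.\<close>
  let ?c = "\<lambda>\<sigma>. \<Sum>p<N. \<Sum>q<N. cc ((\<omega> ^ p) ^ (N - a) * (\<omega> ^ q) ^ (N - b) / of_nat N ^ 2) *
    gl (mat2 (\<omega> ^ p) 0 0 (\<omega> ^ q)) (r \<sigma>)"
  show "vanishing k ?c"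
    by (intro vanishing_sum vanishing_mult vanishing_gl r)
  have N0: "0 < N" using ab by simp
  fix \<sigma> m l
  let ?z = "Poly_Mapping.lookup (Poly_Mapping.lookup (r \<sigma>) m) l"
  have "Poly_Mapping.lookup (Poly_Mapping.lookup (?c \<sigma>) m) l =
      (\<Sum>p<N. \<Sum>q<N. (\<omega> ^ p) ^ (mdeg l + (N - a)) * (\<omega> ^ q) ^ (mdeg m + (N - b)) * (?z / of_nat N ^ 2))"
    unfolding lookup_sum lookup_cc_mult lookup_gl_diag by (simp add: power_add mult_ac)
  also have "\<dots> = (\<Sum>p<N. (\<omega> ^ p) ^ (mdeg l + (N - a))) * (\<Sum>q<N. (\<omega> ^ q) ^ (mdeg m + (N - b))) * (?z / of_nat N ^ 2)"
    unfolding sum_product by (simp only: sum_distrib_right)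
  also have "\<dots> = (if mdeg l = a \<and> mdeg m = b then ?z else 0)"
  proof (cases "?z = 0")
    case False
    \<comment> \<open>Both degrees are below N, so d + (N - c) lies strictly between 0 and 2N; no
      two degrees are confused modulo N.\<close>
    have dvd: "N dvd d + (N - c) \<longleftrightarrow> d = c" if "d < N" "c < N" for c d
    proof
      assume "N dvd d + (N - c)"
      then obtain e where e: "d + (N - c) = N * e" by (auto simp: dvd_def)
      with that have "0 < N * e" "N * e < N * 2" by linarith+
      then have "e = 1" by simp
      with e that show "d = c" by simp
    qed (use that in auto)
    have "N dvd mdeg l + (N - a) \<longleftrightarrow> mdeg l = a" "N dvd mdeg m + (N - b) \<longleftrightarrow> mdeg m = b"
      using N[OF False] ab by (simp_all only: dvd)
    then show ?thesis
      using N0 unfolding \<omega>_def sum_root_of_unity_powers[OF N0]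
      by (simp only: power2_eq_square) simp
  qed simp
  finally show "Poly_Mapping.lookup (Poly_Mapping.lookup (?c \<sigma>) m) l = (if mdeg l = a \<and> mdeg m = b then ?z else 0)" .
qed

lemma M_mod_decomposition:
  fixes v :: "'n::{finite,linorder} smash"
  assumes "v \<in> M_mod k"
  shows "\<exists>D f. finite D \<and> (\<forall>(a, b)\<in>D. f a b \<in> M_bideg k a b) \<and> v = (\<Sum>(a, b)\<in>D. f a b)"
proof -
  obtain r where r: "v = emb k r" "vanishing k r" using assms by (rule M_modE)
  define E where "E = (\<Union>\<sigma>. \<Union>m\<in>Poly_Mapping.keys (r \<sigma>).
    \<Union>l\<in>Poly_Mapping.keys (Poly_Mapping.lookup (r \<sigma>) m). {mdeg l, mdeg m})"
  have "finite E" by (simp add: E_def)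
  \<comment> \<open>Larger than every x-degree and y-degree that occurs; the inserted 0 keeps the
    maximum defined when \<open>r\<close> is zero.\<close>
  define N where "N = Suc (Max (insert 0 E))"
  have N: "mdeg l < N \<and> mdeg m < N" if "Poly_Mapping.lookup (Poly_Mapping.lookup (r \<sigma>) m) l \<noteq> 0" for \<sigma> m l
  proof -
    have "Poly_Mapping.lookup (r \<sigma>) m \<noteq> 0" using that by auto
    with that have "m \<in> Poly_Mapping.keys (r \<sigma>)" "l \<in> Poly_Mapping.keys (Poly_Mapping.lookup (r \<sigma>) m)"
      by (simp_all add: in_keys_iff)
    then have "mdeg l \<in> E" "mdeg m \<in> E" unfolding E_def by blast+
    then show ?thesis using \<open>finite E\<close> by (auto simp: N_def less_Suc_eq_le)
  qed
  define part where "part a b c \<longleftrightarrow> vanishing k c \<and> (\<forall>\<sigma> m l. Poly_Mapping.lookup (Poly_Mapping.lookup (c \<sigma>) m) l =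
      (if mdeg l = a \<and> mdeg m = b then Poly_Mapping.lookup (Poly_Mapping.lookup (r \<sigma>) m) l else 0))" for a b c
  have "\<exists>c. part a b c" if "a < N" "b < N" for a b
    unfolding part_def by (rule vanishing_bihom_component[OF r(2) that N]) blast+
  then have "part a b (SOME c. part a b c)" if "a < N" "b < N" for a b
    using that someI_ex[of "part a b"] by blast
  moreover define c where "c a b = (SOME c. part a b c)" for a b
  ultimately have c: "vanishing k (c a b)"
    "Poly_Mapping.lookup (Poly_Mapping.lookup (c a b \<sigma>) m) l =
       (if mdeg l = a \<and> mdeg m = b then Poly_Mapping.lookup (Poly_Mapping.lookup (r \<sigma>) m) l else 0)"
    if "a < N" "b < N" for a b \<sigma> m l
    using that by (simp_all add: part_def)
  let ?D = "{..<N} \<times> {..<N}"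
  have "r = (\<lambda>\<sigma>. \<Sum>(a, b)\<in>?D. c a b \<sigma>)"
  proof (intro ext poly_mapping_eqI)
    fix \<sigma> m l
    let ?z = "Poly_Mapping.lookup (Poly_Mapping.lookup (r \<sigma>) m) l"
    have "Poly_Mapping.lookup (Poly_Mapping.lookup (\<Sum>(a, b)\<in>?D. c a b \<sigma>) m) l =
        (\<Sum>x\<in>?D. if x = (mdeg l, mdeg m) then ?z else 0)"
      unfolding lookup_sum by (intro sum.cong) (auto simp: c(2) split: if_splits)
    also have "\<dots> = ?z"
      using N[of \<sigma> m l] by auto
    finally show "?z = Poly_Mapping.lookup (Poly_Mapping.lookup (\<Sum>(a, b)\<in>?D. c a b \<sigma>) m) l" ..
  qed
  then have "v = (\<Sum>(a, b)\<in>?D. emb k (c a b))"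
    by (simp add: r(1) case_prod_unfold emb_sum)
  moreover have "emb k (c a b) \<in> M_bideg k a b" if "a < N" "b < N" for a b
    using that by (auto simp: emb_in_M_bideg_iff bihom_def c)
  ultimately show ?thesis
    by (intro exI[of _ ?D] exI[of _ "\<lambda>a b. emb k (c a b)"]) auto
qed

lemma torus_bigrading_gl_action: "torus_bigrading k (gl_action k)"
  unfolding torus_bigrading_def
proof (intro conjI allI ballI M_mod_decomposition)
  fix a b
  show "M_bideg k a b = {v \<in> M_mod k. \<forall>t u. t \<noteq> 0 \<longrightarrow> u \<noteq> 0 \<longrightarrow>
      gl_action k (mat2 t 0 0 u) v = of_cplx (t ^ a * u ^ b) * (v :: 'a smash)}"
    (is "_ = {v \<in> M_mod k. ?W v}")
  proof -
    have "v \<in> M_bideg k a b \<longleftrightarrow> ?W v" if v: "v \<in> M_mod k" for v :: "'a smash"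
    proof -
      obtain r where r: "v = emb k r" "vanishing k r" using v by (rule M_modE)
      show ?thesis
        by (auto simp: r emb_in_M_bideg_iff bihom_iff_weight gl_action_emb of_cplx_mult_emb fun_eq_iff)
    qed
    moreover have "M_bideg k a b \<subseteq> (M_mod k :: 'a smash set)" by (auto simp: M_bideg_def)
    ultimately show ?thesis by blast
  qed
qed

theorem theorem6p2:
  fixes k :: nat
  assumes "k \<ge> 1"
  shows "\<exists>\<rho> :: complex^2^2 \<Rightarrow> 'n::{finite,linorder} smash \<Rightarrow> 'n smash.
    GL2_action (M_mod k) \<rho> \<and>
    torus_bigrading k \<rho> \<and>
    (\<forall>i. \<forall>v\<in>M_mod k. \<rho> (mat2 0 1 1 0) (xvar i * \<rho> (mat2 0 1 1 0) v) = yvar i * v)"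
proof (intro exI conjI allI ballI)
  show "GL2_action (M_mod k) (gl_action k)" by (rule GL2_action_gl_action)
  show "torus_bigrading k (gl_action k)" by (rule torus_bigrading_gl_action)
  fix i and v :: "'n smash"
  assume "v \<in> M_mod k"
  then obtain r where "v = emb k r" by (rule M_modE)
  then show "gl_action k (mat2 0 1 1 0) (xvar i * gl_action k (mat2 0 1 1 0) v) = yvar i * v"
    by (simp add: gl_action_emb xvar_mult_emb yvar_mult_emb gl_swap_conj)
qed

end
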